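(* Let $\mathcal V^\omega$ be an oplax monoidal category. The 2-functor from the 2-category of $\mathcal V$-modules, lax morphisms and natural transformations of such, to the 2-category of (lax) $\mathcal V$-$\delta$modules, oplax functors and natural transformations, which sends a $\mathcal V$-module $\mathcal M^\rho$ to the $\mathcal V$-$\delta$module with underlying category $\mathcal M$ and $R^n(\mathbf a,x;y)=\mathcal M(\rho^n(\mathbf a,x),y)$, induces a 2-equivalence $$\mathcal V\text{-}\mathsf{mod}_{\mathrm{lax}}\ \simeq\ \mathsf{left\ rep.}\ \mathcal V\text{-}\delta\mathsf{mod}^{\mathrm{fun}}_{\mathrm{oplax}}$$ onto the full sub-2-category of left representable $\mathcal V$-$\delta$modules.
   Context: **Oplax monoidal category.** $\mathcal V^\omega$ is a category $\mathcal V$ with functors $\omega^n:\mathcal V^{n+1}\to\mathcal V$ ($n\ge-1$), natural transformations $\omega^{p+q}\to\omega^p(-,\omega^q,-)$ for $p\ge0,q\ge-1$ and each of the $p+1$ insertion positions, and a counit $\omega^0\to\mathrm{Id}$, such that: $\omega^p\to\omega^0\omega^p\to\omega^p$ and $\omega^p\to\omega^p(-,\omega^0,-)\to\omega^p$ are identities; the two composites $\omega^{p+q+r}\to\omega^p(-,\omega^q,-,\omega^r,-)$ agree; the two composites $\omega^{p+q+r}\to\omega^p(-,\omega^q(-,\omega^r,-),-)$ agree. **$\mathcal V$-module $\mathcal M^\rho$.** A category $\mathcal M$ with functors $\rho^n:\mathcal V^n\times\mathcal M\to\mathcal M$ ($n\ge0$), natural transformations $\rho^{p+q}\to\rho^p(-,\omega^q,-)$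 ($p\ge1$, $q\ge-1$, $\omega^q$ inserted in any of the $p$ $\mathcal V$-slots), $\rho^{p+q}\to\rho^p(-,\rho^q)$ ($p,q\ge0$, insertion in the $\mathcal M$-slot) and $\rho^0\to\mathrm{Id}_{\mathcal M}$, such that, whenever they make sense: the composites $\rho^p\to\rho^0\rho^p\to\rho^p$, $\rho^p\to\rho^p(-,\rho^0)\to\rho^p$, $\rho^p\to\rho^p(-,\omega^0,-)\to\rho^p$ are identities; the pairs of composites from $\rho^{p+q+r}$ to $\rho^p(-,\omega^q,-,\rho^r)$ and to $\rho^p(-,\omega^q,-,\omega^r,-)$ (performing the two insertions in either order) agree; the pairs of composites from $\rho^{p+q+r}$ to $\rho^p(-,\rho^q(-,\omega^r,-))$, to $\rho^p(-,\rho^q(-,\rho^r))$ and to $\rho^p(-,\omega^q(-,\omega^r,-),-)$ (inner insertion last or first) agree. A *lax morphism* $\mathcal M^\rho\to\mathcal N^\sigma$ is a functor $F$ with natural transformations $f^n:\sigma^n(-,F)\to F\rho^n$ ($n\ge0$) such that $\sigma^0F\to F\rho^0\to F$ is the counit; $\sigma^{p+q}(-,F)\to\sigma^p(-,\omega^q,-,F)\xrightarrow{f^p}F\rho^p(-,\omega^q,-)$ equals $\sigma^{p+q}(-,F)\xrightarrow{f^{p+q}}F\rho^{p+q}\to F\rho^p(-,\omega^q,-)$; and $\sigma^{p+q}(-,F)\to\sigma^p(-,\sigma^q(-,F))\xrightarrow{f^q}\sigma^p(-,F\rho^q)\xrightarrow{f^p}F\rho^p(-,\rho^q)$ equals $\sigma^{p+q}(-,F)\xrightarrow{f^{p+q}}F\rho^{p+q}\to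 F\rho^p(-,\rho^q)$. A natural transformation between lax morphisms $(F,f),(G,g)$ is a natural transformation $\alpha:F\Rightarrow G$ with $g^n\circ\sigma^n(-,\alpha)=\alpha_{\rho^n}\circ f^n$ for all $n\ge 0$. **$\mathcal V$-$\delta$module $\mathcal M^R$.** A category $\mathcal M$ with distributors $R^n:\mathcal V^n\times\mathcal M\nrightarrow\mathcal M$ ($n\ge0$), i.e. functors $(\mathcal V^n\times\mathcal M)^{\mathrm{op}}\times\mathcal M\to\mathsf{Sets}$ with values $R^n(a_1,\dots,a_n,x;y)$, together with natural maps (α) $R^p(\mathbf a,\omega^q(\mathbf b),\mathbf a',x;y)\to R^{p+q}(\mathbf a,\mathbf b,\mathbf a',x;y)$ for $p\ge1,q\ge-1$ and each position; (β) $R^p(-,R^q)\to R^{p+q}$ for $p,q\ge0$, where $R^p(-,R^q)(\mathbf a,\mathbf b,x;y)=\int_m R^p(\mathbf a,m;y)\times R^q(\mathbf b,x;m)$ is the coend over $m\in\mathcal M$; equivalently natural maps $R^p(\mathbf a,m;y)\times R^q(\mathbf b,x;m)\to R^{p+q}(\mathbf a,\mathbf b,x;y)$, extranatural in $m$; (ι) $\mathcal M(x,y)\to R^0(x;y)$. Axioms (whenever they make sense): β$(\iota(g),r)=g_*r$ and β$(r,\iota(f))=f^*r$ for $r\in R^p$ (action of morphisms of $\mathcal M$); $R^p(\mathbf a,v,\mathbf a',x;y)\to R^p(\mathbf a,\omega^0v,\mathbf a',x;y)\xrightarrow{\alpha}R^p(\mathbf a,v,\mathbf a',x;y)$ (first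 map induced by the counit) is the identity; applications of α in two distinct slots commute; α in the $R^p$-argument commutes with β; α in the $R^q$-argument commutes with β; applying α twice to $R^p(\mathbf a,\omega^q(\mathbf b,\omega^r(\mathbf c),\mathbf b'),\mathbf a',x;y)$ agrees with first restricting along $\omega^{q+r}\to\omega^q(-,\omega^r,-)$ and then applying α; β is associative. It is *left representable* if each $R^n$ is isomorphic to $\mathcal M(\rho^n(-),-)$ for some functor $\rho^n:\mathcal V^n\times\mathcal M\to\mathcal M$. An *oplax functor* $\mathcal M^R\to\mathcal N^S$ is a functor $F:\mathcal M\to\mathcal N$ with natural maps $f^p:R^p(\mathbf a,x;y)\to S^p(\mathbf a,Fx;Fy)$ ($p\ge0$) compatible with ι (i.e. $f^0\circ\iota=\iota\circ F$), with α and with β. A natural transformation $(F,f)\Rightarrow(G,g)$ is a natural transformation $\alpha:F\Rightarrow G$ such that $(\alpha_y)_*\circ f^p=(\alpha_x)^*\circ g^p:R^p(\mathbf a,x;y)\to S^p(\mathbf a,Fx;Gy)$ for all $p\ge0$. **The 2-functor.** On $\mathcal M^\rho$, the maps α, β, ι are obtained by precomposition with the structure transformations of $\rho$; a lax morphism $(F,\{f^n\})$ is sent to $F$ with maps $\mathcal M(\rho^p(\mathbf a,x),y)\xrightarrow{F}\mathcal N(F\rho^p(\mathbf a,x),Fy)\xrightarrow{(f^p)^*}\mathcal N(\sigma^p(\mathbf a,Fx),Fy)$; it is the identity on underlying natural transformations. *)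

theory Defs
  imports "HOL-Library.FuncSet"
begin

section \<open>Categories and functors\<close>

record ('o, 'a) cat =
  Obj :: "'o set"
  Arr :: "'a set"
  Dom :: "'a \<Rightarrow> 'o"
  Cod :: "'a \<Rightarrow> 'o"
  Ide :: "'o \<Rightarrow> 'a"
  Comp :: "'a \<Rightarrow> 'a \<Rightarrow> 'a"  (infixl \<open>\<cdot>\<index>\<close> 70)

definition hom :: "('o, 'a, 'z) cat_scheme \<Rightarrow> 'o \<Rightarrow> 'o \<Rightarrow> 'a set" where
  "hom C x y = {f \<in> Arr C. Dom C f = x \<and> Cod C f = y}"

locale category =
  fixes C :: "('o, 'a, 'z) cat_scheme" (structure)
  assumes dom_obj: "f \<in> Arr C \<Longrightarrow> Dom C f \<in> Obj C"
    and cod_obj: "f \<in> Arr C \<Longrightarrow> Cod C f \<in> Obj C"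
    and ide_hom: "x \<in> Obj C \<Longrightarrow> Ide C x \<in> hom C x x"
    and comp_hom: "f \<in> hom C x y \<Longrightarrow> g \<in> hom C y z \<Longrightarrow> g \<cdot> f \<in> hom C x z"
    and comp_ide_right: "f \<in> hom C x y \<Longrightarrow> f \<cdot> Ide C x = f"
    and comp_ide_left: "f \<in> hom C x y \<Longrightarrow> Ide C y \<cdot> f = f"
    and comp_assoc: "f \<in> hom C w x \<Longrightarrow> g \<in> hom C x y \<Longrightarrow> h \<in> hom C y z \<Longrightarrow>
                     (h \<cdot> g) \<cdot> f = h \<cdot> (g \<cdot> f)"

definition iso_in :: "('o, 'a, 'z) cat_scheme \<Rightarrow> 'a \<Rightarrow> bool" where
  "iso_in C f \<longleftrightarrow> f \<in> Arr C \<and>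
     (\<exists>g \<in> hom C (Cod C f) (Dom C f).
        g \<cdot>\<^bsub>C\<^esub> f = Ide C (Dom C f) \<and> f \<cdot>\<^bsub>C\<^esub> g = Ide C (Cod C f))"

locale cat_functor = C: category C + D: category D
  for C :: "('o, 'a, 'z) cat_scheme" and D :: "('p, 'b, 'y) cat_scheme" +
  fixes Fo :: "'o \<Rightarrow> 'p" and Fa :: "'a \<Rightarrow> 'b"
  assumes functor_obj: "x \<in> Obj C \<Longrightarrow> Fo x \<in> Obj D"
    and functor_hom: "f \<in> hom C x y \<Longrightarrow> Fa f \<in> hom D (Fo x) (Fo y)"
    and functor_ide: "x \<in> Obj C \<Longrightarrow> Fa (Ide C x) = Ide D (Fo x)"
    and functor_comp: "f \<in> hom C x y \<Longrightarrow> g \<in> hom C y z \<Longrightarrow>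
                       Fa (g \<cdot>\<^bsub>C\<^esub> f) = Fa g \<cdot>\<^bsub>D\<^esub> Fa f"

locale nat_trans = F: cat_functor C D Fo Fa + G: cat_functor C D Go Ga
  for C :: "('o, 'a, 'z) cat_scheme" and D :: "('p, 'b, 'y) cat_scheme"
    and Fo :: "'o \<Rightarrow> 'p" and Fa :: "'a \<Rightarrow> 'b" and Go :: "'o \<Rightarrow> 'p" and Ga :: "'a \<Rightarrow> 'b" +
  fixes \<tau> :: "'o \<Rightarrow> 'b"
  assumes component: "x \<in> Obj C \<Longrightarrow> \<tau> x \<in> hom D (Fo x) (Go x)"
    and naturality: "f \<in> hom C x y \<Longrightarrow> \<tau> y \<cdot>\<^bsub>D\<^esub> Fa f = Ga f \<cdot>\<^bsub>D\<^esub> \<tau> x"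

definition op_cat :: "('o, 'a, 'z) cat_scheme \<Rightarrow> ('o, 'a) cat" where
  "op_cat C = \<lparr>Obj = Obj C, Arr = Arr C, Dom = Cod C, Cod = Dom C, Ide = Ide C,
               Comp = (\<lambda>g f. f \<cdot>\<^bsub>C\<^esub> g)\<rparr>"

definition prod_cat ::
  "('o, 'a, 'z) cat_scheme \<Rightarrow> ('p, 'b, 'y) cat_scheme \<Rightarrow> ('o \<times> 'p, 'a \<times> 'b) cat" where
  "prod_cat C D = \<lparr>Obj = Obj C \<times> Obj D, Arr = Arr C \<times> Arr D,
     Dom = map_prod (Dom C) (Dom D), Cod = map_prod (Cod C) (Cod D),
     Ide = map_prod (Ide C) (Ide D),
     Comp = (\<lambda>(g, g') (f, f'). (g \<cdot>\<^bsub>C\<^esub> f, g' \<cdot>\<^bsub>D\<^esub> f'))\<rparr>"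

text \<open>The \<open>n\<close>-fold power of a category; its objects and arrows are lists of length \<open>n\<close>.\<close>

definition pow_cat :: "('o, 'a, 'z) cat_scheme \<Rightarrow> nat \<Rightarrow> ('o list, 'a list) cat" where
  "pow_cat C n = \<lparr>Obj = {as \<in> lists (Obj C). length as = n},
     Arr = {fs \<in> lists (Arr C). length fs = n},
     Dom = map (Dom C), Cod = map (Cod C), Ide = map (Ide C),
     Comp = map2 (Comp C)\<rparr>"

text \<open>Functors to \<open>Sets\<close>. Maps between sets are functions that only matter on their source.\<close>

locale set_functor = category C for C :: "('o, 'a, 'z) cat_scheme" +
  fixes X :: "'o \<Rightarrow> 'r set" and A :: "'a \<Rightarrow> 'r \<Rightarrow> 'r"
  assumes set_functor_map: "f \<in> hom C x y \<Longrightarrow> r \<in> X x \<Longrightarrow> A f r \<in> X y"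
    and set_functor_ide: "x \<in> Obj C \<Longrightarrow> r \<in> X x \<Longrightarrow> A (Ide C x) r = r"
    and set_functor_comp: "f \<in> hom C x y \<Longrightarrow> g \<in> hom C y z \<Longrightarrow> r \<in> X x \<Longrightarrow>
                           A (g \<cdot>\<^bsub>C\<^esub> f) r = A g (A f r)"

locale set_nat_iso = X: set_functor C X A + Y: set_functor C Y B
  for C :: "('o, 'a, 'z) cat_scheme"
    and X :: "'o \<Rightarrow> 'r set" and A :: "'a \<Rightarrow> 'r \<Rightarrow> 'r"
    and Y :: "'o \<Rightarrow> 's set" and B :: "'a \<Rightarrow> 's \<Rightarrow> 's" +
  fixes \<phi> :: "'o \<Rightarrow> 'r \<Rightarrow> 's"
  assumes bijective: "x \<in> Obj C \<Longrightarrow> bij_betw (\<phi> x) (X x) (Y x)"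
    and set_naturality: "f \<in> hom C x y \<Longrightarrow> r \<in> X x \<Longrightarrow> \<phi> y (A f r) = B f (\<phi> x r)"


section \<open>Strict 2-categories, 2-functors and 2-equivalences\<close>

record ('o, 'm, 'c) two_cat =
  Ob0 :: "'o set"
  Mor1 :: "'m set"
  Cell2 :: "'c set"
  src1 :: "'m \<Rightarrow> 'o"
  trg1 :: "'m \<Rightarrow> 'o"
  src2 :: "'c \<Rightarrow> 'm"
  trg2 :: "'c \<Rightarrow> 'm"
  id1 :: "'o \<Rightarrow> 'm"
  comp1 :: "'m \<Rightarrow> 'm \<Rightarrow> 'm"
  id2 :: "'m \<Rightarrow> 'c"
  vcomp :: "'c \<Rightarrow> 'c \<Rightarrow> 'c"
  hcomp :: "'c \<Rightarrow> 'c \<Rightarrow> 'c"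

definition one_cat :: "('o, 'm, 'c) two_cat \<Rightarrow> ('o, 'm) cat" where
  "one_cat T = \<lparr>Obj = Ob0 T, Arr = Mor1 T, Dom = src1 T, Cod = trg1 T,
                Ide = id1 T, Comp = comp1 T\<rparr>"

definition vert_cat :: "('o, 'm, 'c) two_cat \<Rightarrow> ('m, 'c) cat" where
  "vert_cat T = \<lparr>Obj = Mor1 T, Arr = Cell2 T, Dom = src2 T, Cod = trg2 T,
                 Ide = id2 T, Comp = vcomp T\<rparr>"

definition horiz_cat :: "('o, 'm, 'c) two_cat \<Rightarrow> ('o, 'c) cat" where
  "horiz_cat T = \<lparr>Obj = Ob0 T, Arr = Cell2 T,
                  Dom = (\<lambda>s. src1 T (src2 T s)), Cod = (\<lambda>s. trg1 T (src2 T s)),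
                  Ide = (\<lambda>x. id2 T (id1 T x)), Comp = hcomp T\<rparr>"

locale two_category =
  fixes T :: "('o, 'm, 'c) two_cat"
  assumes one_category: "category (one_cat T)"
    and vert_category: "category (vert_cat T)"
    and horiz_category: "category (horiz_cat T)"
    and globular_src: "s \<in> Cell2 T \<Longrightarrow> src1 T (src2 T s) = src1 T (trg2 T s)"
    and globular_trg: "s \<in> Cell2 T \<Longrightarrow> trg1 T (src2 T s) = trg1 T (trg2 T s)"
    and hcomp_bounds: "s \<in> hom (horiz_cat T) x y \<Longrightarrow> t \<in> hom (horiz_cat T) y z \<Longrightarrow>
           src2 T (hcomp T t s) = comp1 T (src2 T t) (src2 T s) \<and>
           trg2 T (hcomp T t s) = comp1 T (trg2 T t) (trg2 T s)"
    and hcomp_id2: "f \<in> hom (one_cat T) x y \<Longrightarrow> g \<in> hom (one_cat T) y z \<Longrightarrow>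
           hcomp T (id2 T g) (id2 T f) = id2 T (comp1 T g f)"
    and interchange:
      "s \<in> hom (vert_cat T) f f' \<Longrightarrow> s' \<in> hom (vert_cat T) f' f'' \<Longrightarrow>
       t \<in> hom (vert_cat T) g g' \<Longrightarrow> t' \<in> hom (vert_cat T) g' g'' \<Longrightarrow> trg1 T f = src1 T g \<Longrightarrow>
       hcomp T (vcomp T t' t) (vcomp T s' s) = vcomp T (hcomp T t' s') (hcomp T t s)"

definition full_sub_two_cat :: "('o \<Rightarrow> bool) \<Rightarrow> ('o, 'm, 'c) two_cat \<Rightarrow> ('o, 'm, 'c) two_cat" where
  "full_sub_two_cat P T = T\<lparr>
     Ob0 := {x \<in> Ob0 T. P x},
     Mor1 := {f \<in> Mor1 T. P (src1 T f) \<and> P (trg1 T f)},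
     Cell2 := {s \<in> Cell2 T. P (src1 T (src2 T s)) \<and> P (trg1 T (src2 T s))}\<rparr>"

locale two_functor = S: two_category S + T: two_category T
  for S :: "('o, 'm, 'c) two_cat" and T :: "('p, 'n, 'd) two_cat" +
  fixes F0 :: "'o \<Rightarrow> 'p" and F1 :: "'m \<Rightarrow> 'n" and F2 :: "'c \<Rightarrow> 'd"
  assumes functor_one: "cat_functor (one_cat S) (one_cat T) F0 F1"
    and functor_vert: "cat_functor (vert_cat S) (vert_cat T) F1 F2"
    and functor_horiz: "cat_functor (horiz_cat S) (horiz_cat T) F0 F2"

locale two_nat_iso = F: two_functor S T F0 F1 F2 + G: two_functor S T G0 G1 G2
  for S :: "('o, 'm, 'c) two_cat" and T :: "('p, 'n, 'd) two_cat"
    and F0 :: "'o \<Rightarrow> 'p" and F1 :: "'m \<Rightarrow> 'n" and F2 :: "'c \<Rightarrow> 'd"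
    and G0 :: "'o \<Rightarrow> 'p" and G1 :: "'m \<Rightarrow> 'n" and G2 :: "'c \<Rightarrow> 'd" +
  fixes \<eta> :: "'o \<Rightarrow> 'n"
  assumes component_hom: "x \<in> Ob0 S \<Longrightarrow> \<eta> x \<in> hom (one_cat T) (F0 x) (G0 x)"
    and component_iso: "x \<in> Ob0 S \<Longrightarrow> iso_in (one_cat T) (\<eta> x)"
    and natural_one: "f \<in> hom (one_cat S) x y \<Longrightarrow>
           comp1 T (\<eta> y) (F1 f) = comp1 T (G1 f) (\<eta> x)"
    and natural_two: "s \<in> hom (horiz_cat S) x y \<Longrightarrow>
           hcomp T (id2 T (\<eta> y)) (F2 s) = hcomp T (G2 s) (id2 T (\<eta> x))"

text \<open>Strict (\<open>Cat\<close>-enriched) equivalence: an inverse 2-functor up to 2-natural isomorphism.\<close>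

definition two_equivalence ::
  "('o, 'm, 'c) two_cat \<Rightarrow> ('p, 'n, 'd) two_cat \<Rightarrow>
   ('o \<Rightarrow> 'p) \<Rightarrow> ('m \<Rightarrow> 'n) \<Rightarrow> ('c \<Rightarrow> 'd) \<Rightarrow> bool" where
  "two_equivalence S T F0 F1 F2 \<longleftrightarrow> two_functor S T F0 F1 F2 \<and>
     (\<exists>G0 G1 G2 \<eta> \<epsilon>. two_functor T S G0 G1 G2 \<and>
        two_nat_iso S S id id id (G0 \<circ> F0) (G1 \<circ> F1) (G2 \<circ> F2) \<eta> \<and>
        two_nat_iso T T (F0 \<circ> G0) (F1 \<circ> G1) (F2 \<circ> G2) id id id \<epsilon>)"


section \<open>Oplax monoidal categories\<close>

text \<open>
  The families \<open>\<omega>\<^sup>n\<close> (and, below, \<open>\<rho>\<^sup>n\<close> and \<open>R\<^sup>n\<close>) are functions on lists; the index is recovered from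
  the length, so \<open>\<omega>\<^sup>n\<close> is \<open>omega V\<close> on lists of length \<open>n + 1\<close>, and \<open>\<omega>\<^sup>-\<^sup>1\<close> is \<open>omega V []\<close>.
  \<open>omega_split V a b a' : \<omega>(a, b, a') \<rightarrow> \<omega>(a, \<omega>(b), a')\<close> is the component at \<open>a, b, a'\<close> of
  \<open>\<omega>\<^sup>p\<^sup>+\<^sup>q \<rightarrow> \<omega>\<^sup>p(-, \<omega>\<^sup>q, -)\<close> where \<open>p = |a| + |a'|\<close>, \<open>q = |b| - 1\<close> and the position is \<open>|a|\<close>.
\<close>

record ('v, 'w) omcat = "('v, 'w) cat" +
  omega :: "'v list \<Rightarrow> 'v"
  omega_map :: "'w list \<Rightarrow> 'w"
  omega_split :: "'v list \<Rightarrow> 'v list \<Rightarrow> 'v list \<Rightarrow> 'w"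
  omega_counit :: "'v \<Rightarrow> 'w"

abbreviation objs :: "('o, 'a, 'z) cat_scheme \<Rightarrow> 'o list set" where
  "objs C \<equiv> lists (Obj C)"

abbreviation arrs :: "('o, 'a, 'z) cat_scheme \<Rightarrow> 'a list set" where
  "arrs C \<equiv> lists (Arr C)"

abbreviation doms :: "('o, 'a, 'z) cat_scheme \<Rightarrow> 'a list \<Rightarrow> 'o list" where
  "doms C \<equiv> map (Dom C)"

abbreviation cods :: "('o, 'a, 'z) cat_scheme \<Rightarrow> 'a list \<Rightarrow> 'o list" where
  "cods C \<equiv> map (Cod C)"

abbreviation ides :: "('o, 'a, 'z) cat_scheme \<Rightarrow> 'o list \<Rightarrow> 'a list" where
  "ides C \<equiv> map (Ide C)"

locale oplax_monoidal = category V
  for V :: "('v, 'w) omcat" (structure) +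
  assumes omega_functor: "cat_functor (pow_cat V n) V (omega V) (omega_map V)"
    and omega_split_hom: "a \<in> objs V \<Longrightarrow> b \<in> objs V \<Longrightarrow> a' \<in> objs V \<Longrightarrow>
          omega_split V a b a' \<in> hom V (omega V (a @ b @ a')) (omega V (a @ [omega V b] @ a'))"
    and omega_split_natural: "fs \<in> arrs V \<Longrightarrow> gs \<in> arrs V \<Longrightarrow> fs' \<in> arrs V \<Longrightarrow>
          omega_split V (cods V fs) (cods V gs) (cods V fs') \<cdot> omega_map V (fs @ gs @ fs') =
          omega_map V (fs @ [omega_map V gs] @ fs') \<cdot>
            omega_split V (doms V fs) (doms V gs) (doms V fs')"
    and omega_counit_hom: "v \<in> Obj V \<Longrightarrow> omega_counit V v \<in> hom V (omega V [v]) v"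
    and omega_counit_natural: "f \<in> hom V v w \<Longrightarrow>
          omega_counit V w \<cdot> omega_map V [f] = f \<cdot> omega_counit V v"
    and omega_counit_outer: "b \<in> objs V \<Longrightarrow>
          omega_counit V (omega V b) \<cdot> omega_split V [] b [] = Ide V (omega V b)"
    and omega_counit_inner: "a \<in> objs V \<Longrightarrow> v \<in> Obj V \<Longrightarrow> a' \<in> objs V \<Longrightarrow>
          omega_map V (ides V a @ [omega_counit V v] @ ides V a') \<cdot> omega_split V a [v] a' =
          Ide V (omega V (a @ [v] @ a'))"
    and omega_split_parallel:
      "a \<in> objs V \<Longrightarrow> b \<in> objs V \<Longrightarrow> c \<in> objs V \<Longrightarrow> d \<in> objs V \<Longrightarrow> e \<in> objs V \<Longrightarrow>
          omega_split V (a @ [omega V b] @ c) d e \<cdot> omega_split V a b (c @ d @ e) =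
          omega_split V a b (c @ [omega V d] @ e) \<cdot> omega_split V (a @ b @ c) d e"
    and omega_split_nested:
      "a \<in> objs V \<Longrightarrow> b \<in> objs V \<Longrightarrow> c \<in> objs V \<Longrightarrow> b' \<in> objs V \<Longrightarrow> a' \<in> objs V \<Longrightarrow>
          omega_map V (ides V a @ [omega_split V b c b'] @ ides V a') \<cdot>
            omega_split V a (b @ c @ b') a' =
          omega_split V a (b @ [omega V c] @ b') a' \<cdot> omega_split V (a @ b) c (b' @ a')"


section \<open>Modules\<close>

text \<open>
  \<open>rho_split M a b a' x : \<rho>(a, b, a', x) \<rightarrow> \<rho>(a, \<omega>(b), a', x)\<close> and
  \<open>rho_nest M a b x : \<rho>(a, b, x) \<rightarrow> \<rho>(a, \<rho>(b, x))\<close>.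
\<close>

record ('v, 'w, 'o, 'a) vmod = "('o, 'a) cat" +
  rho :: "'v list \<Rightarrow> 'o \<Rightarrow> 'o"
  rho_map :: "'w list \<Rightarrow> 'a \<Rightarrow> 'a"
  rho_split :: "'v list \<Rightarrow> 'v list \<Rightarrow> 'v list \<Rightarrow> 'o \<Rightarrow> 'a"
  rho_nest :: "'v list \<Rightarrow> 'v list \<Rightarrow> 'o \<Rightarrow> 'a"
  rho_counit :: "'o \<Rightarrow> 'a"

locale vmodule = V: oplax_monoidal V + M: category M
  for V :: "('v, 'w) omcat" and M :: "('v, 'w, 'o, 'a) vmod" (structure) +
  assumes rho_functor: "cat_functor (prod_cat (pow_cat V n) M) M
          (\<lambda>(a, x). rho M a x) (\<lambda>(fs, f). rho_map M fs f)"
    and rho_split_hom: "a \<in> objs V \<Longrightarrow> b \<in> objs V \<Longrightarrow> a' \<in> objs V \<Longrightarrow> x \<in> Obj M \<Longrightarrow>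
          rho_split M a b a' x \<in> hom M (rho M (a @ b @ a') x) (rho M (a @ [omega V b] @ a') x)"
    and rho_split_natural:
      "fs \<in> arrs V \<Longrightarrow> gs \<in> arrs V \<Longrightarrow> fs' \<in> arrs V \<Longrightarrow> f \<in> hom M x y \<Longrightarrow>
          rho_split M (cods V fs) (cods V gs) (cods V fs') y \<cdot> rho_map M (fs @ gs @ fs') f =
          rho_map M (fs @ [omega_map V gs] @ fs') f \<cdot>
            rho_split M (doms V fs) (doms V gs) (doms V fs') x"
    and rho_nest_hom: "a \<in> objs V \<Longrightarrow> b \<in> objs V \<Longrightarrow> x \<in> Obj M \<Longrightarrow>
          rho_nest M a b x \<in> hom M (rho M (a @ b) x) (rho M a (rho M b x))"
    and rho_nest_natural: "fs \<in> arrs V \<Longrightarrow> gs \<in> arrs V \<Longrightarrow> f \<in> hom M x y \<Longrightarrow>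
          rho_nest M (cods V fs) (cods V gs) y \<cdot> rho_map M (fs @ gs) f =
          rho_map M fs (rho_map M gs f) \<cdot> rho_nest M (doms V fs) (doms V gs) x"
    and rho_counit_hom: "x \<in> Obj M \<Longrightarrow> rho_counit M x \<in> hom M (rho M [] x) x"
    and rho_counit_natural: "f \<in> hom M x y \<Longrightarrow>
          rho_counit M y \<cdot> rho_map M [] f = f \<cdot> rho_counit M x"
    and rho_counit_outer: "a \<in> objs V \<Longrightarrow> x \<in> Obj M \<Longrightarrow>
          rho_counit M (rho M a x) \<cdot> rho_nest M [] a x = Ide M (rho M a x)"
    and rho_counit_inner: "a \<in> objs V \<Longrightarrow> x \<in> Obj M \<Longrightarrow>
          rho_map M (ides V a) (rho_counit M x) \<cdot> rho_nest M a [] x = Ide M (rho M a x)"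
    and omega_counit_rho: "a \<in> objs V \<Longrightarrow> v \<in> Obj V \<Longrightarrow> a' \<in> objs V \<Longrightarrow> x \<in> Obj M \<Longrightarrow>
          rho_map M (ides V a @ [omega_counit V v] @ ides V a') (Ide M x) \<cdot>
            rho_split M a [v] a' x =
          Ide M (rho M (a @ [v] @ a') x)"
    and rho_nest_split_parallel:
      "a \<in> objs V \<Longrightarrow> b \<in> objs V \<Longrightarrow> a' \<in> objs V \<Longrightarrow> c \<in> objs V \<Longrightarrow> x \<in> Obj M \<Longrightarrow>
          rho_nest M (a @ [omega V b] @ a') c x \<cdot> rho_split M a b (a' @ c) x =
          rho_split M a b a' (rho M c x) \<cdot> rho_nest M (a @ b @ a') c x"
    and rho_split_parallel:
      "a \<in> objs V \<Longrightarrow> b \<in> objs V \<Longrightarrow> c \<in> objs V \<Longrightarrow> d \<in> objs V \<Longrightarrow> e \<in> objs V \<Longrightarrow> x \<in> Obj M \<Longrightarrow>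
          rho_split M (a @ [omega V b] @ c) d e x \<cdot> rho_split M a b (c @ d @ e) x =
          rho_split M a b (c @ [omega V d] @ e) x \<cdot> rho_split M (a @ b @ c) d e x"
    and rho_nest_split_nested:
      "a \<in> objs V \<Longrightarrow> b \<in> objs V \<Longrightarrow> c \<in> objs V \<Longrightarrow> b' \<in> objs V \<Longrightarrow> x \<in> Obj M \<Longrightarrow>
          rho_map M (ides V a) (rho_split M b c b' x) \<cdot> rho_nest M a (b @ c @ b') x =
          rho_nest M a (b @ [omega V c] @ b') x \<cdot> rho_split M (a @ b) c b' x"
    and rho_nest_nested:
      "a \<in> objs V \<Longrightarrow> b \<in> objs V \<Longrightarrow> c \<in> objs V \<Longrightarrow> x \<in> Obj M \<Longrightarrow>
          rho_map M (ides V a) (rho_nest M b c x) \<cdot> rho_nest M a (b @ c) x =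
          rho_nest M a b (rho M c x) \<cdot> rho_nest M (a @ b) c x"
    and rho_split_nested:
      "a \<in> objs V \<Longrightarrow> b \<in> objs V \<Longrightarrow> c \<in> objs V \<Longrightarrow> b' \<in> objs V \<Longrightarrow> a' \<in> objs V \<Longrightarrow> x \<in> Obj M \<Longrightarrow>
          rho_map M (ides V a @ [omega_split V b c b'] @ ides V a') (Ide M x) \<cdot>
            rho_split M a (b @ c @ b') a' x =
          rho_split M a (b @ [omega V c] @ b') a' x \<cdot> rho_split M (a @ b) c (b' @ a') x"

text \<open>
  Functors, transformations and the like that are compared for equality, as 1-cells or 2-cells, are
  \<open>extensional\<close> (equal to \<open>undefined\<close> outside their domain).
\<close>

locale lax_morphism = M: vmodule V M + N: vmodule V N + F: cat_functor M N Fo Fa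
  for V :: "('v, 'w) omcat" and M N :: "('v, 'w, 'o, 'a) vmod"
    and Fo :: "'o \<Rightarrow> 'o" and Fa :: "'a \<Rightarrow> 'a" +
  fixes f :: "'v list \<times> 'o \<Rightarrow> 'a"
  assumes ext: "Fo \<in> extensional (Obj M)" "Fa \<in> extensional (Arr M)"
                "f \<in> extensional (objs V \<times> Obj M)"
    and lax_hom: "a \<in> objs V \<Longrightarrow> x \<in> Obj M \<Longrightarrow> f (a, x) \<in> hom N (rho N a (Fo x)) (Fo (rho M a x))"
    and lax_natural: "hs \<in> arrs V \<Longrightarrow> h \<in> hom M x y \<Longrightarrow>
          f (cods V hs, y) \<cdot>\<^bsub>N\<^esub> rho_map N hs (Fa h) = Fa (rho_map M hs h) \<cdot>\<^bsub>N\<^esub> f (doms V hs, x)"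
    and lax_counit: "x \<in> Obj M \<Longrightarrow> Fa (rho_counit M x) \<cdot>\<^bsub>N\<^esub> f ([], x) = rho_counit N (Fo x)"
    and lax_split: "a \<in> objs V \<Longrightarrow> b \<in> objs V \<Longrightarrow> a' \<in> objs V \<Longrightarrow> x \<in> Obj M \<Longrightarrow>
          f (a @ [omega V b] @ a', x) \<cdot>\<^bsub>N\<^esub> rho_split N a b a' (Fo x) =
          Fa (rho_split M a b a' x) \<cdot>\<^bsub>N\<^esub> f (a @ b @ a', x)"
    and lax_nest: "a \<in> objs V \<Longrightarrow> b \<in> objs V \<Longrightarrow> x \<in> Obj M \<Longrightarrow>
          f (a, rho M b x) \<cdot>\<^bsub>N\<^esub> (rho_map N (ides V a) (f (b, x)) \<cdot>\<^bsub>N\<^esub> rho_nest N a b (Fo x)) =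
          Fa (rho_nest M a b x) \<cdot>\<^bsub>N\<^esub> f (a @ b, x)"

text \<open>1-cells and 2-cells, each carrying its source and target.\<close>

record ('o, 'a, 'mod, 'str) mor =
  Src :: 'mod
  Trg :: 'mod
  OMap :: "'o \<Rightarrow> 'o"
  AMap :: "'a \<Rightarrow> 'a"
  Str :: 'str

record ('o, 'a, 'mod, 'str) cell =
  SrcC :: "('o, 'a, 'mod, 'str) mor"
  TrgC :: "('o, 'a, 'mod, 'str) mor"
  At :: "'o \<Rightarrow> 'a"

type_synonym ('v, 'w, 'o, 'a) lax_mor =
  "('o, 'a, ('v, 'w, 'o, 'a) vmod, 'v list \<times> 'o \<Rightarrow> 'a) mor"

type_synonym ('v, 'w, 'o, 'a) lax_cell =
  "('o, 'a, ('v, 'w, 'o, 'a) vmod, 'v list \<times> 'o \<Rightarrow> 'a) cell"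

definition is_lax_mor :: "('v, 'w) omcat \<Rightarrow> ('v, 'w, 'o, 'a) lax_mor \<Rightarrow> bool" where
  "is_lax_mor V F \<longleftrightarrow> lax_morphism V (Src F) (Trg F) (OMap F) (AMap F) (Str F)"

definition parallel :: "('o, 'a, 'mod, 'str) mor \<Rightarrow> ('o, 'a, 'mod, 'str) mor \<Rightarrow> bool" where
  "parallel F G \<longleftrightarrow> Src F = Src G \<and> Trg F = Trg G"

definition is_lax_cell :: "('v, 'w) omcat \<Rightarrow> ('v, 'w, 'o, 'a) lax_cell \<Rightarrow> bool" where
  "is_lax_cell V s \<longleftrightarrow>
     (let F = SrcC s; G = TrgC s; M = Src F; N = Trg F in
        is_lax_mor V F \<and> is_lax_mor V G \<and> parallel F G \<and>
        nat_trans M N (OMap F) (AMap F) (OMap G) (AMap G) (At s) \<and>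
        At s \<in> extensional (Obj M) \<and>
        (\<forall>a \<in> objs V. \<forall>x \<in> Obj M.
           Str G (a, x) \<cdot>\<^bsub>N\<^esub> rho_map N (ides V a) (At s x) =
           At s (rho M a x) \<cdot>\<^bsub>N\<^esub> Str F (a, x)))"

definition id_lax :: "('v, 'w) omcat \<Rightarrow> ('v, 'w, 'o, 'a) vmod \<Rightarrow> ('v, 'w, 'o, 'a) lax_mor" where
  "id_lax V M = \<lparr>Src = M, Trg = M, OMap = restrict id (Obj M), AMap = restrict id (Arr M),
     Str = restrict (\<lambda>(a, x). Ide M (rho M a x)) (objs V \<times> Obj M)\<rparr>"

definition comp_lax ::
  "('v, 'w) omcat \<Rightarrow> ('v, 'w, 'o, 'a) lax_mor \<Rightarrow> ('v, 'w, 'o, 'a) lax_mor \<Rightarrow> ('v, 'w, 'o, 'a) lax_mor"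
where
  "comp_lax V G F = \<lparr>Src = Src F, Trg = Trg G,
     OMap = restrict (OMap G \<circ> OMap F) (Obj (Src F)),
     AMap = restrict (AMap G \<circ> AMap F) (Arr (Src F)),
     Str = restrict (\<lambda>(a, x). AMap G (Str F (a, x)) \<cdot>\<^bsub>Trg G\<^esub> Str G (a, OMap F x))
             (objs V \<times> Obj (Src F))\<rparr>"

text \<open>
  Underlying natural transformations compose in the same way for modules and for \<open>\<delta>\<close>modules; the
  parameters \<open>cat_of\<close> and \<open>cmp\<close> are the underlying category and the composition of 1-cells.
\<close>

definition id_cell ::
  "('mod \<Rightarrow> ('o, 'a) cat) \<Rightarrow> ('o, 'a, 'mod, 'str) mor \<Rightarrow> ('o, 'a, 'mod, 'str) cell" where
  "id_cell cat_of F = \<lparr>SrcC = F, TrgC = F,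
     At = restrict (\<lambda>x. Ide (cat_of (Trg F)) (OMap F x)) (Obj (cat_of (Src F)))\<rparr>"

definition vcomp_cell ::
  "('mod \<Rightarrow> ('o, 'a) cat) \<Rightarrow> ('o, 'a, 'mod, 'str) cell \<Rightarrow> ('o, 'a, 'mod, 'str) cell \<Rightarrow>
   ('o, 'a, 'mod, 'str) cell" where
  "vcomp_cell cat_of t s = \<lparr>SrcC = SrcC s, TrgC = TrgC t,
     At = restrict (\<lambda>x. Comp (cat_of (Trg (SrcC s))) (At t x) (At s x))
            (Obj (cat_of (Src (SrcC s))))\<rparr>"

definition hcomp_cell ::
  "('mod \<Rightarrow> ('o, 'a) cat) \<Rightarrow>
   (('o, 'a, 'mod, 'str) mor \<Rightarrow> ('o, 'a, 'mod, 'str) mor \<Rightarrow> ('o, 'a, 'mod, 'str) mor) \<Rightarrow>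
   ('o, 'a, 'mod, 'str) cell \<Rightarrow> ('o, 'a, 'mod, 'str) cell \<Rightarrow> ('o, 'a, 'mod, 'str) cell" where
  "hcomp_cell cat_of cmp t s = \<lparr>SrcC = cmp (SrcC t) (SrcC s), TrgC = cmp (TrgC t) (TrgC s),
     At = restrict (\<lambda>x. Comp (cat_of (Trg (SrcC t)))
                          (At t (OMap (TrgC s) x)) (AMap (SrcC t) (At s x)))
            (Obj (cat_of (Src (SrcC s))))\<rparr>"

definition Vmod_lax ::
  "('v, 'w) omcat \<Rightarrow>
   (('v, 'w, 'o, 'a) vmod, ('v, 'w, 'o, 'a) lax_mor, ('v, 'w, 'o, 'a) lax_cell) two_cat" where
  "Vmod_lax V = \<lparr>Ob0 = {M. vmodule V M}, Mor1 = {F. is_lax_mor V F}, Cell2 = {s. is_lax_cell V s},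
     src1 = Src, trg1 = Trg, src2 = SrcC, trg2 = TrgC,
     id1 = id_lax V, comp1 = comp_lax V,
     id2 = id_cell cat.truncate, vcomp = vcomp_cell cat.truncate,
     hcomp = hcomp_cell cat.truncate (comp_lax V)\<rparr>"


section \<open>\<open>\<delta>\<close>modules\<close>

text \<open>
  \<open>Sets\<close> is the category of subsets of the arrow type \<open>'a\<close>, so that the hom-sets of the categories
  considered are objects of \<open>Sets\<close>. Since only the carrier \<open>Arr M\<close> enters, \<open>'a\<close> may be arbitrarily
  large compared with \<open>M\<close>.
  For \<open>fs : a \<rightarrow> a'\<close>, \<open>f : x \<rightarrow> x'\<close>, \<open>g : y \<rightarrow> y'\<close>, \<open>Rmap M fs f g : R(a', x'; y) \<rightarrow> R(a, x; y')\<close>.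
  Further \<open>Ralpha M a b a' x y : R(a, \<omega>(b), a', x; y) \<rightarrow> R(a, b, a', x; y)\<close>, and
  \<open>Rbeta M a b x m y : R(a, m; y) \<times> R(b, x; m) \<rightarrow> R(a, b, x; y)\<close>, extranatural in \<open>m\<close>, encodes the
  map out of the coend over \<open>m\<close>.
\<close>

record ('v, 'w, 'o, 'a) dmod = "('o, 'a) cat" +
  Rset :: "'v list \<Rightarrow> 'o \<Rightarrow> 'o \<Rightarrow> 'a set"
  Rmap :: "'w list \<Rightarrow> 'a \<Rightarrow> 'a \<Rightarrow> 'a \<Rightarrow> 'a"
  Ralpha :: "'v list \<Rightarrow> 'v list \<Rightarrow> 'v list \<Rightarrow> 'o \<Rightarrow> 'o \<Rightarrow> 'a \<Rightarrow> 'a"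
  Rbeta :: "'v list \<Rightarrow> 'v list \<Rightarrow> 'o \<Rightarrow> 'o \<Rightarrow> 'o \<Rightarrow> 'a \<Rightarrow> 'a \<Rightarrow> 'a"
  Riota :: "'o \<Rightarrow> 'o \<Rightarrow> 'a \<Rightarrow> 'a"

definition dist_cat ::
  "('v, 'w, 'y) cat_scheme \<Rightarrow> ('o, 'a, 'z) cat_scheme \<Rightarrow> nat \<Rightarrow>
   (('v list \<times> 'o) \<times> 'o, ('w list \<times> 'a) \<times> 'a) cat" where
  "dist_cat V M n = prod_cat (op_cat (prod_cat (pow_cat V n) M)) M"

locale dmodule = V: oplax_monoidal V + M: category M
  for V :: "('v, 'w) omcat" and M :: "('v, 'w, 'o, 'a) dmod" (structure) +
  assumes R_functor: "set_functor (dist_cat V M n)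
          (\<lambda>((a, x), y). Rset M a x y) (\<lambda>((fs, f), g). Rmap M fs f g)"
    and alpha_map:
      "a \<in> objs V \<Longrightarrow> b \<in> objs V \<Longrightarrow> a' \<in> objs V \<Longrightarrow> x \<in> Obj M \<Longrightarrow> y \<in> Obj M \<Longrightarrow>
       r \<in> Rset M (a @ [omega V b] @ a') x y \<Longrightarrow>
          Ralpha M a b a' x y r \<in> Rset M (a @ b @ a') x y"
    and alpha_natural:
      "fs \<in> arrs V \<Longrightarrow> gs \<in> arrs V \<Longrightarrow> fs' \<in> arrs V \<Longrightarrow> f \<in> hom M x x' \<Longrightarrow> g \<in> hom M y y' \<Longrightarrow>
       r \<in> Rset M (cods V fs @ [omega V (cods V gs)] @ cods V fs') x' y \<Longrightarrow>
          Ralpha M (doms V fs) (doms V gs) (doms V fs') x y'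
            (Rmap M (fs @ [omega_map V gs] @ fs') f g r) =
          Rmap M (fs @ gs @ fs') f g
            (Ralpha M (cods V fs) (cods V gs) (cods V fs') x' y r)"
    and beta_map:
      "a \<in> objs V \<Longrightarrow> b \<in> objs V \<Longrightarrow> x \<in> Obj M \<Longrightarrow> m \<in> Obj M \<Longrightarrow> y \<in> Obj M \<Longrightarrow>
       r \<in> Rset M a m y \<Longrightarrow> s \<in> Rset M b x m \<Longrightarrow> Rbeta M a b x m y r s \<in> Rset M (a @ b) x y"
    and beta_natural:
      "fs \<in> arrs V \<Longrightarrow> gs \<in> arrs V \<Longrightarrow> f \<in> hom M x x' \<Longrightarrow> m \<in> Obj M \<Longrightarrow> g \<in> hom M y y' \<Longrightarrow>
       r \<in> Rset M (cods V fs) m y \<Longrightarrow> s \<in> Rset M (cods V gs) x' m \<Longrightarrow>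
          Rbeta M (doms V fs) (doms V gs) x m y'
            (Rmap M fs (Ide M m) g r) (Rmap M gs f (Ide M m) s) =
          Rmap M (fs @ gs) f g (Rbeta M (cods V fs) (cods V gs) x' m y r s)"
    and beta_extranatural:
      "a \<in> objs V \<Longrightarrow> b \<in> objs V \<Longrightarrow> x \<in> Obj M \<Longrightarrow> k \<in> hom M m m' \<Longrightarrow> y \<in> Obj M \<Longrightarrow>
       r \<in> Rset M a m' y \<Longrightarrow> s \<in> Rset M b x m \<Longrightarrow>
          Rbeta M a b x m y (Rmap M (ides V a) k (Ide M y) r) s =
          Rbeta M a b x m' y r (Rmap M (ides V b) (Ide M x) k s)"
    and iota_map: "g \<in> hom M x y \<Longrightarrow> Riota M x y g \<in> Rset M [] x y"
    and iota_natural: "f \<in> hom M x x' \<Longrightarrow> g \<in> hom M x' y \<Longrightarrow> h \<in> hom M y y' \<Longrightarrow>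
          Riota M x y' (h \<cdot> g \<cdot> f) = Rmap M [] f h (Riota M x' y g)"
    and beta_iota_left: "a \<in> objs V \<Longrightarrow> x \<in> Obj M \<Longrightarrow> r \<in> Rset M a x y \<Longrightarrow> g \<in> hom M y z \<Longrightarrow>
          Rbeta M [] a x y z (Riota M y z g) r = Rmap M (ides V a) (Ide M x) g r"
    and beta_iota_right: "a \<in> objs V \<Longrightarrow> y \<in> Obj M \<Longrightarrow> r \<in> Rset M a x y \<Longrightarrow> f \<in> hom M w x \<Longrightarrow>
          Rbeta M a [] w x y r (Riota M w x f) = Rmap M (ides V a) f (Ide M y) r"
    and alpha_counit:
      "a \<in> objs V \<Longrightarrow> v \<in> Obj V \<Longrightarrow> a' \<in> objs V \<Longrightarrow> x \<in> Obj M \<Longrightarrow> y \<in> Obj M \<Longrightarrow>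
       r \<in> Rset M (a @ [v] @ a') x y \<Longrightarrow>
          Ralpha M a [v] a' x y
            (Rmap M (ides V a @ [omega_counit V v] @ ides V a') (Ide M x) (Ide M y) r) = r"
    and alpha_parallel:
      "a \<in> objs V \<Longrightarrow> b \<in> objs V \<Longrightarrow> c \<in> objs V \<Longrightarrow> d \<in> objs V \<Longrightarrow> e \<in> objs V \<Longrightarrow>
       x \<in> Obj M \<Longrightarrow> y \<in> Obj M \<Longrightarrow> r \<in> Rset M (a @ [omega V b] @ c @ [omega V d] @ e) x y \<Longrightarrow>
          Ralpha M a b (c @ d @ e) x y (Ralpha M (a @ [omega V b] @ c) d e x y r) =
          Ralpha M (a @ b @ c) d e x y (Ralpha M a b (c @ [omega V d] @ e) x y r)"
    and beta_alpha_left: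
      "a \<in> objs V \<Longrightarrow> b \<in> objs V \<Longrightarrow> a' \<in> objs V \<Longrightarrow> c \<in> objs V \<Longrightarrow>
       x \<in> Obj M \<Longrightarrow> m \<in> Obj M \<Longrightarrow> y \<in> Obj M \<Longrightarrow>
       r \<in> Rset M (a @ [omega V b] @ a') m y \<Longrightarrow> s \<in> Rset M c x m \<Longrightarrow>
          Rbeta M (a @ b @ a') c x m y (Ralpha M a b a' m y r) s =
          Ralpha M a b (a' @ c) x y (Rbeta M (a @ [omega V b] @ a') c x m y r s)"
    and beta_alpha_right:
      "a \<in> objs V \<Longrightarrow> b \<in> objs V \<Longrightarrow> c \<in> objs V \<Longrightarrow> b' \<in> objs V \<Longrightarrow>
       x \<in> Obj M \<Longrightarrow> m \<in> Obj M \<Longrightarrow> y \<in> Obj M \<Longrightarrow>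
       r \<in> Rset M a m y \<Longrightarrow> s \<in> Rset M (b @ [omega V c] @ b') x m \<Longrightarrow>
          Rbeta M a (b @ c @ b') x m y r (Ralpha M b c b' x m s) =
          Ralpha M (a @ b) c b' x y (Rbeta M a (b @ [omega V c] @ b') x m y r s)"
    and alpha_nested:
      "a \<in> objs V \<Longrightarrow> b \<in> objs V \<Longrightarrow> c \<in> objs V \<Longrightarrow> b' \<in> objs V \<Longrightarrow> a' \<in> objs V \<Longrightarrow>
       x \<in> Obj M \<Longrightarrow> y \<in> Obj M \<Longrightarrow> r \<in> Rset M (a @ [omega V (b @ [omega V c] @ b')] @ a') x y \<Longrightarrow>
          Ralpha M (a @ b) c (b' @ a') x y (Ralpha M a (b @ [omega V c] @ b') a' x y r) =
          Ralpha M a (b @ c @ b') a' x y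
            (Rmap M (ides V a @ [omega_split V b c b'] @ ides V a') (Ide M x) (Ide M y) r)"
    and beta_assoc:
      "a \<in> objs V \<Longrightarrow> b \<in> objs V \<Longrightarrow> c \<in> objs V \<Longrightarrow>
       x \<in> Obj M \<Longrightarrow> l \<in> Obj M \<Longrightarrow> m \<in> Obj M \<Longrightarrow> y \<in> Obj M \<Longrightarrow>
       r \<in> Rset M a m y \<Longrightarrow> s \<in> Rset M b l m \<Longrightarrow> t \<in> Rset M c x l \<Longrightarrow>
          Rbeta M (a @ b) c x l y (Rbeta M a b l m y r s) t =
          Rbeta M a (b @ c) x m y r (Rbeta M b c x l m s t)"

definition left_representable :: "('v, 'w) omcat \<Rightarrow> ('v, 'w, 'o, 'a) dmod \<Rightarrow> bool" where
  "left_representable V M \<longleftrightarrow>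
     (\<forall>n. \<exists>\<rho>o \<rho>a \<phi>. cat_functor (prod_cat (pow_cat V n) M) M \<rho>o \<rho>a \<and>
        set_nat_iso (dist_cat V M n)
          (\<lambda>((a, x), y). Rset M a x y) (\<lambda>((fs, f), g). Rmap M fs f g)
          (\<lambda>(p, y). hom M (\<rho>o p) y) (\<lambda>(h, g) r. g \<cdot>\<^bsub>M\<^esub> r \<cdot>\<^bsub>M\<^esub> \<rho>a h)
          \<phi>)"

definition R_elements ::
  "('v, 'w) omcat \<Rightarrow> ('v, 'w, 'o, 'a) dmod \<Rightarrow> ('v list \<times> 'o \<times> 'o \<times> 'a) set" where
  "R_elements V M =
     {(a, x, y, r). a \<in> objs V \<and> x \<in> Obj M \<and> y \<in> Obj M \<and> r \<in> Rset M a x y}"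

locale oplax_functor = M: dmodule V M + N: dmodule V N + F: cat_functor M N Fo Fa
  for V :: "('v, 'w) omcat" and M N :: "('v, 'w, 'o, 'a) dmod"
    and Fo :: "'o \<Rightarrow> 'o" and Fa :: "'a \<Rightarrow> 'a" +
  fixes f :: "'v list \<times> 'o \<times> 'o \<times> 'a \<Rightarrow> 'a"
  assumes ext: "Fo \<in> extensional (Obj M)" "Fa \<in> extensional (Arr M)"
                "f \<in> extensional (R_elements V M)"
    and oplax_map: "a \<in> objs V \<Longrightarrow> x \<in> Obj M \<Longrightarrow> y \<in> Obj M \<Longrightarrow> r \<in> Rset M a x y \<Longrightarrow>
          f (a, x, y, r) \<in> Rset N a (Fo x) (Fo y)"
    and oplax_natural:
      "hs \<in> arrs V \<Longrightarrow> h \<in> hom M x x' \<Longrightarrow> k \<in> hom M y y' \<Longrightarrow> r \<in> Rset M (cods V hs) x' y \<Longrightarrow>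
          f (doms V hs, x, y', Rmap M hs h k r) =
          Rmap N hs (Fa h) (Fa k) (f (cods V hs, x', y, r))"
    and oplax_iota: "g \<in> hom M x y \<Longrightarrow>
          f ([], x, y, Riota M x y g) = Riota N (Fo x) (Fo y) (Fa g)"
    and oplax_alpha:
      "a \<in> objs V \<Longrightarrow> b \<in> objs V \<Longrightarrow> a' \<in> objs V \<Longrightarrow> x \<in> Obj M \<Longrightarrow> y \<in> Obj M \<Longrightarrow>
       r \<in> Rset M (a @ [omega V b] @ a') x y \<Longrightarrow>
          f (a @ b @ a', x, y, Ralpha M a b a' x y r) =
          Ralpha N a b a' (Fo x) (Fo y) (f (a @ [omega V b] @ a', x, y, r))"
    and oplax_beta:
      "a \<in> objs V \<Longrightarrow> b \<in> objs V \<Longrightarrow> x \<in> Obj M \<Longrightarrow> m \<in> Obj M \<Longrightarrow> y \<in> Obj M \<Longrightarrow>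
       r \<in> Rset M a m y \<Longrightarrow> s \<in> Rset M b x m \<Longrightarrow>
          f (a @ b, x, y, Rbeta M a b x m y r s) =
          Rbeta N a b (Fo x) (Fo m) (Fo y) (f (a, m, y, r)) (f (b, x, m, s))"

type_synonym ('v, 'w, 'o, 'a) oplax_mor =
  "('o, 'a, ('v, 'w, 'o, 'a) dmod, 'v list \<times> 'o \<times> 'o \<times> 'a \<Rightarrow> 'a) mor"

type_synonym ('v, 'w, 'o, 'a) oplax_cell =
  "('o, 'a, ('v, 'w, 'o, 'a) dmod, 'v list \<times> 'o \<times> 'o \<times> 'a \<Rightarrow> 'a) cell"

definition is_oplax_mor :: "('v, 'w) omcat \<Rightarrow> ('v, 'w, 'o, 'a) oplax_mor \<Rightarrow> bool" where
  "is_oplax_mor V F \<longleftrightarrow> oplax_functor V (Src F) (Trg F) (OMap F) (AMap F) (Str F)"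

definition is_oplax_cell :: "('v, 'w) omcat \<Rightarrow> ('v, 'w, 'o, 'a) oplax_cell \<Rightarrow> bool" where
  "is_oplax_cell V s \<longleftrightarrow>
     (let F = SrcC s; G = TrgC s; M = Src F; N = Trg F in
        is_oplax_mor V F \<and> is_oplax_mor V G \<and> parallel F G \<and>
        nat_trans M N (OMap F) (AMap F) (OMap G) (AMap G) (At s) \<and>
        At s \<in> extensional (Obj M) \<and>
        (\<forall>a \<in> objs V. \<forall>x \<in> Obj M. \<forall>y \<in> Obj M. \<forall>r \<in> Rset M a x y.
           Rmap N (ides V a) (Ide N (OMap F x)) (At s y) (Str F (a, x, y, r)) =
           Rmap N (ides V a) (At s x) (Ide N (OMap G y)) (Str G (a, x, y, r))))"

definition id_oplax :: "('v, 'w) omcat \<Rightarrow> ('v, 'w, 'o, 'a) dmod \<Rightarrow> ('v, 'w, 'o, 'a) oplax_mor" where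
  "id_oplax V M = \<lparr>Src = M, Trg = M, OMap = restrict id (Obj M), AMap = restrict id (Arr M),
     Str = restrict (\<lambda>(a, x, y, r). r) (R_elements V M)\<rparr>"

definition comp_oplax ::
  "('v, 'w) omcat \<Rightarrow> ('v, 'w, 'o, 'a) oplax_mor \<Rightarrow> ('v, 'w, 'o, 'a) oplax_mor \<Rightarrow>
   ('v, 'w, 'o, 'a) oplax_mor" where
  "comp_oplax V G F = \<lparr>Src = Src F, Trg = Trg G,
     OMap = restrict (OMap G \<circ> OMap F) (Obj (Src F)),
     AMap = restrict (AMap G \<circ> AMap F) (Arr (Src F)),
     Str = restrict (\<lambda>(a, x, y, r). Str G (a, OMap F x, OMap F y, Str F (a, x, y, r)))
             (R_elements V (Src F))\<rparr>"

definition Vdmod_oplax ::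
  "('v, 'w) omcat \<Rightarrow>
   (('v, 'w, 'o, 'a) dmod, ('v, 'w, 'o, 'a) oplax_mor, ('v, 'w, 'o, 'a) oplax_cell) two_cat" where
  "Vdmod_oplax V = \<lparr>Ob0 = {M. dmodule V M}, Mor1 = {F. is_oplax_mor V F},
     Cell2 = {s. is_oplax_cell V s},
     src1 = Src, trg1 = Trg, src2 = SrcC, trg2 = TrgC,
     id1 = id_oplax V, comp1 = comp_oplax V,
     id2 = id_cell cat.truncate, vcomp = vcomp_cell cat.truncate,
     hcomp = hcomp_cell cat.truncate (comp_oplax V)\<rparr>"


section \<open>The 2-functor\<close>

definition dmod_of ::
  "('v, 'w) omcat \<Rightarrow> ('v, 'w, 'o, 'a) vmod \<Rightarrow> ('v, 'w, 'o, 'a) dmod" where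
  "dmod_of V M = \<lparr>Obj = Obj M, Arr = Arr M, Dom = Dom M, Cod = Cod M, Ide = Ide M, Comp = Comp M,
     Rset = (\<lambda>a x y. hom M (rho M a x) y),
     Rmap = (\<lambda>fs f g r. g \<cdot>\<^bsub>M\<^esub> r \<cdot>\<^bsub>M\<^esub> rho_map M fs f),
     Ralpha = (\<lambda>a b a' x y r. r \<cdot>\<^bsub>M\<^esub> rho_split M a b a' x),
     Rbeta = (\<lambda>a b x m y r s. r \<cdot>\<^bsub>M\<^esub> rho_map M (ides V a) s \<cdot>\<^bsub>M\<^esub> rho_nest M a b x),
     Riota = (\<lambda>x y g. g \<cdot>\<^bsub>M\<^esub> rho_counit M x)\<rparr>"

definition oplax_of ::
  "('v, 'w) omcat \<Rightarrow> ('v, 'w, 'o, 'a) lax_mor \<Rightarrow> ('v, 'w, 'o, 'a) oplax_mor" where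
  "oplax_of V F = \<lparr>Src = dmod_of V (Src F), Trg = dmod_of V (Trg F),
     OMap = OMap F, AMap = AMap F,
     Str = restrict (\<lambda>(a, x, y, r). AMap F r \<cdot>\<^bsub>Trg F\<^esub> Str F (a, x))
             (R_elements V (dmod_of V (Src F)))\<rparr>"

definition oplax_cell_of ::
  "('v, 'w) omcat \<Rightarrow> ('v, 'w, 'o, 'a) lax_cell \<Rightarrow> ('v, 'w, 'o, 'a) oplax_cell" where
  "oplax_cell_of V s = \<lparr>SrcC = oplax_of V (SrcC s), TrgC = oplax_of V (TrgC s), At = At s\<rparr>"

end

(*
  By the Yoneda lemma a natural family N(rho(a, x), y) -> S(a, F x; F y) is determined by its value at
  an identity, so lax structures on F correspond to oplax structures on F between the associated
  delta-modules, strictly compatibly with composition; the same holds for the conditions on 2-cells.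
  Hence the 2-functor is an isomorphism on hom categories. A left representable R is isomorphic to one
  in its image: writing u(a, x) in R(a, x; rho(a, x)) for the universal elements, the structure maps
  of rho are the unique ones with split_* u = alpha(u), nest_* u = beta(u, u) and
  counit_* u = iota(id), and each module axiom is the corresponding axiom of R evaluated at
  universal elements. Conjugation by the chosen isomorphisms then gives a strict inverse 2-functor up
  to 2-natural isomorphism.
*)

theory Submission
  imports Defs
begin

section \<open>Ordinary categories, and inverting fully faithful essentially surjective
  functors\<close>

section \<open>Categories\<close>

text \<open>A strict inverse 2-functor needs more than equivalences of hom categories: composition
  must be preserved on the nose. This is possible because \<open>oplax_of\<close> and
  \<open>oplax_cell_of\<close> are bijective between fixed boundaries, and because 1-cells and
  2-cells consist of extensional functions, so that agreement on the carriers is equality. On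
  2-cells the inverse conjugates with identity 2-cells, so horizontally it is the same construction
  as on 1-cells, carried out in the category whose arrows are all 2-cells between two objects. One
  fact about ordinary categories serves both, and only vertical composition needs its own argument,
  interchange.

  Essential surjectivity must likewise give isomorphisms, not equivalences. Their underlying
  functors are identities: the module lives on the category of the \<delta>module itself, and only
  the sets R(a, x; y) are replaced by hom sets. Once every element is written as
  \<open>elt a x k\<close>, the operations of R obey the formulas of \<open>dmod_of\<close>, and
  both the module axioms and the two inverse 1-cells become rewriting.\<close>

context category
begin

text \<open>Premises about \<open>hom\<close> leave endpoints for the simplifier to guess. With
  membership in \<open>Arr\<close> and equations between \<open>Dom\<close> and \<open>Cod\<close>
  instead, the same axioms become conditional rewrite rules.\<close>

lemma comp_arr [simp]:
  assumes "f \<in> Arr C" "g \<in> Arr C" "Dom C g = Cod C f"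
  shows "g \<cdot> f \<in> Arr C" "Dom C (g \<cdot> f) = Dom C f" "Cod C (g \<cdot> f) = Cod C g"
  using comp_hom[of f "Dom C f" "Cod C f" g "Cod C g"] assms by (auto simp: hom_def)

lemma ide_arr [simp]:
  assumes "x \<in> Obj C"
  shows "Ide C x \<in> Arr C" "Dom C (Ide C x) = x" "Cod C (Ide C x) = x"
  using ide_hom[OF assms] by (auto simp: hom_def)

lemma dom_cod_obj [simp]:
  assumes "f \<in> Arr C"
  shows "Dom C f \<in> Obj C" "Cod C f \<in> Obj C"
  using assms dom_obj cod_obj by auto

lemma comp_ide [simp]:
  assumes "f \<in> Arr C"
  shows "Dom C f = x \<Longrightarrow> f \<cdot> Ide C x = f" "Cod C f = x \<Longrightarrow> Ide C x \<cdot> f = f"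
  using comp_ide_right[of f "Dom C f" "Cod C f"] comp_ide_left[of f "Dom C f" "Cod C f"] assms
  by (auto simp: hom_def)

lemma assoc:
  assumes "f \<in> Arr C" "g \<in> Arr C" "h \<in> Arr C" "Dom C g = Cod C f" "Dom C h = Cod C g"
  shows "(h \<cdot> g) \<cdot> f = h \<cdot> (g \<cdot> f)"
  using comp_assoc[of f "Dom C f" "Cod C f" g "Cod C g" h "Cod C h"] assms by (auto simp: hom_def)

end

lemma homI: "f \<in> Arr C \<Longrightarrow> Dom C f = x \<Longrightarrow> Cod C f = y \<Longrightarrow> f \<in> hom C x y"
  by (simp add: hom_def)

lemma categoryI:
  assumes "\<And>f. f \<in> Arr C \<Longrightarrow> Dom C f \<in> Obj C \<and> Cod C f \<in> Obj C"
    and "\<And>x. x \<in> Obj C \<Longrightarrow> Ide C x \<in> Arr C \<and> Dom C (Ide C x) = x \<and> Cod C (Ide C x) = x"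
    and "\<And>f g. f \<in> Arr C \<Longrightarrow> g \<in> Arr C \<Longrightarrow> Dom C g = Cod C f \<Longrightarrow>
           Comp C g f \<in> Arr C \<and> Dom C (Comp C g f) = Dom C f \<and> Cod C (Comp C g f) = Cod C g"
    and "\<And>f. f \<in> Arr C \<Longrightarrow> Comp C f (Ide C (Dom C f)) = f \<and> Comp C (Ide C (Cod C f)) f = f"
    and "\<And>f g h. f \<in> Arr C \<Longrightarrow> g \<in> Arr C \<Longrightarrow> h \<in> Arr C \<Longrightarrow> Dom C g = Cod C f \<Longrightarrow>
           Dom C h = Cod C g \<Longrightarrow> Comp C (Comp C h g) f = Comp C h (Comp C g f)"
  shows "category C"
  by unfold_locales (use assms in \<open>auto simp: hom_def\<close>)

context cat_functor
begin

lemma functor_arr [simp]: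
  assumes "f \<in> Arr C"
  shows "Fa f \<in> Arr D" "Dom D (Fa f) = Fo (Dom C f)" "Cod D (Fa f) = Fo (Cod C f)"
  using functor_hom[of f "Dom C f" "Cod C f"] assms by (auto simp: hom_def)

lemma functor_comp_arr [simp]:
  assumes "f \<in> Arr C" "g \<in> Arr C" "Dom C g = Cod C f"
  shows "Fa (g \<cdot>\<^bsub>C\<^esub> f) = Fa g \<cdot>\<^bsub>D\<^esub> Fa f"
  using functor_comp[of f "Dom C f" "Cod C f" g "Cod C g"] assms by (auto simp: hom_def)

lemmas functor_simps [simp] = functor_obj functor_ide

end

lemma cat_functorI:
  assumes "category C" "category D"
    and "\<And>x. x \<in> Obj C \<Longrightarrow> Fo x \<in> Obj D \<and> Fa (Ide C x) = Ide D (Fo x)"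
    and "\<And>f. f \<in> Arr C \<Longrightarrow>
           Fa f \<in> Arr D \<and> Dom D (Fa f) = Fo (Dom C f) \<and> Cod D (Fa f) = Fo (Cod C f)"
    and "\<And>f g. f \<in> Arr C \<Longrightarrow> g \<in> Arr C \<Longrightarrow> Dom C g = Cod C f \<Longrightarrow>
           Fa (Comp C g f) = Comp D (Fa g) (Fa f)"
  shows "cat_functor C D Fo Fa"
proof -
  interpret C: category C by fact
  interpret D: category D by fact
  show ?thesis
    by unfold_locales (use assms(3-) in \<open>auto simp: hom_def\<close>)
qed

text \<open>The chosen preimages \<open>g\<close> and the isomorphisms \<open>e\<close>,
  \<open>e'\<close> are parameters rather than obtained inside, so that two functors with the same
  object map can be inverted with the same choices.\<close>

locale ff_ess_functor = F: cat_functor C D Fo Fa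
  for C :: "('o, 'a, 'z) cat_scheme" and D :: "('p, 'b, 'y) cat_scheme"
    and Fo :: "'o \<Rightarrow> 'p" and Fa :: "'a \<Rightarrow> 'b" +
  fixes g :: "'p \<Rightarrow> 'o" and e e' :: "'p \<Rightarrow> 'b"
  assumes ff: "x \<in> Obj C \<Longrightarrow> x' \<in> Obj C \<Longrightarrow> bij_betw Fa (hom C x x') (hom D (Fo x) (Fo x'))"
    and g_obj [simp]: "y \<in> Obj D \<Longrightarrow> g y \<in> Obj C"
    and e_hom: "y \<in> Obj D \<Longrightarrow> e y \<in> hom D (Fo (g y)) y"
    and e'_hom: "y \<in> Obj D \<Longrightarrow> e' y \<in> hom D y (Fo (g y))"
    and e_e' [simp]: "y \<in> Obj D \<Longrightarrow> e y \<cdot>\<^bsub>D\<^esub> e' y = Ide D y"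
    and e'_e [simp]: "y \<in> Obj D \<Longrightarrow> e' y \<cdot>\<^bsub>D\<^esub> e y = Ide D (Fo (g y))"
begin

lemma e_arr [simp]:
  assumes "y \<in> Obj D"
  shows "e y \<in> Arr D" "Dom D (e y) = Fo (g y)" "Cod D (e y) = y"
    "e' y \<in> Arr D" "Dom D (e' y) = y" "Cod D (e' y) = Fo (g y)"
  using e_hom[OF assms] e'_hom[OF assms] by (auto simp: hom_def)

definition lift :: "'o \<Rightarrow> 'o \<Rightarrow> 'b \<Rightarrow> 'a" where
  "lift x y = the_inv_into (hom C x y) Fa"

lemma lift:
  assumes "x \<in> Obj C" "y \<in> Obj C" "b \<in> Arr D" "Dom D b = Fo x" "Cod D b = Fo y"
  shows "lift x y b \<in> Arr C" "Dom C (lift x y b) = x" "Cod C (lift x y b) = y" "Fa (lift x y b) = b"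
proof -
  have b: "b \<in> Fa ` hom C x y"
    using assms ff[of x y] by (auto simp: bij_betw_def homI)
  have inj: "inj_on Fa (hom C x y)"
    using assms ff[of x y] by (auto simp: bij_betw_def)
  have "lift x y b \<in> hom C x y"
    unfolding lift_def using the_inv_into_into[OF inj b] by auto
  thus "lift x y b \<in> Arr C" "Dom C (lift x y b) = x" "Cod C (lift x y b) = y"
    by (auto simp: hom_def)
  show "Fa (lift x y b) = b"
    unfolding lift_def by (rule f_the_inv_into_f[OF inj b])
qed

lemma faithful:
  assumes "f \<in> Arr C" "f' \<in> Arr C" "Dom C f = Dom C f'" "Cod C f = Cod C f'" "Fa f = Fa f'"
  shows "f = f'"
proof -
  have "inj_on Fa (hom C (Dom C f) (Cod C f))"
    using assms ff[of "Dom C f" "Cod C f"] by (auto simp: bij_betw_def)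
  thus ?thesis
    using assms by (auto simp: hom_def dest: inj_onD)
qed

text \<open>Conjugation is forced: it is the only value that makes \<open>e\<close> natural from the
  composite functor to the identity.\<close>

definition Ga :: "'b \<Rightarrow> 'a" where
  "Ga b = lift (g (Dom D b)) (g (Cod D b)) (e' (Cod D b) \<cdot>\<^bsub>D\<^esub> (b \<cdot>\<^bsub>D\<^esub> e (Dom D b)))"

lemma Ga [simp]:
  assumes "b \<in> Arr D"
  shows "Ga b \<in> Arr C" "Dom C (Ga b) = g (Dom D b)" "Cod C (Ga b) = g (Cod D b)"
    "Fa (Ga b) = e' (Cod D b) \<cdot>\<^bsub>D\<^esub> (b \<cdot>\<^bsub>D\<^esub> e (Dom D b))"
  unfolding Ga_def by (rule lift; use assms in simp)+

text \<open>Cancellation in the right-nested form to which \<open>assoc\<close> brings every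
  composite.\<close>

lemma e_e'_comp [simp]:
  assumes "y \<in> Obj D" "b \<in> Arr D"
  shows "Cod D b = y \<Longrightarrow> e y \<cdot>\<^bsub>D\<^esub> (e' y \<cdot>\<^bsub>D\<^esub> b) = b"
    "Cod D b = Fo (g y) \<Longrightarrow> e' y \<cdot>\<^bsub>D\<^esub> (e y \<cdot>\<^bsub>D\<^esub> b) = b"
  using assms by (simp_all flip: F.D.assoc)

text \<open>By faithfulness the functor laws may be checked after \<open>Fa\<close>, where adjacent
  \<open>e\<close> and \<open>e'\<close> cancel.\<close>

lemma functor_Ga: "cat_functor D C g Ga"
proof (rule cat_functorI)
  fix x assume "x \<in> Obj D"
  then show "g x \<in> Obj C \<and> Ga (Ide D x) = Ide C (g x)"
    by (auto intro!: faithful)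
next
  fix f h assume "f \<in> Arr D" "h \<in> Arr D" "Dom D h = Cod D f"
  then show "Ga (h \<cdot>\<^bsub>D\<^esub> f) = Ga h \<cdot>\<^bsub>C\<^esub> Ga f"
    by (intro faithful) (auto simp: F.D.assoc)
qed (auto intro: F.C.category_axioms F.D.category_axioms)

lemma counit_natural:
  assumes "b \<in> Arr D"
  shows "e (Cod D b) \<cdot>\<^bsub>D\<^esub> Fa (Ga b) = b \<cdot>\<^bsub>D\<^esub> e (Dom D b)"
  using assms by simp

text \<open>The lift of the inverse counit at \<open>Fo x\<close>, as a triangle identity dictates.
  Naturality and invertibility can then be checked after \<open>Fa\<close>, by cancelling
  \<open>e\<close> against \<open>e'\<close>.\<close>

definition \<eta> :: "'o \<Rightarrow> 'a" where
  "\<eta> x = lift x (g (Fo x)) (e' (Fo x))"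

definition \<eta>' :: "'o \<Rightarrow> 'a" where
  "\<eta>' x = lift (g (Fo x)) x (e (Fo x))"

lemma \<eta> [simp]:
  assumes "x \<in> Obj C"
  shows "\<eta> x \<in> Arr C" "Dom C (\<eta> x) = x" "Cod C (\<eta> x) = g (Fo x)" "Fa (\<eta> x) = e' (Fo x)"
  unfolding \<eta>_def by (rule lift; use assms in simp)+

lemma \<eta>' [simp]:
  assumes "x \<in> Obj C"
  shows "\<eta>' x \<in> Arr C" "Dom C (\<eta>' x) = g (Fo x)" "Cod C (\<eta>' x) = x" "Fa (\<eta>' x) = e (Fo x)"
  unfolding \<eta>'_def by (rule lift; use assms in simp)+

lemma unit_iso:
  assumes "x \<in> Obj C"
  shows "iso_in C (\<eta> x)"
proof -
  have "\<eta>' x \<cdot>\<^bsub>C\<^esub> \<eta> x = Ide C x" "\<eta> x \<cdot>\<^bsub>C\<^esub> \<eta>' x = Ide C (g (Fo x))"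
    using assms by (auto intro!: faithful)
  thus ?thesis
    unfolding iso_in_def using assms by (auto intro!: bexI[of _ "\<eta>' x"] homI)
qed

lemma unit_natural:
  assumes "f \<in> Arr C"
  shows "\<eta> (Cod C f) \<cdot>\<^bsub>C\<^esub> f = Ga (Fa f) \<cdot>\<^bsub>C\<^esub> \<eta> (Dom C f)"
  using assms by (intro faithful) (auto simp: F.D.assoc)

end

section \<open>Strict 2-categories and a criterion for strict 2-equivalence\<close>

section \<open>2-categories\<close>

lemma two_cat_simps:
  "Obj (one_cat T) = Ob0 T" "Arr (one_cat T) = Mor1 T" "Dom (one_cat T) = src1 T"
  "Cod (one_cat T) = trg1 T" "Ide (one_cat T) = id1 T" "Comp (one_cat T) = comp1 T"
  "Obj (vert_cat T) = Mor1 T" "Arr (vert_cat T) = Cell2 T" "Dom (vert_cat T) = src2 T"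
  "Cod (vert_cat T) = trg2 T" "Ide (vert_cat T) = id2 T" "Comp (vert_cat T) = vcomp T"
  "Obj (horiz_cat T) = Ob0 T" "Arr (horiz_cat T) = Cell2 T"
  "Dom (horiz_cat T) = (\<lambda>s. src1 T (src2 T s))" "Cod (horiz_cat T) = (\<lambda>s. trg1 T (src2 T s))"
  "Ide (horiz_cat T) = (\<lambda>x. id2 T (id1 T x))" "Comp (horiz_cat T) = hcomp T"
  by (simp_all add: one_cat_def vert_cat_def horiz_cat_def)

text \<open>Sources, targets and identities of horizontal composition are inherited from the other
  two categories through the boundary conditions, so for \<open>horiz_cat\<close> only closure,
  units and associativity have to be supplied.\<close>

lemma two_categoryI:
  assumes "category (one_cat T)" "category (vert_cat T)"
    and globular: "\<And>s. s \<in> Cell2 T \<Longrightarrow> src1 T (trg2 T s) = src1 T (src2 T s) \<and>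
           trg1 T (trg2 T s) = trg1 T (src2 T s)"
    and hcomp: "\<And>s t. s \<in> Cell2 T \<Longrightarrow> t \<in> Cell2 T \<Longrightarrow> src1 T (src2 T t) = trg1 T (src2 T s) \<Longrightarrow>
           hcomp T t s \<in> Cell2 T \<and>
           src2 T (hcomp T t s) = comp1 T (src2 T t) (src2 T s) \<and>
           trg2 T (hcomp T t s) = comp1 T (trg2 T t) (trg2 T s)"
    and hcomp_unit: "\<And>s. s \<in> Cell2 T \<Longrightarrow>
           hcomp T s (id2 T (id1 T (src1 T (src2 T s)))) = s \<and>
           hcomp T (id2 T (id1 T (trg1 T (src2 T s)))) s = s"
    and hcomp_assoc: "\<And>s t u. s \<in> Cell2 T \<Longrightarrow> t \<in> Cell2 T \<Longrightarrow> u \<in> Cell2 T \<Longrightarrow>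
           src1 T (src2 T t) = trg1 T (src2 T s) \<Longrightarrow> src1 T (src2 T u) = trg1 T (src2 T t) \<Longrightarrow>
           hcomp T (hcomp T u t) s = hcomp T u (hcomp T t s)"
    and hcomp_id2: "\<And>f g. f \<in> Mor1 T \<Longrightarrow> g \<in> Mor1 T \<Longrightarrow> src1 T g = trg1 T f \<Longrightarrow>
           hcomp T (id2 T g) (id2 T f) = id2 T (comp1 T g f)"
    and interchange: "\<And>s s' t t'. s \<in> Cell2 T \<Longrightarrow> s' \<in> Cell2 T \<Longrightarrow> t \<in> Cell2 T \<Longrightarrow> t' \<in> Cell2 T \<Longrightarrow>
           src2 T s' = trg2 T s \<Longrightarrow> src2 T t' = trg2 T t \<Longrightarrow> src1 T (src2 T t) = trg1 T (src2 T s) \<Longrightarrow>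
           hcomp T (vcomp T t' t) (vcomp T s' s) = vcomp T (hcomp T t' s') (hcomp T t s)"
  shows "two_category T"
proof -
  interpret O: category "one_cat T" by fact
  interpret W: category "vert_cat T" by fact
  have mor: "src1 T f \<in> Ob0 T" "trg1 T f \<in> Ob0 T" if "f \<in> Mor1 T" for f
    using O.dom_cod_obj[of f] that by (auto simp: two_cat_simps)
  have cell: "src2 T s \<in> Mor1 T" "trg2 T s \<in> Mor1 T" if "s \<in> Cell2 T" for s
    using W.dom_cod_obj[of s] that by (auto simp: two_cat_simps)
  have id1: "id1 T x \<in> Mor1 T" "src1 T (id1 T x) = x" "trg1 T (id1 T x) = x" if "x \<in> Ob0 T" for x
    using O.ide_arr[of x] that by (auto simp: two_cat_simps)
  have id2: "id2 T f \<in> Cell2 T" "src2 T (id2 T f) = f" "trg2 T (id2 T f) = f" if "f \<in> Mor1 T" for f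
    using W.ide_arr[of f] that by (auto simp: two_cat_simps)
  have comp1: "src1 T (comp1 T g f) = src1 T f" "trg1 T (comp1 T g f) = trg1 T g"
    if "f \<in> Mor1 T" "g \<in> Mor1 T" "src1 T g = trg1 T f" for f g
    using O.comp_arr[of f g] that by (auto simp: two_cat_simps)
  have "category (horiz_cat T)"
    by (rule categoryI)
      (use hcomp hcomp_unit hcomp_assoc in \<open>auto simp: two_cat_simps mor cell id1 id2 comp1\<close>)
  then show ?thesis
    using assms(1,2) globular hcomp hcomp_id2 interchange
    by (intro two_category.intro) (auto simp: hom_def two_cat_simps)
qed

context two_category
begin

sublocale one: category "one_cat T" by (rule one_category)
sublocale vert: category "vert_cat T" by (rule vert_category)
sublocale horiz: category "horiz_cat T" by (rule horiz_category)

lemma mor1 [simp]: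
  assumes "f \<in> Mor1 T"
  shows "src1 T f \<in> Ob0 T" "trg1 T f \<in> Ob0 T"
  using one.dom_cod_obj[of f] assms by (auto simp: two_cat_simps)

lemma cell2 [simp]:
  assumes "s \<in> Cell2 T"
  shows "src2 T s \<in> Mor1 T" "trg2 T s \<in> Mor1 T"
    "src1 T (trg2 T s) = src1 T (src2 T s)" "trg1 T (trg2 T s) = trg1 T (src2 T s)"
  using vert.dom_cod_obj[of s] globular_src globular_trg assms by (auto simp: two_cat_simps)

lemma id1_mor [simp]:
  assumes "x \<in> Ob0 T"
  shows "id1 T x \<in> Mor1 T" "src1 T (id1 T x) = x" "trg1 T (id1 T x) = x"
  using one.ide_arr[of x] assms by (auto simp: two_cat_simps)

lemma id2_cell [simp]:
  assumes "f \<in> Mor1 T"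
  shows "id2 T f \<in> Cell2 T" "src2 T (id2 T f) = f" "trg2 T (id2 T f) = f"
  using vert.ide_arr[of f] assms by (auto simp: two_cat_simps)

lemma comp1_mor [simp]:
  assumes "f \<in> Mor1 T" "g \<in> Mor1 T" "src1 T g = trg1 T f"
  shows "comp1 T g f \<in> Mor1 T" "src1 T (comp1 T g f) = src1 T f" "trg1 T (comp1 T g f) = trg1 T g"
  using one.comp_arr[of f g] assms by (auto simp: two_cat_simps)

lemma vcomp_cell2 [simp]:
  assumes "s \<in> Cell2 T" "t \<in> Cell2 T" "src2 T t = trg2 T s"
  shows "vcomp T t s \<in> Cell2 T" "src2 T (vcomp T t s) = src2 T s" "trg2 T (vcomp T t s) = trg2 T t"
  using vert.comp_arr[of s t] assms by (auto simp: two_cat_simps)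

lemma hcomp_cell2 [simp]:
  assumes "s \<in> Cell2 T" "t \<in> Cell2 T" "src1 T (src2 T t) = trg1 T (src2 T s)"
  shows "hcomp T t s \<in> Cell2 T" "src2 T (hcomp T t s) = comp1 T (src2 T t) (src2 T s)"
    "trg2 T (hcomp T t s) = comp1 T (trg2 T t) (trg2 T s)"
  using horiz.comp_arr[of s t] assms
    hcomp_bounds[of s "src1 T (src2 T s)" "trg1 T (src2 T s)" t "trg1 T (src2 T t)"]
  by (auto simp: two_cat_simps hom_def)

lemma vcomp_id2 [simp]:
  assumes "f \<in> Mor1 T"
  shows "vcomp T (id2 T f) (id2 T f) = id2 T f"
  using vert.comp_ide(1)[of "id2 T f" f] assms by (auto simp: two_cat_simps)

lemma hcomp_id2_arr [simp]:
  assumes "f \<in> Mor1 T" "g \<in> Mor1 T" "src1 T g = trg1 T f"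
  shows "hcomp T (id2 T g) (id2 T f) = id2 T (comp1 T g f)"
  using hcomp_id2[of f "src1 T f" "trg1 T f" g "trg1 T g"] assms by (auto simp: two_cat_simps hom_def)

lemma interchange_arr:
  assumes "s \<in> Cell2 T" "s' \<in> Cell2 T" "t \<in> Cell2 T" "t' \<in> Cell2 T"
    "src2 T s' = trg2 T s" "src2 T t' = trg2 T t" "src1 T (src2 T t) = trg1 T (src2 T s)"
  shows "hcomp T (vcomp T t' t) (vcomp T s' s) = vcomp T (hcomp T t' s') (hcomp T t s)"
  using interchange[of s "src2 T s" "trg2 T s" s' "trg2 T s'" t "src2 T t" "trg2 T t" t' "trg2 T t'"]
    assms by (auto simp: two_cat_simps hom_def)

text \<open>The operations are unchanged, and fullness makes the smaller carriers closed under
  them.\<close>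

lemma two_category_full_sub: "two_category (full_sub_two_cat P T)"
proof -
  have "category (one_cat (full_sub_two_cat P T))"
    by (rule categoryI)
      (use one.assoc one.comp_ide in \<open>auto simp: two_cat_simps full_sub_two_cat_def\<close>)
  moreover have "category (vert_cat (full_sub_two_cat P T))"
    by (rule categoryI)
      (use vert.assoc vert.comp_ide in \<open>auto simp: two_cat_simps full_sub_two_cat_def\<close>)
  moreover have "category (horiz_cat (full_sub_two_cat P T))"
    by (rule categoryI)
      (use horiz.assoc horiz.comp_ide in \<open>auto simp: two_cat_simps full_sub_two_cat_def\<close>)
  ultimately show ?thesis
    by (intro two_category.intro)
      (auto simp: hom_def full_sub_two_cat_def two_cat_simps interchange_arr)
qed

end

context two_functor
begin

sublocale one: cat_functor "one_cat S" "one_cat T" F0 F1 by (rule functor_one)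
sublocale vert: cat_functor "vert_cat S" "vert_cat T" F1 F2 by (rule functor_vert)
sublocale horiz: cat_functor "horiz_cat S" "horiz_cat T" F0 F2 by (rule functor_horiz)

lemma map_obj [simp]: "x \<in> Ob0 S \<Longrightarrow> F0 x \<in> Ob0 T"
  using one.functor_obj[of x] by (simp add: two_cat_simps)

lemma map_mor [simp]:
  assumes "f \<in> Mor1 S"
  shows "F1 f \<in> Mor1 T" "src1 T (F1 f) = F0 (src1 S f)" "trg1 T (F1 f) = F0 (trg1 S f)"
    "F2 (id2 S f) = id2 T (F1 f)"
  using one.functor_arr[of f] vert.functor_ide[of f] assms by (auto simp: two_cat_simps)

lemma map_cell [simp]:
  assumes "s \<in> Cell2 S"
  shows "F2 s \<in> Cell2 T" "src2 T (F2 s) = F1 (src2 S s)" "trg2 T (F2 s) = F1 (trg2 S s)"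
  using vert.functor_arr[of s] assms by (auto simp: two_cat_simps)

lemma map_vcomp [simp]:
  assumes "s \<in> Cell2 S" "t \<in> Cell2 S" "src2 S t = trg2 S s"
  shows "F2 (vcomp S t s) = vcomp T (F2 t) (F2 s)"
  using vert.functor_comp_arr[of s t] assms by (auto simp: two_cat_simps)

end

lemma cat_functor_comp:
  assumes "cat_functor A B Fo Fa" "cat_functor B C Go Ga"
  shows "cat_functor A C (Go \<circ> Fo) (Ga \<circ> Fa)"
proof -
  interpret F: cat_functor A B Fo Fa by fact
  interpret G: cat_functor B C Go Ga by fact
  show ?thesis
    by (rule cat_functorI) (auto intro: F.C.category_axioms G.D.category_axioms)
qed

lemma two_functor_comp:
  assumes "two_functor R S F0 F1 F2" "two_functor S T G0 G1 G2"
  shows "two_functor R T (G0 \<circ> F0) (G1 \<circ> F1) (G2 \<circ> F2)"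
  using assms by (auto simp: two_functor_def two_functor_axioms_def intro: cat_functor_comp)

lemma cat_functor_id: "category C \<Longrightarrow> cat_functor C C id id"
  by (rule cat_functorI) auto

lemma (in two_category) two_functor_id: "two_functor T T id id id"
  by unfold_locales (auto intro: one_category vert_category horiz_category cat_functor_id
      dest: cat_functor.functor_obj)

text \<open>Unique lifting between fixed boundaries allows every law of the inverse to be checked
  after applying the 2-functor. \<open>ff_ess_functor\<close> is used once for 1-cells and once for
  2-cells under horizontal composition, with the same \<open>g\<close>.\<close>

theorem two_equivalenceI:
  assumes F: "two_functor S T F0 F1 F2"
    and bij1: "\<And>x y. x \<in> Ob0 S \<Longrightarrow> y \<in> Ob0 S \<Longrightarrow>
           bij_betw F1 (hom (one_cat S) x y) (hom (one_cat T) (F0 x) (F0 y))"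
    and bij2: "\<And>f f'. f \<in> Mor1 S \<Longrightarrow> f' \<in> Mor1 S \<Longrightarrow> src1 S f = src1 S f' \<Longrightarrow>
           trg1 S f = trg1 S f' \<Longrightarrow> bij_betw F2 (hom (vert_cat S) f f') (hom (vert_cat T) (F1 f) (F1 f'))"
    and ess: "\<And>y. y \<in> Ob0 T \<Longrightarrow> \<exists>x \<in> Ob0 S. \<exists>e \<in> hom (one_cat T) (F0 x) y. iso_in (one_cat T) e"
  shows "two_equivalence S T F0 F1 F2"
proof -
  interpret F: two_functor S T F0 F1 F2 by fact
  have "\<forall>y. \<exists>x e e'. y \<in> Ob0 T \<longrightarrow> x \<in> Ob0 S \<and> e \<in> hom (one_cat T) (F0 x) y \<and>
      e' \<in> hom (one_cat T) y (F0 x) \<and> comp1 T e e' = id1 T y \<and> comp1 T e' e = id1 T (F0 x)"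
    using ess unfolding iso_in_def by (fastforce simp: two_cat_simps hom_def)
  then obtain g e e' where ge: "\<And>y. y \<in> Ob0 T \<Longrightarrow> g y \<in> Ob0 S \<and> e y \<in> hom (one_cat T) (F0 (g y)) y \<and>
      e' y \<in> hom (one_cat T) y (F0 (g y)) \<and> comp1 T (e y) (e' y) = id1 T y \<and>
      comp1 T (e' y) (e y) = id1 T (F0 (g y))"
    by metis
  interpret one: ff_ess_functor "one_cat S" "one_cat T" F0 F1 g e e'
    by unfold_locales (use ge bij1 in \<open>auto simp: two_cat_simps\<close>)
  have mor1_inj: "f = f'" if "f \<in> Mor1 S" "f' \<in> Mor1 S" "src1 S f = src1 S f'" "trg1 S f = trg1 S f'"
    "F1 f = F1 f'" for f f'
    using one.faithful[of f f'] that by (auto simp: two_cat_simps)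
  \<comment> \<open>Only the boundary objects are known to agree. Equal images have equal boundary
    1-cells, which injectivity of \<open>F1\<close> pulls back; only then does \<open>bij2\<close>
    apply.\<close>
  have cell2_inj: "s = s'" if s: "s \<in> Cell2 S" "s' \<in> Cell2 S"
    "src1 S (src2 S s) = src1 S (src2 S s')" "trg1 S (src2 S s) = trg1 S (src2 S s')"
    "F2 s = F2 s'" for s s'
  proof -
    have "src2 S s = src2 S s'" "trg2 S s = trg2 S s'"
      using s F.map_cell[of s] F.map_cell[of s'] by (auto intro!: mor1_inj)
    moreover have "inj_on F2 (hom (vert_cat S) (src2 S s) (trg2 S s))"
      using bij2[of "src2 S s" "trg2 S s"] s(1) by (auto simp: bij_betw_def)
    ultimately show ?thesis
      using s by (auto simp: hom_def two_cat_simps dest: inj_onD)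
  qed
  \<comment> \<open>Dually, the two boundary 1-cells are lifted by \<open>bij1\<close> before the
    2-cell is lifted by \<open>bij2\<close>.\<close>
  have cell2_surj: "t \<in> F2 ` hom (horiz_cat S) x y"
    if "x \<in> Ob0 S" "y \<in> Ob0 S" "t \<in> hom (horiz_cat T) (F0 x) (F0 y)" for x y t
  proof -
    have t: "t \<in> Cell2 T" "src1 T (src2 T t) = F0 x" "trg1 T (src2 T t) = F0 y"
      using that by (auto simp: hom_def two_cat_simps)
    then have "src2 T t \<in> hom (one_cat T) (F0 x) (F0 y)" "trg2 T t \<in> hom (one_cat T) (F0 x) (F0 y)"
      by (auto simp: hom_def two_cat_simps)
    then have "src2 T t \<in> F1 ` hom (one_cat S) x y" "trg2 T t \<in> F1 ` hom (one_cat S) x y"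
      using bij1[of x y] that by (auto simp: bij_betw_def)
    then obtain f f' where f: "f \<in> hom (one_cat S) x y" "src2 T t = F1 f"
      "f' \<in> hom (one_cat S) x y" "trg2 T t = F1 f'"
      by blast
    have "t \<in> hom (vert_cat T) (F1 f) (F1 f')"
      using t f by (auto simp: hom_def two_cat_simps)
    then have "t \<in> F2 ` hom (vert_cat S) f f'"
      using bij2[of f f'] f by (auto simp: bij_betw_def hom_def two_cat_simps)
    then show ?thesis
      using f by (auto simp: hom_def two_cat_simps)
  qed
  have e [simp]: "e y \<in> Mor1 T" "src1 T (e y) = F0 (g y)" "trg1 T (e y) = y"
    "e' y \<in> Mor1 T" "trg1 T (e' y) = F0 (g y)" "src1 T (e' y) = y"
    "comp1 T (e y) (e' y) = id1 T y" "comp1 T (e' y) (e y) = id1 T (F0 (g y))"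
    "g y \<in> Ob0 S"
    if "y \<in> Ob0 T" for y
    using ge[OF that] by (auto simp: hom_def two_cat_simps)
  \<comment> \<open>Identity 2-cells compose horizontally to identity 2-cells, so those on
    \<open>e\<close> and \<open>e'\<close> are mutually inverse in the horizontal category.\<close>
  interpret horiz: ff_ess_functor "horiz_cat S" "horiz_cat T" F0 F2 g "\<lambda>y. id2 T (e y)" "\<lambda>y. id2 T (e' y)"
  proof unfold_locales
    fix x y assume "x \<in> Obj (horiz_cat S)" "y \<in> Obj (horiz_cat S)"
    then show "bij_betw F2 (hom (horiz_cat S) x y) (hom (horiz_cat T) (F0 x) (F0 y))"
      unfolding bij_betw_def inj_on_def using cell2_surj[of x y]
      by (auto simp: hom_def two_cat_simps intro: cell2_inj)
  qed (auto simp: two_cat_simps hom_def)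
  have G2 [simp]: "horiz.Ga t \<in> Cell2 S" "src1 S (src2 S (horiz.Ga t)) = g (src1 T (src2 T t))"
    "trg1 S (src2 S (horiz.Ga t)) = g (trg1 T (src2 T t))"
    "F2 (horiz.Ga t) = hcomp T (id2 T (e' (trg1 T (src2 T t)))) (hcomp T t (id2 T (e (src1 T (src2 T t)))))"
    if "t \<in> Cell2 T" for t
    using horiz.Ga[of t] that by (auto simp: two_cat_simps)
  have G1 [simp]: "one.Ga f \<in> Mor1 S" "src1 S (one.Ga f) = g (src1 T f)"
    "trg1 S (one.Ga f) = g (trg1 T f)"
    "F1 (one.Ga f) = comp1 T (e' (trg1 T f)) (comp1 T f (e (src1 T f)))"
    if "f \<in> Mor1 T" for f
    using one.Ga[of f] that by (auto simp: two_cat_simps)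
  \<comment> \<open>The inverses on 1-cells and on 2-cells come from two separate interpretations;
    injectivity of \<open>F1\<close> shows that their boundaries match.\<close>
  have G2_bounds [simp]: "src2 S (horiz.Ga t) = one.Ga (src2 T t)" "trg2 S (horiz.Ga t) = one.Ga (trg2 T t)"
    if "t \<in> Cell2 T" for t
    using that by (auto intro!: mor1_inj simp flip: F.map_cell)
  have "cat_functor (vert_cat T) (vert_cat S) one.Ga horiz.Ga"
  proof (rule cat_functorI)
    fix s t assume st: "s \<in> Arr (vert_cat T)" "t \<in> Arr (vert_cat T)"
      "Dom (vert_cat T) t = Cod (vert_cat T) s"
    then have st: "s \<in> Cell2 T" "t \<in> Cell2 T" "src2 T t = trg2 T s"
      by (auto simp: two_cat_simps)
    let ?e = "id2 T (e (src1 T (src2 T s)))" and ?e' = "id2 T (e' (trg1 T (src2 T s)))"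
    \<comment> \<open>Each outer identity is written as its own vertical square, so that interchange
      can distribute the conjugation over both factors.\<close>
    have "hcomp T ?e' (hcomp T (vcomp T t s) ?e) =
        hcomp T (vcomp T ?e' ?e') (hcomp T (vcomp T t s) (vcomp T ?e ?e))"
      using st by simp
    also have "\<dots> = vcomp T (hcomp T ?e' (hcomp T t ?e)) (hcomp T ?e' (hcomp T s ?e))"
      using st by (simp add: F.T.interchange_arr del: F.T.vcomp_id2)
    finally have "horiz.Ga (vcomp T t s) = vcomp S (horiz.Ga t) (horiz.Ga s)"
      using st by (intro cell2_inj) auto
    then show "horiz.Ga (Comp (vert_cat T) t s) = Comp (vert_cat S) (horiz.Ga t) (horiz.Ga s)"
      by (simp add: two_cat_simps)
  qed (auto simp: two_cat_simps F.T.vert_category F.S.vert_category intro!: cell2_inj)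
  then have G: "two_functor T S g one.Ga horiz.Ga"
    using one.functor_Ga horiz.functor_Ga F.S.two_category_axioms F.T.two_category_axioms
    by (simp add: two_functor_def two_functor_axioms_def)
  have \<eta> [simp]: "one.\<eta> x \<in> Mor1 S" "src1 S (one.\<eta> x) = x" "trg1 S (one.\<eta> x) = g (F0 x)"
    "F1 (one.\<eta> x) = e' (F0 x)" if "x \<in> Ob0 S" for x
    using one.\<eta>[of x] that by (auto simp: two_cat_simps)
  \<comment> \<open>The unit for 2-cells is the identity 2-cell on the unit for 1-cells. Hence
    naturality in the horizontal category is exactly the 2-dimensional naturality of
    \<open>one.\<eta>\<close>.\<close>
  have horiz_\<eta>: "horiz.\<eta> x = id2 S (one.\<eta> x)" if "x \<in> Ob0 S" for x
    using horiz.\<eta>[of x] that by (intro cell2_inj) (auto simp: two_cat_simps)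
  have "two_nat_iso S S id id id (g \<circ> F0) (one.Ga \<circ> F1) (horiz.Ga \<circ> F2) one.\<eta>"
  proof (intro two_nat_iso.intro two_nat_iso_axioms.intro F.S.two_functor_id two_functor_comp[OF F G])
    fix f x y assume "f \<in> hom (one_cat S) x y"
    then show "comp1 S (one.\<eta> y) (id f) = comp1 S ((one.Ga \<circ> F1) f) (one.\<eta> x)"
      using one.unit_natural[of f] by (auto simp: hom_def two_cat_simps)
  next
    fix s x y assume "s \<in> hom (horiz_cat S) x y"
    then show "hcomp S (id2 S (one.\<eta> y)) (id s) = hcomp S ((horiz.Ga \<circ> F2) s) (id2 S (one.\<eta> x))"
      using horiz.unit_natural[of s] by (auto simp: hom_def two_cat_simps horiz_\<eta>)
  qed (use one.unit_iso in \<open>auto simp: two_cat_simps hom_def\<close>)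
  moreover have "two_nat_iso T T (F0 \<circ> g) (F1 \<circ> one.Ga) (F2 \<circ> horiz.Ga) id id id e"
  proof (intro two_nat_iso.intro two_nat_iso_axioms.intro F.T.two_functor_id two_functor_comp[OF G F])
    fix f x y assume "f \<in> hom (one_cat T) x y"
    then show "comp1 T (e y) ((F1 \<circ> one.Ga) f) = comp1 T (id f) (e x)"
      using one.counit_natural[of f] by (auto simp: hom_def two_cat_simps)
  next
    fix s x y assume "s \<in> hom (horiz_cat T) x y"
    then show "hcomp T (id2 T (e y)) ((F2 \<circ> horiz.Ga) s) = hcomp T (id s) (id2 T (e x))"
      using horiz.counit_natural[of s] by (auto simp: hom_def two_cat_simps)
  next
    fix x assume "x \<in> Ob0 T"
    then show "iso_in (one_cat T) (e x)"
      unfolding iso_in_def by (auto simp: two_cat_simps hom_def intro!: exI[of _ "e' x"])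
  qed (auto simp: two_cat_simps hom_def)
  ultimately show ?thesis
    unfolding two_equivalence_def using F G by blast
qed

section \<open>The 2-category of categories with extra structure\<close>

section \<open>2-categories of structured categories\<close>

lemma truncate_simps [simp]:
  "Obj (cat.truncate M) = Obj M" "Arr (cat.truncate M) = Arr M" "Dom (cat.truncate M) = Dom M"
  "Cod (cat.truncate M) = Cod M" "Ide (cat.truncate M) = Ide M" "Comp (cat.truncate M) = Comp M"
  by (simp_all add: cat.truncate_def)

lemma hom_truncate [simp]: "hom (cat.truncate M) x y = hom M x y"
  by (simp add: hom_def)

lemma category_truncate [simp]: "category (cat.truncate M) \<longleftrightarrow> category M"
  by (simp add: category_def)

lemma cat_functor_truncate [simp]:
  "cat_functor (cat.truncate M) (cat.truncate N) Fo Fa \<longleftrightarrow> cat_functor M N Fo Fa"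
  by (simp add: cat_functor_def cat_functor_axioms_def)

lemma nat_trans_truncate [simp]:
  "nat_trans (cat.truncate M) (cat.truncate N) Fo Fa Go Ga \<tau> \<longleftrightarrow> nat_trans M N Fo Fa Go Ga \<tau>"
  by (simp add: nat_trans_def nat_trans_axioms_def)

lemma nat_transI:
  assumes "cat_functor C D Fo Fa" "cat_functor C D Go Ga"
    and "\<And>x. x \<in> Obj C \<Longrightarrow> \<tau> x \<in> Arr D \<and> Dom D (\<tau> x) = Fo x \<and> Cod D (\<tau> x) = Go x"
    and "\<And>f. f \<in> Arr C \<Longrightarrow> Comp D (\<tau> (Cod C f)) (Fa f) = Comp D (Ga f) (\<tau> (Dom C f))"
  shows "nat_trans C D Fo Fa Go Ga \<tau>"
  using assms by (auto simp: nat_trans_def nat_trans_axioms_def hom_def)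

lemma nat_transD:
  assumes "nat_trans C D Fo Fa Go Ga \<tau>"
  shows "x \<in> Obj C \<Longrightarrow> \<tau> x \<in> Arr D" "x \<in> Obj C \<Longrightarrow> Dom D (\<tau> x) = Fo x" "x \<in> Obj C \<Longrightarrow> Cod D (\<tau> x) = Go x"
    and "f \<in> Arr C \<Longrightarrow> Comp D (\<tau> (Cod C f)) (Fa f) = Comp D (Ga f) (\<tau> (Dom C f))"
  using assms by (auto simp: nat_trans_def nat_trans_axioms_def hom_def)

text \<open>
  \<open>V\<close>-modules and \<open>V\<close>-\<open>\<delta>\<close>modules differ only in the structure \<open>Str\<close> on 1-cells and in the condition
  \<open>compat\<close> that it imposes on natural transformations.
\<close>

locale structured_cats =
  fixes cat_of :: "'mod \<Rightarrow> ('o, 'a) cat"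
    and isob :: "'mod \<Rightarrow> bool"
    and ismor :: "('o, 'a, 'mod, 'str) mor \<Rightarrow> bool"
    and iscell :: "('o, 'a, 'mod, 'str) cell \<Rightarrow> bool"
    and compat :: "('o, 'a, 'mod, 'str) cell \<Rightarrow> bool"
    and idm :: "'mod \<Rightarrow> ('o, 'a, 'mod, 'str) mor"
    and cmp :: "('o, 'a, 'mod, 'str) mor \<Rightarrow> ('o, 'a, 'mod, 'str) mor \<Rightarrow> ('o, 'a, 'mod, 'str) mor"
  assumes cat [simp]: "isob M \<Longrightarrow> category (cat_of M)"
    and mor_ob [simp]: "ismor F \<Longrightarrow> isob (Src F)" "ismor F \<Longrightarrow> isob (Trg F)"
    and mor_functor: "ismor F \<Longrightarrow> cat_functor (cat_of (Src F)) (cat_of (Trg F)) (OMap F) (AMap F)"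
    and mor_ext: "ismor F \<Longrightarrow> OMap F \<in> extensional (Obj (cat_of (Src F)))"
      "ismor F \<Longrightarrow> AMap F \<in> extensional (Arr (cat_of (Src F)))"
    and cell_iff: "iscell s \<longleftrightarrow> ismor (SrcC s) \<and> ismor (TrgC s) \<and> parallel (SrcC s) (TrgC s) \<and>
          nat_trans (cat_of (Src (SrcC s))) (cat_of (Trg (SrcC s)))
            (OMap (SrcC s)) (AMap (SrcC s)) (OMap (TrgC s)) (AMap (TrgC s)) (At s) \<and>
          At s \<in> extensional (Obj (cat_of (Src (SrcC s)))) \<and> compat s"
    and idm_mor [simp]: "isob M \<Longrightarrow> ismor (idm M)"
    and idm_simps [simp]: "Src (idm M) = M" "Trg (idm M) = M"
      "OMap (idm M) = restrict id (Obj (cat_of M))" "AMap (idm M) = restrict id (Arr (cat_of M))"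
    and cmp_mor [simp]: "ismor F \<Longrightarrow> ismor G \<Longrightarrow> Src G = Trg F \<Longrightarrow> ismor (cmp G F)"
    and cmp_simps [simp]: "Src (cmp G F) = Src F" "Trg (cmp G F) = Trg G"
      "OMap (cmp G F) = restrict (OMap G \<circ> OMap F) (Obj (cat_of (Src F)))"
      "AMap (cmp G F) = restrict (AMap G \<circ> AMap F) (Arr (cat_of (Src F)))"
    and cmp_Str_assoc: "ismor F \<Longrightarrow> ismor G \<Longrightarrow> ismor H \<Longrightarrow> Src G = Trg F \<Longrightarrow> Src H = Trg G \<Longrightarrow>
          Str (cmp (cmp H G) F) = Str (cmp H (cmp G F))"
    and cmp_Str_idm: "ismor F \<Longrightarrow> Str (cmp F (idm (Src F))) = Str F"
      "ismor F \<Longrightarrow> Str (cmp (idm (Trg F)) F) = Str F"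
    and compat_id: "ismor F \<Longrightarrow> compat (id_cell cat_of F)"
    and compat_vcomp: "iscell s \<Longrightarrow> iscell t \<Longrightarrow> SrcC t = TrgC s \<Longrightarrow> compat (vcomp_cell cat_of t s)"
    and compat_hcomp: "iscell s \<Longrightarrow> iscell t \<Longrightarrow> Src (SrcC t) = Trg (SrcC s) \<Longrightarrow>
          compat (hcomp_cell cat_of cmp t s)"
begin

lemma mor_simps [simp]:
  assumes "ismor F"
  shows "x \<in> Obj (cat_of (Src F)) \<Longrightarrow> OMap F x \<in> Obj (cat_of (Trg F))"
    "f \<in> Arr (cat_of (Src F)) \<Longrightarrow> AMap F f \<in> Arr (cat_of (Trg F))"
    "f \<in> Arr (cat_of (Src F)) \<Longrightarrow> Dom (cat_of (Trg F)) (AMap F f) = OMap F (Dom (cat_of (Src F)) f)"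
    "f \<in> Arr (cat_of (Src F)) \<Longrightarrow> Cod (cat_of (Trg F)) (AMap F f) = OMap F (Cod (cat_of (Src F)) f)"
    "x \<in> Obj (cat_of (Src F)) \<Longrightarrow>
       AMap F (Ide (cat_of (Src F)) x) = Ide (cat_of (Trg F)) (OMap F x)"
    "f \<in> Arr (cat_of (Src F)) \<Longrightarrow> g \<in> Arr (cat_of (Src F)) \<Longrightarrow>
       Dom (cat_of (Src F)) g = Cod (cat_of (Src F)) f \<Longrightarrow>
       AMap F (g \<cdot>\<^bsub>cat_of (Src F)\<^esub> f) = AMap F g \<cdot>\<^bsub>cat_of (Trg F)\<^esub> AMap F f"
proof -
  interpret cat_functor "cat_of (Src F)" "cat_of (Trg F)" "OMap F" "AMap F"
    by (rule mor_functor[OF assms])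
  show "x \<in> Obj (cat_of (Src F)) \<Longrightarrow> OMap F x \<in> Obj (cat_of (Trg F))"
    "f \<in> Arr (cat_of (Src F)) \<Longrightarrow> AMap F f \<in> Arr (cat_of (Trg F))"
    "f \<in> Arr (cat_of (Src F)) \<Longrightarrow> Dom (cat_of (Trg F)) (AMap F f) = OMap F (Dom (cat_of (Src F)) f)"
    "f \<in> Arr (cat_of (Src F)) \<Longrightarrow> Cod (cat_of (Trg F)) (AMap F f) = OMap F (Cod (cat_of (Src F)) f)"
    "x \<in> Obj (cat_of (Src F)) \<Longrightarrow>
       AMap F (Ide (cat_of (Src F)) x) = Ide (cat_of (Trg F)) (OMap F x)"
    "f \<in> Arr (cat_of (Src F)) \<Longrightarrow> g \<in> Arr (cat_of (Src F)) \<Longrightarrow>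
       Dom (cat_of (Src F)) g = Cod (cat_of (Src F)) f \<Longrightarrow>
       AMap F (g \<cdot>\<^bsub>cat_of (Src F)\<^esub> f) = AMap F g \<cdot>\<^bsub>cat_of (Trg F)\<^esub> AMap F f"
    by simp_all
qed

lemma cell_simps [simp]:
  assumes "iscell s"
  shows "ismor (SrcC s)" "ismor (TrgC s)" "Src (TrgC s) = Src (SrcC s)" "Trg (TrgC s) = Trg (SrcC s)"
    "x \<in> Obj (cat_of (Src (SrcC s))) \<Longrightarrow> At s x \<in> Arr (cat_of (Trg (SrcC s)))"
    "x \<in> Obj (cat_of (Src (SrcC s))) \<Longrightarrow> Dom (cat_of (Trg (SrcC s))) (At s x) = OMap (SrcC s) x"
    "x \<in> Obj (cat_of (Src (SrcC s))) \<Longrightarrow> Cod (cat_of (Trg (SrcC s))) (At s x) = OMap (TrgC s) x"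
  using assms by (auto simp: cell_iff parallel_def nat_transD)

lemma cell_natural:
  assumes "iscell s" "f \<in> Arr (cat_of (Src (SrcC s)))"
    "Dom (cat_of (Src (SrcC s))) f = x" "Cod (cat_of (Src (SrcC s))) f = y"
  shows "At s y \<cdot>\<^bsub>cat_of (Trg (SrcC s))\<^esub> AMap (SrcC s) f =
    AMap (TrgC s) f \<cdot>\<^bsub>cat_of (Trg (SrcC s))\<^esub> At s x"
proof -
  have "nat_trans (cat_of (Src (SrcC s))) (cat_of (Trg (SrcC s)))
      (OMap (SrcC s)) (AMap (SrcC s)) (OMap (TrgC s)) (AMap (TrgC s)) (At s)"
    using assms(1) unfolding cell_iff by blast
  from nat_transD(4)[OF this assms(2)] show ?thesis
    using assms(3,4) by simp
qed

lemma cell_extensional: "iscell s \<Longrightarrow> At s \<in> extensional (Obj (cat_of (Src (SrcC s))))"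
  unfolding cell_iff by blast

text \<open>The category varies with the 1-cell, so its laws serve as rules conditional on
  \<open>category (cat_of M)\<close> instead of through one interpretation.\<close>

lemmas [simp] = category.comp_arr category.ide_arr category.dom_cod_obj category.comp_ide

lemma cmp_assoc:
  assumes "ismor F" "ismor G" "ismor H" "Src G = Trg F" "Src H = Trg G"
  shows "cmp (cmp H G) F = cmp H (cmp G F)"
  using assms mor_simps[of F] by (intro mor.equality) (auto simp: cmp_Str_assoc fun_eq_iff)

lemma cmp_idm:
  assumes "ismor F"
  shows "cmp F (idm (Src F)) = F" "cmp (idm (Trg F)) F = F"
  using assms mor_ext[of F]
  by (auto intro!: mor.equality simp: cmp_Str_idm fun_eq_iff extensional_def)

lemma id_cell [simp]:
  assumes "ismor F"
  shows "iscell (id_cell cat_of F)"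
  unfolding cell_iff
  using assms compat_id[OF assms] mor_functor
  by (auto intro!: nat_transI simp: id_cell_def parallel_def)

lemma vcomp_cell [simp]:
  assumes st: "iscell s" "iscell t" "SrcC t = TrgC s"
  shows "iscell (vcomp_cell cat_of t s)"
proof -
  let ?M = "cat_of (Src (SrcC s))" and ?N = "cat_of (Trg (SrcC s))"
  have "(At t (Cod ?M f) \<cdot>\<^bsub>?N\<^esub> At s (Cod ?M f)) \<cdot>\<^bsub>?N\<^esub> AMap (SrcC s) f =
      AMap (TrgC t) f \<cdot>\<^bsub>?N\<^esub> (At t (Dom ?M f) \<cdot>\<^bsub>?N\<^esub> At s (Dom ?M f))"
    if f: "f \<in> Arr ?M" for f
  proof -
    have [simp]: "category ?M" "category ?N"
      using st by auto
    have t: "At t x \<in> Arr ?N" "Dom ?N (At t x) = OMap (TrgC s) x" "Cod ?N (At t x) = OMap (TrgC t) x"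
      if "x \<in> Obj ?M" for x
      using cell_simps(5-)[of t x] st that by auto
    have T: "AMap (TrgC s) f \<in> Arr ?N" "Dom ?N (AMap (TrgC s) f) = OMap (TrgC s) (Dom ?M f)"
       "Cod ?N (AMap (TrgC s) f) = OMap (TrgC s) (Cod ?M f)"
       "AMap (TrgC t) f \<in> Arr ?N" "Dom ?N (AMap (TrgC t) f) = OMap (TrgC t) (Dom ?M f)"
       "Cod ?N (AMap (TrgC t) f) = OMap (TrgC t) (Cod ?M f)"
      using st f mor_simps[of "TrgC s"] mor_simps[of "TrgC t"] by auto
    have 1: "At t (Cod ?M f) \<cdot>\<^bsub>?N\<^esub> AMap (TrgC s) f = AMap (TrgC t) f \<cdot>\<^bsub>?N\<^esub> At t (Dom ?M f)"
      using cell_natural[of t f] st f by simp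
    have "(At t (Cod ?M f) \<cdot>\<^bsub>?N\<^esub> At s (Cod ?M f)) \<cdot>\<^bsub>?N\<^esub> AMap (SrcC s) f =
        At t (Cod ?M f) \<cdot>\<^bsub>?N\<^esub> (AMap (TrgC s) f \<cdot>\<^bsub>?N\<^esub> At s (Dom ?M f))"
      using st f t T by (simp add: category.assoc cell_natural)
    also have "\<dots> = AMap (TrgC t) f \<cdot>\<^bsub>?N\<^esub> (At t (Dom ?M f) \<cdot>\<^bsub>?N\<^esub> At s (Dom ?M f))"
      using st f t T by (simp add: category.assoc[symmetric] 1)
    finally show ?thesis .
  qed
  then show ?thesis
    unfolding cell_iff
    using st compat_vcomp[OF st] mor_functor[of "SrcC s"] mor_functor[of "TrgC t"]
      cell_simps(3-)[of t]
    by (auto intro!: nat_transI simp: vcomp_cell_def parallel_def)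
qed

lemma hcomp_cell [simp]:
  assumes st: "iscell s" "iscell t" "Src (SrcC t) = Trg (SrcC s)"
  shows "iscell (hcomp_cell cat_of cmp t s)"
proof -
  let ?L = "cat_of (Src (SrcC s))" and ?M = "cat_of (Trg (SrcC s))" and ?N = "cat_of (Trg (SrcC t))"
  note * = cell_simps[OF st(1)] cell_simps[OF st(2)] st
  have cat [simp]: "category ?L" "category ?M" "category ?N"
    using * by auto
  note mors = mor_simps[of "SrcC s"] mor_simps[of "TrgC s"] mor_simps[of "SrcC t", unfolded st(3)]
     mor_simps[of "TrgC t"]
  have "(At t (OMap (TrgC s) (Cod ?L f)) \<cdot>\<^bsub>?N\<^esub> AMap (SrcC t) (At s (Cod ?L f))) \<cdot>\<^bsub>?N\<^esub>
         AMap (SrcC t) (AMap (SrcC s) f) =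
       AMap (TrgC t) (AMap (TrgC s) f) \<cdot>\<^bsub>?N\<^esub>
         (At t (OMap (TrgC s) (Dom ?L f)) \<cdot>\<^bsub>?N\<^esub> AMap (SrcC t) (At s (Dom ?L f)))" (is "?l = ?r")
    if f: "f \<in> Arr ?L" for f
  proof -
    have "?l = At t (OMap (TrgC s) (Cod ?L f)) \<cdot>\<^bsub>?N\<^esub> AMap (SrcC t) (At s (Cod ?L f) \<cdot>\<^bsub>?M\<^esub> AMap (SrcC s) f)"
      using f * mors by (simp add: category.assoc)
    also have "\<dots> = At t (OMap (TrgC s) (Cod ?L f)) \<cdot>\<^bsub>?N\<^esub> AMap (SrcC t) (AMap (TrgC s) f \<cdot>\<^bsub>?M\<^esub> At s (Dom ?L f))"
      using f * by (simp add: cell_natural)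
    also have "\<dots> = (At t (OMap (TrgC s) (Cod ?L f)) \<cdot>\<^bsub>?N\<^esub> AMap (SrcC t) (AMap (TrgC s) f)) \<cdot>\<^bsub>?N\<^esub> AMap (SrcC t) (At s (Dom ?L f))"
      using f * mors by (simp add: category.assoc)
    \<comment> \<open>Naturality of \<open>t\<close> at the arrow \<open>AMap (TrgC s) f\<close>;
      that of \<open>s\<close> has been used inside \<open>SrcC t\<close>.\<close>
    also have "At t (OMap (TrgC s) (Cod ?L f)) \<cdot>\<^bsub>?N\<^esub> AMap (SrcC t) (AMap (TrgC s) f) =
        AMap (TrgC t) (AMap (TrgC s) f) \<cdot>\<^bsub>?N\<^esub> At t (OMap (TrgC s) (Dom ?L f))"
      by (rule cell_natural) (use f * mors in auto)
    finally show ?thesis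
      using f * mors by (simp add: category.assoc)
  qed
  then show ?thesis
    unfolding cell_iff
    using * mors compat_hcomp[OF st] mor_functor[of "cmp (SrcC t) (SrcC s)"] mor_functor[of "cmp (TrgC t) (TrgC s)"]
    by (auto intro!: nat_transI simp: hcomp_cell_def parallel_def)
qed

definition two_cat :: "('mod, ('o, 'a, 'mod, 'str) mor, ('o, 'a, 'mod, 'str) cell) two_cat" where
  "two_cat = \<lparr>Ob0 = {M. isob M}, Mor1 = {F. ismor F}, Cell2 = {s. iscell s},
     src1 = Src, trg1 = Trg, src2 = SrcC, trg2 = TrgC, id1 = idm, comp1 = cmp,
     id2 = id_cell cat_of, vcomp = vcomp_cell cat_of, hcomp = hcomp_cell cat_of cmp\<rparr>"

lemma two_category: "two_category two_cat"
proof (rule two_categoryI)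
  show "category (one_cat two_cat)"
    by (rule categoryI) (auto simp: two_cat_simps two_cat_def cmp_assoc cmp_idm)
  show "category (vert_cat two_cat)"
  proof (rule categoryI)
    fix s assume "s \<in> Arr (vert_cat two_cat)"
    then have s: "iscell s"
      by (simp add: two_cat_simps two_cat_def)
    then have "vcomp_cell cat_of s (id_cell cat_of (SrcC s)) = s"
      "vcomp_cell cat_of (id_cell cat_of (TrgC s)) s = s"
      using cell_extensional[OF s]
      by (auto intro!: cell.equality simp: vcomp_cell_def id_cell_def fun_eq_iff extensional_def)
    then show "Comp (vert_cat two_cat) s (Ide (vert_cat two_cat) (Dom (vert_cat two_cat) s)) = s \<and>
        Comp (vert_cat two_cat) (Ide (vert_cat two_cat) (Cod (vert_cat two_cat) s)) s = s"
      by (simp add: two_cat_simps two_cat_def)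
  next
    fix s t u assume "s \<in> Arr (vert_cat two_cat)" "t \<in> Arr (vert_cat two_cat)" "u \<in> Arr (vert_cat two_cat)"
      "Dom (vert_cat two_cat) t = Cod (vert_cat two_cat) s"
      "Dom (vert_cat two_cat) u = Cod (vert_cat two_cat) t"
    then have stu: "iscell s" "iscell t" "iscell u" "SrcC t = TrgC s" "SrcC u = TrgC t"
      by (auto simp: two_cat_simps two_cat_def)
    then have "vcomp_cell cat_of (vcomp_cell cat_of u t) s = vcomp_cell cat_of u (vcomp_cell cat_of t s)"
      using cell_simps(3-)[of t] cell_simps(3-)[of u] cell_simps[of s]
      by (auto intro!: cell.equality simp: vcomp_cell_def fun_eq_iff category.assoc)
    then show "Comp (vert_cat two_cat) (Comp (vert_cat two_cat) u t) s =
        Comp (vert_cat two_cat) u (Comp (vert_cat two_cat) t s)"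
      by (simp add: two_cat_simps two_cat_def)
  qed (auto simp: two_cat_simps two_cat_def, auto simp: id_cell_def vcomp_cell_def)
next
  fix s assume "s \<in> Cell2 two_cat"
  then have s: "iscell s"
    by (simp add: two_cat_def)
  then have "hcomp_cell cat_of cmp s (id_cell cat_of (idm (Src (SrcC s)))) = s"
    "hcomp_cell cat_of cmp (id_cell cat_of (idm (Trg (SrcC s)))) s = s"
    using cell_extensional[OF s] cmp_idm[of "SrcC s"] cmp_idm[of "TrgC s"] mor_simps(1)[of "TrgC s"]
    by (auto intro!: cell.equality simp: hcomp_cell_def id_cell_def fun_eq_iff extensional_def)
  then show "hcomp two_cat s (id2 two_cat (id1 two_cat (src1 two_cat (src2 two_cat s)))) = s \<and>
      hcomp two_cat (id2 two_cat (id1 two_cat (trg1 two_cat (src2 two_cat s)))) s = s"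
    by (simp add: two_cat_def)
next
  fix s t u assume "s \<in> Cell2 two_cat" "t \<in> Cell2 two_cat" "u \<in> Cell2 two_cat"
    "src1 two_cat (src2 two_cat t) = trg1 two_cat (src2 two_cat s)"
    "src1 two_cat (src2 two_cat u) = trg1 two_cat (src2 two_cat t)"
  then have stu: "iscell s" "iscell t" "iscell u" "Src (SrcC t) = Trg (SrcC s)"
    "Src (SrcC u) = Trg (SrcC t)"
    by (auto simp: two_cat_def)
  note * = cell_simps[OF stu(1)] cell_simps[OF stu(2)] cell_simps[OF stu(3)] stu
  note mors = mor_simps[of "SrcC s"] mor_simps[of "TrgC s"] mor_simps[of "SrcC t", unfolded stu(4)]
     mor_simps[of "TrgC t"] mor_simps[of "SrcC u", unfolded stu(5)]
  have "hcomp_cell cat_of cmp (hcomp_cell cat_of cmp u t) s = hcomp_cell cat_of cmp u (hcomp_cell cat_of cmp t s)"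
  proof (rule cell.equality)
    show "At (hcomp_cell cat_of cmp (hcomp_cell cat_of cmp u t) s) =
        At (hcomp_cell cat_of cmp u (hcomp_cell cat_of cmp t s))"
    proof
      fix x
      show "At (hcomp_cell cat_of cmp (hcomp_cell cat_of cmp u t) s) x =
          At (hcomp_cell cat_of cmp u (hcomp_cell cat_of cmp t s)) x"
      proof (cases "x \<in> Obj (cat_of (Src (SrcC s)))")
        case True
        then show ?thesis
          using * mors by (simp add: hcomp_cell_def category.assoc)
      qed (simp add: hcomp_cell_def)
    qed
  qed (use * in \<open>simp_all add: hcomp_cell_def cmp_assoc\<close>)
  then show "hcomp two_cat (hcomp two_cat u t) s = hcomp two_cat u (hcomp two_cat t s)"
    by (simp add: two_cat_def)
next
  fix f g assume "f \<in> Mor1 two_cat" "g \<in> Mor1 two_cat" "src1 two_cat g = trg1 two_cat f"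
  then show "hcomp two_cat (id2 two_cat g) (id2 two_cat f) = id2 two_cat (comp1 two_cat g f)"
    using mor_simps[of f] mor_simps[of g]
    by (auto intro!: cell.equality simp: two_cat_def hcomp_cell_def id_cell_def fun_eq_iff)
next
  fix s s' t t' assume "s \<in> Cell2 two_cat" "s' \<in> Cell2 two_cat" "t \<in> Cell2 two_cat" "t' \<in> Cell2 two_cat"
    "src2 two_cat s' = trg2 two_cat s" "src2 two_cat t' = trg2 two_cat t"
    "src1 two_cat (src2 two_cat t) = trg1 two_cat (src2 two_cat s)"
  then have st: "iscell s" "iscell s'" "iscell t" "iscell t'" "SrcC s' = TrgC s" "SrcC t' = TrgC t"
    "Src (SrcC t) = Trg (SrcC s)"
    by (auto simp: two_cat_def)
  let ?L = "cat_of (Src (SrcC s))" and ?M = "cat_of (Trg (SrcC s))" and ?N = "cat_of (Trg (SrcC t))"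
  have bounds: "Src (TrgC s) = Src (SrcC s)" "Trg (TrgC s) = Trg (SrcC s)" "Src (TrgC s') = Src (SrcC s)"
    "Trg (TrgC s') = Trg (SrcC s)" "Src (TrgC t) = Trg (SrcC s)" "Trg (TrgC t) = Trg (SrcC t)"
    "Src (TrgC t') = Trg (SrcC s)" "Trg (TrgC t') = Trg (SrcC t)"
    using st cell_simps(3,4)[of s] cell_simps(3,4)[of s'] cell_simps(3,4)[of t] cell_simps(3,4)[of t'] by auto
  note * = cell_simps[OF st(1)] cell_simps[OF st(2)] cell_simps[OF st(3)] cell_simps[OF st(4)] st bounds
  note mors = mor_simps[of "SrcC s"] mor_simps[of "TrgC s"] mor_simps[of "TrgC s'"]
    mor_simps[of "SrcC t"] mor_simps[of "TrgC t"] mor_simps[of "TrgC t'"]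
  have cat: "category ?L" "category ?M" "category ?N"
    using * by auto
  have "At (hcomp_cell cat_of cmp (vcomp_cell cat_of t' t) (vcomp_cell cat_of s' s)) x =
      At (vcomp_cell cat_of (hcomp_cell cat_of cmp t' s') (hcomp_cell cat_of cmp t s)) x"
    if x: "x \<in> Obj ?L" for x
  proof -
    let ?y = "OMap (TrgC s') x" and ?y' = "OMap (TrgC s) x"
    have "(At t' ?y \<cdot>\<^bsub>?N\<^esub> At t ?y) \<cdot>\<^bsub>?N\<^esub> AMap (SrcC t) (At s' x \<cdot>\<^bsub>?M\<^esub> At s x) =
        At t' ?y \<cdot>\<^bsub>?N\<^esub> ((At t ?y \<cdot>\<^bsub>?N\<^esub> AMap (SrcC t) (At s' x)) \<cdot>\<^bsub>?N\<^esub> AMap (SrcC t) (At s x))"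
      using * mors cat x by (simp add: category.assoc)
    \<comment> \<open>Interchange comes down to naturality of \<open>t\<close> at the component
      \<open>At s' x\<close>, which swaps the two middle factors.\<close>
    also have "At t ?y \<cdot>\<^bsub>?N\<^esub> AMap (SrcC t) (At s' x) = AMap (TrgC t) (At s' x) \<cdot>\<^bsub>?N\<^esub> At t ?y'"
      by (rule cell_natural) (use * x in simp_all)
    also have "At t' ?y \<cdot>\<^bsub>?N\<^esub> ((AMap (TrgC t) (At s' x) \<cdot>\<^bsub>?N\<^esub> At t ?y') \<cdot>\<^bsub>?N\<^esub> AMap (SrcC t) (At s x)) =
        (At t' ?y \<cdot>\<^bsub>?N\<^esub> AMap (TrgC t) (At s' x)) \<cdot>\<^bsub>?N\<^esub> (At t ?y' \<cdot>\<^bsub>?N\<^esub> AMap (SrcC t) (At s x))"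
      using * mors cat x by (simp add: category.assoc)
    finally show ?thesis
      using * mors x by (simp add: hcomp_cell_def vcomp_cell_def)
  qed
  then show "hcomp two_cat (vcomp two_cat t' t) (vcomp two_cat s' s) =
      vcomp two_cat (hcomp two_cat t' s') (hcomp two_cat t s)"
    using * by (auto intro!: cell.equality simp: two_cat_def hcomp_cell_def vcomp_cell_def fun_eq_iff)
qed (auto simp: two_cat_def, auto simp: hcomp_cell_def)

end

section \<open>Actions of powers of V, modules and lax morphisms\<close>

section \<open>Modules and lax morphisms\<close>

context category
begin

lemma ides_arrs [simp]:
  assumes "a \<in> objs C"
  shows "ides C a \<in> arrs C" "doms C (ides C a) = a" "cods C (ides C a) = a"
    "map (Dom C \<circ> Ide C) a = a" "map (Cod C \<circ> Ide C) a = a"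
    "map2 (Comp C) (ides C a) (ides C a) = ides C a"
  using assms by (induction a) auto

lemma doms_cods_objs [simp]:
  assumes "fs \<in> arrs C"
  shows "doms C fs \<in> objs C" "cods C fs \<in> objs C"
  using assms by (induction fs) auto

lemma map2_comp_arrs:
  assumes "fs \<in> arrs C" "gs \<in> arrs C" "doms C gs = cods C fs"
  shows "map2 (Comp C) gs fs \<in> arrs C" "doms C (map2 (Comp C) gs fs) = doms C fs"
    "cods C (map2 (Comp C) gs fs) = cods C gs"
proof -
  have "map2 (Comp C) gs fs \<in> arrs C \<and> doms C (map2 (Comp C) gs fs) = doms C fs \<and>
    cods C (map2 (Comp C) gs fs) = cods C gs"
    using assms
  proof (induction fs arbitrary: gs)
    case (Cons f fs)
    then show ?case
      by (cases gs) auto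
  qed auto
  then show "map2 (Comp C) gs fs \<in> arrs C" "doms C (map2 (Comp C) gs fs) = doms C fs"
    "cods C (map2 (Comp C) gs fs) = cods C gs"
    by auto
qed

lemma comp_ides [simp]:
  assumes "fs \<in> arrs C"
  shows "doms C fs = a \<Longrightarrow> map2 (Comp C) fs (ides C a) = fs"
    "cods C fs = a \<Longrightarrow> map2 (Comp C) (ides C a) fs = fs"
proof -
  have "map2 (Comp C) fs (ides C (doms C fs)) = fs" "map2 (Comp C) (ides C (cods C fs)) fs = fs"
    using assms by (induction fs) auto
  then show "doms C fs = a \<Longrightarrow> map2 (Comp C) fs (ides C a) = fs"
    "cods C fs = a \<Longrightarrow> map2 (Comp C) (ides C a) fs = fs"
    by auto
qed

end

lemma pow_cat_simps [simp]:
  "Obj (pow_cat C n) = {as \<in> objs C. length as = n}"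
  "Arr (pow_cat C n) = {fs \<in> arrs C. length fs = n}"
  "Dom (pow_cat C n) = doms C" "Cod (pow_cat C n) = cods C" "Ide (pow_cat C n) = ides C"
  "Comp (pow_cat C n) = map2 (Comp C)"
  by (simp_all add: pow_cat_def)

lemma prod_cat_simps [simp]:
  "Obj (prod_cat C D) = Obj C \<times> Obj D" "Arr (prod_cat C D) = Arr C \<times> Arr D"
  "Dom (prod_cat C D) = map_prod (Dom C) (Dom D)" "Cod (prod_cat C D) = map_prod (Cod C) (Cod D)"
  "Ide (prod_cat C D) = map_prod (Ide C) (Ide D)"
  "Comp (prod_cat C D) = (\<lambda>(g, g') (f, f'). (g \<cdot>\<^bsub>C\<^esub> f, g' \<cdot>\<^bsub>D\<^esub> f'))"
  by (simp_all add: prod_cat_def)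

text \<open>Only the functoriality of an action. It is shared by modules and by the representing
  functors of a \<delta>module, for which the structure transformations are still to be
  constructed.\<close>

locale power_action = V: category V + M: category M
  for V :: "('v, 'w, 'y) cat_scheme" and M :: "('o, 'a, 'z) cat_scheme" (structure) +
  fixes act :: "'v list \<Rightarrow> 'o \<Rightarrow> 'o" and act_map :: "'w list \<Rightarrow> 'a \<Rightarrow> 'a"
  assumes act_functor:
    "cat_functor (prod_cat (pow_cat V n) M) M (\<lambda>(a, x). act a x) (\<lambda>(fs, f). act_map fs f)"
begin

lemma act_obj [simp]:
  assumes "a \<in> objs V" "x \<in> Obj M"
  shows "act a x \<in> Obj M" "act_map (ides V a) (Ide M x) = Ide M (act a x)"
proof -
  interpret act: cat_functor "prod_cat (pow_cat V (length a)) M" M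
      "\<lambda>(a, x). act a x" "\<lambda>(fs, f). act_map fs f"
    by (rule act_functor)
  show "act a x \<in> Obj M" "act_map (ides V a) (Ide M x) = Ide M (act a x)"
    using act.functor_obj[of "(a, x)"] act.functor_ide[of "(a, x)"] assms by auto
qed

lemma act_map_arr [simp]:
  assumes "fs \<in> arrs V" "f \<in> Arr M"
  shows "act_map fs f \<in> Arr M" "Dom M (act_map fs f) = act (doms V fs) (Dom M f)"
    "Cod M (act_map fs f) = act (cods V fs) (Cod M f)"
proof -
  interpret act: cat_functor "prod_cat (pow_cat V (length fs)) M" M
      "\<lambda>(a, x). act a x" "\<lambda>(fs, f). act_map fs f"
    by (rule act_functor)
  show "act_map fs f \<in> Arr M" "Dom M (act_map fs f) = act (doms V fs) (Dom M f)"
    "Cod M (act_map fs f) = act (cods V fs) (Cod M f)"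
    using act.functor_arr[of "(fs, f)"] assms by auto
qed

lemma act_map_comp:
  assumes "fs \<in> arrs V" "f \<in> Arr M" "gs \<in> arrs V" "g \<in> Arr M" "doms V gs = cods V fs" "Dom M g = Cod M f"
  shows "act_map (map2 (Comp V) gs fs) (g \<cdot> f) = act_map gs g \<cdot> act_map fs f"
proof -
  interpret act: cat_functor "prod_cat (pow_cat V (length fs)) M" M
      "\<lambda>(a, x). act a x" "\<lambda>(fs, f). act_map fs f"
    by (rule act_functor)
  have "length gs = length fs"
    using assms(5) by (metis length_map)
  then show ?thesis
    using act.functor_comp_arr[of "(fs, f)" "(gs, g)"] assms by auto
qed

lemma act_map_ides_comp [simp]:
  assumes "a \<in> objs V" "f \<in> Arr M" "g \<in> Arr M" "Dom M g = Cod M f"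
  shows "act_map (ides V a) (g \<cdot> f) = act_map (ides V a) g \<cdot> act_map (ides V a) f"
  using act_map_comp[of "ides V a" f "ides V a" g] assms by simp

text \<open>With the next lemma, this lets an arrow of \<open>M\<close> be absorbed into, or split
  off from, the action of arbitrary arrows of \<open>V\<close>; naturality of \<beta> in several
  variables at once depends on it.\<close>

lemma act_map_ides_left:
  assumes "fs \<in> arrs V" "f \<in> Arr M" "g \<in> Arr M" "Dom M g = Cod M f" "cods V fs = a"
  shows "act_map (ides V a) g \<cdot> act_map fs f = act_map fs (g \<cdot> f)"
proof -
  have "a \<in> objs V"
    using assms by auto
  then show ?thesis
    using act_map_comp[of fs f "ides V a" g] assms by simp
qed

lemma act_map_ides_right:
  assumes "fs \<in> arrs V" "f \<in> Arr M" "g \<in> Arr M" "Dom M g = Cod M f" "doms V fs = a"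
  shows "act_map fs g \<cdot> act_map (ides V a) f = act_map fs (g \<cdot> f)"
proof -
  have "a \<in> objs V"
    using assms by auto
  then show ?thesis
    using act_map_comp[of "ides V a" f fs g] assms by simp
qed

end

context oplax_monoidal
begin

lemma omega_obj [simp]:
  assumes "a \<in> objs V"
  shows "omega V a \<in> Obj V" "omega_map V (ides V a) = Ide V (omega V a)"
proof -
  interpret omega: cat_functor "pow_cat V (length a)" V "omega V" "omega_map V"
    by (rule omega_functor)
  show "omega V a \<in> Obj V" "omega_map V (ides V a) = Ide V (omega V a)"
    using omega.functor_obj[of a] omega.functor_ide[of a] assms by auto
qed

lemma omega_map_arr [simp]:
  assumes "fs \<in> arrs V"
  shows "omega_map V fs \<in> Arr V" "Dom V (omega_map V fs) = omega V (doms V fs)"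
    "Cod V (omega_map V fs) = omega V (cods V fs)"
proof -
  interpret omega: cat_functor "pow_cat V (length fs)" V "omega V" "omega_map V"
    by (rule omega_functor)
  show "omega_map V fs \<in> Arr V" "Dom V (omega_map V fs) = omega V (doms V fs)"
    "Cod V (omega_map V fs) = omega V (cods V fs)"
    using omega.functor_arr[of fs] assms by auto
qed

lemma omega_split_arr [simp]:
  assumes "a \<in> objs V" "b \<in> objs V" "a' \<in> objs V"
  shows "omega_split V a b a' \<in> Arr V" "Dom V (omega_split V a b a') = omega V (a @ b @ a')"
    "Cod V (omega_split V a b a') = omega V (a @ omega V b # a')"
  using omega_split_hom[OF assms] by (auto simp: hom_def)

lemma omega_counit_arr [simp]:
  assumes "v \<in> Obj V"
  shows "omega_counit V v \<in> Arr V" "Dom V (omega_counit V v) = omega V [v]"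
    "Cod V (omega_counit V v) = v"
  using omega_counit_hom[OF assms] by (auto simp: hom_def)

end

context vmodule
begin

sublocale power_action V M "rho M" "rho_map M"
  by (intro power_action.intro power_action_axioms.intro V.category_axioms M.category_axioms rho_functor)

lemma rho_split_arr [simp]:
  assumes "a \<in> objs V" "b \<in> objs V" "a' \<in> objs V" "x \<in> Obj M"
  shows "rho_split M a b a' x \<in> Arr M" "Dom M (rho_split M a b a' x) = rho M (a @ b @ a') x"
    "Cod M (rho_split M a b a' x) = rho M (a @ omega V b # a') x"
  using rho_split_hom[OF assms] by (auto simp: hom_def)

lemma rho_nest_arr [simp]:
  assumes "a \<in> objs V" "b \<in> objs V" "x \<in> Obj M"
  shows "rho_nest M a b x \<in> Arr M" "Dom M (rho_nest M a b x) = rho M (a @ b) x"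
    "Cod M (rho_nest M a b x) = rho M a (rho M b x)"
  using rho_nest_hom[OF assms] by (auto simp: hom_def)

lemma rho_counit_arr [simp]:
  assumes "x \<in> Obj M"
  shows "rho_counit M x \<in> Arr M" "Dom M (rho_counit M x) = rho M [] x" "Cod M (rho_counit M x) = x"
  using rho_counit_hom[OF assms] by (auto simp: hom_def)

end

text \<open>The premises have the shape that simplification produces: \<open>omega V b # a'\<close>
  instead of an appended singleton, and endpoint equations instead of \<open>hom\<close>.\<close>

lemma lax_morphismI:
  assumes "vmodule V M" "vmodule V N" "cat_functor M N Fo Fa"
    and "Fo \<in> extensional (Obj M)" "Fa \<in> extensional (Arr M)" "f \<in> extensional (objs V \<times> Obj M)"
    and "\<And>a x. a \<in> objs V \<Longrightarrow> x \<in> Obj M \<Longrightarrow> f (a, x) \<in> Arr N \<and> Dom N (f (a, x)) = rho N a (Fo x) \<and>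
          Cod N (f (a, x)) = Fo (rho M a x)"
    and "\<And>hs h. hs \<in> arrs V \<Longrightarrow> h \<in> Arr M \<Longrightarrow>
          f (cods V hs, Cod M h) \<cdot>\<^bsub>N\<^esub> rho_map N hs (Fa h) =
          Fa (rho_map M hs h) \<cdot>\<^bsub>N\<^esub> f (doms V hs, Dom M h)"
    and "\<And>x. x \<in> Obj M \<Longrightarrow> Fa (rho_counit M x) \<cdot>\<^bsub>N\<^esub> f ([], x) = rho_counit N (Fo x)"
    and "\<And>a b a' x. a \<in> objs V \<Longrightarrow> b \<in> objs V \<Longrightarrow> a' \<in> objs V \<Longrightarrow> x \<in> Obj M \<Longrightarrow>
          f (a @ omega V b # a', x) \<cdot>\<^bsub>N\<^esub> rho_split N a b a' (Fo x) =
          Fa (rho_split M a b a' x) \<cdot>\<^bsub>N\<^esub> f (a @ b @ a', x)"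
    and "\<And>a b x. a \<in> objs V \<Longrightarrow> b \<in> objs V \<Longrightarrow> x \<in> Obj M \<Longrightarrow>
          f (a, rho M b x) \<cdot>\<^bsub>N\<^esub> (rho_map N (ides V a) (f (b, x)) \<cdot>\<^bsub>N\<^esub> rho_nest N a b (Fo x)) =
          Fa (rho_nest M a b x) \<cdot>\<^bsub>N\<^esub> f (a @ b, x)"
  shows "lax_morphism V M N Fo Fa f"
  using assms by (intro lax_morphism.intro lax_morphism_axioms.intro) (auto simp: hom_def)

context lax_morphism
begin

lemma lax_arr [simp]:
  assumes "a \<in> objs V" "x \<in> Obj M"
  shows "f (a, x) \<in> Arr N" "Dom N (f (a, x)) = rho N a (Fo x)" "Cod N (f (a, x)) = Fo (rho M a x)"
  using lax_hom[OF assms] by (auto simp: hom_def)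

lemma lax_natural_arr:
  assumes "hs \<in> arrs V" "h \<in> Arr M" "cods V hs = a" "Cod M h = y"
  shows "f (a, y) \<cdot>\<^bsub>N\<^esub> rho_map N hs (Fa h) = Fa (rho_map M hs h) \<cdot>\<^bsub>N\<^esub> f (doms V hs, Dom M h)"
  using lax_natural[of hs h "Dom M h" "Cod M h"] assms by (auto simp: hom_def)

end

lemma lax_morphism_id:
  assumes "vmodule V M"
  shows "lax_morphism V M M (restrict id (Obj M)) (restrict id (Arr M))
    (restrict (\<lambda>(a, x). Ide M (rho M a x)) (objs V \<times> Obj M))"
proof -
  interpret vmodule V M by fact
  show ?thesis
    by (rule lax_morphismI)
      (use assms M.category_axioms in \<open>auto intro!: cat_functorI simp: M.assoc rho_nest_hom\<close>)
qed

lemma lax_morphism_comp: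
  assumes "lax_morphism V L M Fo Fa f" "lax_morphism V M N Go Ga g"
  shows "lax_morphism V L N (restrict (Go \<circ> Fo) (Obj L)) (restrict (Ga \<circ> Fa) (Arr L))
    (restrict (\<lambda>(a, x). Ga (f (a, x)) \<cdot>\<^bsub>N\<^esub> g (a, Fo x)) (objs V \<times> Obj L))"
proof -
  interpret F: lax_morphism V L M Fo Fa f by fact
  interpret G: lax_morphism V M N Go Ga g by fact
  have *: "cat_functor L N (restrict (Go \<circ> Fo) (Obj L)) (restrict (Ga \<circ> Fa) (Arr L))"
    by (rule cat_functorI) (auto intro: F.M.M.category_axioms G.N.M.category_axioms)
  have natural: "(Ga (f (cods V hs, Cod L h)) \<cdot>\<^bsub>N\<^esub> g (cods V hs, Fo (Cod L h))) \<cdot>\<^bsub>N\<^esub> rho_map N hs (Ga (Fa h)) =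
      Ga (Fa (rho_map L hs h)) \<cdot>\<^bsub>N\<^esub> (Ga (f (doms V hs, Dom L h)) \<cdot>\<^bsub>N\<^esub> g (doms V hs, Fo (Dom L h)))"
    (is "?l = ?r") if "hs \<in> arrs V" "h \<in> Arr L" for hs h
  proof -
    have "?l = Ga (f (cods V hs, Cod L h)) \<cdot>\<^bsub>N\<^esub> (g (cods V hs, Fo (Cod L h)) \<cdot>\<^bsub>N\<^esub> rho_map N hs (Ga (Fa h)))"
      using that by (simp add: G.N.M.assoc)
    also have "\<dots> = Ga (f (cods V hs, Cod L h) \<cdot>\<^bsub>M\<^esub> rho_map M hs (Fa h)) \<cdot>\<^bsub>N\<^esub> g (doms V hs, Fo (Dom L h))"
      using that by (simp add: G.N.M.assoc G.lax_natural_arr)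
    also have "\<dots> = ?r"
      using that by (simp add: G.N.M.assoc F.lax_natural_arr)
    finally show ?thesis .
  qed
  have counit: "Ga (Fa (rho_counit L x)) \<cdot>\<^bsub>N\<^esub> (Ga (f ([], x)) \<cdot>\<^bsub>N\<^esub> g ([], Fo x)) = rho_counit N (Go (Fo x))"
    (is "?l = ?r") if "x \<in> Obj L" for x
  proof -
    have "?l = Ga (Fa (rho_counit L x) \<cdot>\<^bsub>M\<^esub> f ([], x)) \<cdot>\<^bsub>N\<^esub> g ([], Fo x)"
      using that by (simp add: G.N.M.assoc)
    then show ?thesis
      using that by (simp only: F.lax_counit G.lax_counit F.F.functor_obj)
  qed
  have split: "(Ga (f (a @ omega V b # a', x)) \<cdot>\<^bsub>N\<^esub> g (a @ omega V b # a', Fo x)) \<cdot>\<^bsub>N\<^esub>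
        rho_split N a b a' (Go (Fo x)) =
      Ga (Fa (rho_split L a b a' x)) \<cdot>\<^bsub>N\<^esub> (Ga (f (a @ b @ a', x)) \<cdot>\<^bsub>N\<^esub> g (a @ b @ a', Fo x))"
    (is "?l = ?r") if "a \<in> objs V" "b \<in> objs V" "a' \<in> objs V" "x \<in> Obj L" for a b a' x
  proof -
    have "?l = Ga (f (a @ omega V b # a', x)) \<cdot>\<^bsub>N\<^esub> (g (a @ omega V b # a', Fo x) \<cdot>\<^bsub>N\<^esub> rho_split N a b a' (Go (Fo x)))"
      using that by (simp add: G.N.M.assoc)
    also have "\<dots> = Ga (f (a @ omega V b # a', x) \<cdot>\<^bsub>M\<^esub> rho_split M a b a' (Fo x)) \<cdot>\<^bsub>N\<^esub> g (a @ b @ a', Fo x)"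
      using that G.lax_split[of a b a' "Fo x"] by (simp add: G.N.M.assoc)
    also have "\<dots> = ?r"
      using that F.lax_split[of a b a' x] by (simp add: G.N.M.assoc)
    finally show ?thesis .
  qed
  \<comment> \<open>The inner structure arrow of \<open>F\<close> is first carried past
    \<open>g\<close> by naturality. Then the nest law of \<open>G\<close> applies, and after it that
    of \<open>F\<close> under \<open>Ga\<close>.\<close>
  have nest: "(Ga (f (a, rho L b x)) \<cdot>\<^bsub>N\<^esub> g (a, Fo (rho L b x))) \<cdot>\<^bsub>N\<^esub>
        (rho_map N (ides V a) (Ga (f (b, x)) \<cdot>\<^bsub>N\<^esub> g (b, Fo x)) \<cdot>\<^bsub>N\<^esub> rho_nest N a b (Go (Fo x))) =
      Ga (Fa (rho_nest L a b x)) \<cdot>\<^bsub>N\<^esub> (Ga (f (a @ b, x)) \<cdot>\<^bsub>N\<^esub> g (a @ b, Fo x))"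
    (is "?l = ?r") if "a \<in> objs V" "b \<in> objs V" "x \<in> Obj L" for a b x
  proof -
    have "?l = Ga (f (a, rho L b x)) \<cdot>\<^bsub>N\<^esub> ((g (a, Fo (rho L b x)) \<cdot>\<^bsub>N\<^esub> rho_map N (ides V a) (Ga (f (b, x)))) \<cdot>\<^bsub>N\<^esub>
        (rho_map N (ides V a) (g (b, Fo x)) \<cdot>\<^bsub>N\<^esub> rho_nest N a b (Go (Fo x))))"
      using that by (simp add: G.N.M.assoc)
    also have "\<dots> = Ga (f (a, rho L b x)) \<cdot>\<^bsub>N\<^esub> (Ga (rho_map M (ides V a) (f (b, x))) \<cdot>\<^bsub>N\<^esub>
        (g (a, rho M b (Fo x)) \<cdot>\<^bsub>N\<^esub> (rho_map N (ides V a) (g (b, Fo x)) \<cdot>\<^bsub>N\<^esub> rho_nest N a b (Go (Fo x)))))"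
      using that by (simp add: G.N.M.assoc G.lax_natural_arr)
    also have "\<dots> = Ga (f (a, rho L b x) \<cdot>\<^bsub>M\<^esub> (rho_map M (ides V a) (f (b, x)) \<cdot>\<^bsub>M\<^esub> rho_nest M a b (Fo x))) \<cdot>\<^bsub>N\<^esub>
        g (a @ b, Fo x)"
      using that by (simp add: G.lax_nest G.N.M.assoc)
    also have "\<dots> = ?r"
      using that F.lax_nest[of a b x] by (simp add: G.N.M.assoc)
    finally show ?thesis .
  qed
  show ?thesis
    by (rule lax_morphismI)
      (use * natural counit split nest in
        \<open>auto intro: F.M.vmodule_axioms G.N.vmodule_axioms\<close>)
qed

text \<open>The one conjunct of \<open>is_lax_cell\<close> that is specific to modules, isolated so
  that \<open>structured_cats\<close> can be instantiated.\<close>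

definition lax_compat :: "('v, 'w) omcat \<Rightarrow> ('v, 'w, 'o, 'a) lax_cell \<Rightarrow> bool" where
  "lax_compat V s \<longleftrightarrow> (\<forall>a \<in> objs V. \<forall>x \<in> Obj (Src (SrcC s)).
     Str (TrgC s) (a, x) \<cdot>\<^bsub>Trg (SrcC s)\<^esub> rho_map (Trg (SrcC s)) (ides V a) (At s x) =
     At s (rho (Src (SrcC s)) a x) \<cdot>\<^bsub>Trg (SrcC s)\<^esub> Str (SrcC s) (a, x))"

lemma is_lax_cell_iff:
  "is_lax_cell V s \<longleftrightarrow> is_lax_mor V (SrcC s) \<and> is_lax_mor V (TrgC s) \<and> parallel (SrcC s) (TrgC s) \<and>
     nat_trans (Src (SrcC s)) (Trg (SrcC s)) (OMap (SrcC s)) (AMap (SrcC s)) (OMap (TrgC s)) (AMap (TrgC s)) (At s) \<and>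
     At s \<in> extensional (Obj (Src (SrcC s))) \<and> lax_compat V s"
  by (simp add: is_lax_cell_def lax_compat_def Let_def)

lemma lax_compat_vcomp:
  assumes "is_lax_cell V s" "is_lax_cell V t" "SrcC t = TrgC s"
  shows "lax_compat V (vcomp_cell cat.truncate t s)"
proof -
  let ?M = "Src (SrcC s)" and ?N = "Trg (SrcC s)"
  have s: "is_lax_mor V (SrcC s)" "is_lax_mor V (TrgC s)" "parallel (SrcC s) (TrgC s)" "lax_compat V s"
    and ns: "nat_trans ?M ?N (OMap (SrcC s)) (AMap (SrcC s)) (OMap (TrgC s)) (AMap (TrgC s)) (At s)"
    using assms(1) by (auto simp: is_lax_cell_iff)
  have st: "Src (TrgC s) = ?M" "Trg (TrgC s) = ?N"
    using s by (auto simp: parallel_def)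
  have t: "is_lax_mor V (TrgC t)" "parallel (TrgC s) (TrgC t)" "lax_compat V t"
    and nt: "nat_trans ?M ?N (OMap (TrgC s)) (AMap (TrgC s)) (OMap (TrgC t)) (AMap (TrgC t)) (At t)"
    using assms(2,3) st by (auto simp: is_lax_cell_iff)
  have tt: "Src (TrgC t) = ?M" "Trg (TrgC t) = ?N"
    using t st by (auto simp: parallel_def)
  interpret F: lax_morphism V ?M ?N "OMap (SrcC s)" "AMap (SrcC s)" "Str (SrcC s)"
    using s(1) by (simp add: is_lax_mor_def)
  interpret G: lax_morphism V ?M ?N "OMap (TrgC s)" "AMap (TrgC s)" "Str (TrgC s)"
    using s(2) st by (simp add: is_lax_mor_def)
  interpret H: lax_morphism V ?M ?N "OMap (TrgC t)" "AMap (TrgC t)" "Str (TrgC t)"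
    using t(1) tt by (simp add: is_lax_mor_def)
  have "Str (TrgC t) (a, x) \<cdot>\<^bsub>?N\<^esub> rho_map ?N (ides V a) (At t x \<cdot>\<^bsub>?N\<^esub> At s x) =
      (At t (rho ?M a x) \<cdot>\<^bsub>?N\<^esub> At s (rho ?M a x)) \<cdot>\<^bsub>?N\<^esub> Str (SrcC s) (a, x)" (is "?l = ?r")
    if ax: "a \<in> objs V" "x \<in> Obj ?M" for a x
  proof -
    have "?l = (Str (TrgC t) (a, x) \<cdot>\<^bsub>?N\<^esub> rho_map ?N (ides V a) (At t x)) \<cdot>\<^bsub>?N\<^esub> rho_map ?N (ides V a) (At s x)"
      using ax by (simp add: F.N.M.assoc nat_transD[OF ns] nat_transD[OF nt])
    also have "\<dots> = (At t (rho ?M a x) \<cdot>\<^bsub>?N\<^esub> Str (TrgC s) (a, x)) \<cdot>\<^bsub>?N\<^esub> rho_map ?N (ides V a) (At s x)"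
      using t(3) ax by (simp add: lax_compat_def st assms(3))
    also have "\<dots> = At t (rho ?M a x) \<cdot>\<^bsub>?N\<^esub> (Str (TrgC s) (a, x) \<cdot>\<^bsub>?N\<^esub> rho_map ?N (ides V a) (At s x))"
      using ax by (simp add: F.N.M.assoc nat_transD[OF ns] nat_transD[OF nt])
    also have "\<dots> = At t (rho ?M a x) \<cdot>\<^bsub>?N\<^esub> (At s (rho ?M a x) \<cdot>\<^bsub>?N\<^esub> Str (SrcC s) (a, x))"
      using s(4) ax by (simp add: lax_compat_def)
    also have "\<dots> = ?r"
      using ax by (simp add: F.N.M.assoc nat_transD[OF ns] nat_transD[OF nt])
    finally show ?thesis .
  qed
  then show ?thesis
    by (simp add: lax_compat_def vcomp_cell_def)
qed

text \<open>Four squares are pasted: compatibility of \<open>t\<close> at the image of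
  \<open>x\<close>, naturality of the structure of \<open>SrcC t\<close> at a component of
  \<open>s\<close>, naturality of \<open>t\<close> at a structure arrow of \<open>TrgC s\<close>,
  and compatibility of \<open>s\<close> under \<open>SrcC t\<close>.\<close>

lemma lax_compat_hcomp:
  assumes "is_lax_cell V s" "is_lax_cell V t" "Src (SrcC t) = Trg (SrcC s)"
  shows "lax_compat V (hcomp_cell cat.truncate (comp_lax V) t s)"
proof -
  let ?L = "Src (SrcC s)" and ?M = "Trg (SrcC s)" and ?N = "Trg (SrcC t)"
  have s: "is_lax_mor V (SrcC s)" "is_lax_mor V (TrgC s)" "parallel (SrcC s) (TrgC s)" "lax_compat V s"
    and ns: "nat_trans ?L ?M (OMap (SrcC s)) (AMap (SrcC s)) (OMap (TrgC s)) (AMap (TrgC s)) (At s)"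
    using assms(1) by (auto simp: is_lax_cell_iff)
  have st: "Src (TrgC s) = ?L" "Trg (TrgC s) = ?M"
    using s by (auto simp: parallel_def)
  have t: "is_lax_mor V (SrcC t)" "is_lax_mor V (TrgC t)" "parallel (SrcC t) (TrgC t)" "lax_compat V t"
    and nt: "nat_trans ?M ?N (OMap (SrcC t)) (AMap (SrcC t)) (OMap (TrgC t)) (AMap (TrgC t)) (At t)"
    using assms(2,3) by (auto simp: is_lax_cell_iff)
  have tt: "Src (TrgC t) = ?M" "Trg (TrgC t) = ?N"
    using t assms(3) by (auto simp: parallel_def)
  interpret F: lax_morphism V ?L ?M "OMap (SrcC s)" "AMap (SrcC s)" "Str (SrcC s)"
    using s(1) by (simp add: is_lax_mor_def)
  interpret F': lax_morphism V ?L ?M "OMap (TrgC s)" "AMap (TrgC s)" "Str (TrgC s)"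
    using s(2) st by (simp add: is_lax_mor_def)
  interpret G: lax_morphism V ?M ?N "OMap (SrcC t)" "AMap (SrcC t)" "Str (SrcC t)"
    using t(1) assms(3) by (simp add: is_lax_mor_def)
  interpret G': lax_morphism V ?M ?N "OMap (TrgC t)" "AMap (TrgC t)" "Str (TrgC t)"
    using t(2) tt by (simp add: is_lax_mor_def)
  note [simp] = nat_transD(1-3)[OF ns] nat_transD(1-3)[OF nt] G.N.M.assoc
  have "(AMap (TrgC t) (Str (TrgC s) (a, x)) \<cdot>\<^bsub>?N\<^esub> Str (TrgC t) (a, OMap (TrgC s) x)) \<cdot>\<^bsub>?N\<^esub>
        rho_map ?N (ides V a) (At t (OMap (TrgC s) x) \<cdot>\<^bsub>?N\<^esub> AMap (SrcC t) (At s x)) =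
      (At t (OMap (TrgC s) (rho ?L a x)) \<cdot>\<^bsub>?N\<^esub> AMap (SrcC t) (At s (rho ?L a x))) \<cdot>\<^bsub>?N\<^esub>
        (AMap (SrcC t) (Str (SrcC s) (a, x)) \<cdot>\<^bsub>?N\<^esub> Str (SrcC t) (a, OMap (SrcC s) x))" (is "?l = ?r")
    if ax: "a \<in> objs V" "x \<in> Obj ?L" for a x
  proof -
    let ?y = "OMap (TrgC s) x"
    have "?l = AMap (TrgC t) (Str (TrgC s) (a, x)) \<cdot>\<^bsub>?N\<^esub>
        ((Str (TrgC t) (a, ?y) \<cdot>\<^bsub>?N\<^esub> rho_map ?N (ides V a) (At t ?y)) \<cdot>\<^bsub>?N\<^esub>
          rho_map ?N (ides V a) (AMap (SrcC t) (At s x)))"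
      using ax by simp
    also have "Str (TrgC t) (a, ?y) \<cdot>\<^bsub>?N\<^esub> rho_map ?N (ides V a) (At t ?y) =
        At t (rho ?M a ?y) \<cdot>\<^bsub>?N\<^esub> Str (SrcC t) (a, ?y)"
      using t(4) ax by (simp add: lax_compat_def assms(3))
    also have "AMap (TrgC t) (Str (TrgC s) (a, x)) \<cdot>\<^bsub>?N\<^esub>
          ((At t (rho ?M a ?y) \<cdot>\<^bsub>?N\<^esub> Str (SrcC t) (a, ?y)) \<cdot>\<^bsub>?N\<^esub>
            rho_map ?N (ides V a) (AMap (SrcC t) (At s x))) =
        (AMap (TrgC t) (Str (TrgC s) (a, x)) \<cdot>\<^bsub>?N\<^esub> At t (rho ?M a ?y)) \<cdot>\<^bsub>?N\<^esub>
          (Str (SrcC t) (a, ?y) \<cdot>\<^bsub>?N\<^esub> rho_map ?N (ides V a) (AMap (SrcC t) (At s x)))"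
      using ax by simp
    also have "Str (SrcC t) (a, ?y) \<cdot>\<^bsub>?N\<^esub> rho_map ?N (ides V a) (AMap (SrcC t) (At s x)) =
        AMap (SrcC t) (rho_map ?M (ides V a) (At s x)) \<cdot>\<^bsub>?N\<^esub> Str (SrcC t) (a, OMap (SrcC s) x)"
      using ax by (simp add: G.lax_natural_arr)
    also have "AMap (TrgC t) (Str (TrgC s) (a, x)) \<cdot>\<^bsub>?N\<^esub> At t (rho ?M a ?y) =
        At t (OMap (TrgC s) (rho ?L a x)) \<cdot>\<^bsub>?N\<^esub> AMap (SrcC t) (Str (TrgC s) (a, x))"
      using ax nat_transD(4)[OF nt, of "Str (TrgC s) (a, x)"] by simp
    also have "(At t (OMap (TrgC s) (rho ?L a x)) \<cdot>\<^bsub>?N\<^esub> AMap (SrcC t) (Str (TrgC s) (a, x))) \<cdot>\<^bsub>?N\<^esub>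
          (AMap (SrcC t) (rho_map ?M (ides V a) (At s x)) \<cdot>\<^bsub>?N\<^esub> Str (SrcC t) (a, OMap (SrcC s) x)) =
        At t (OMap (TrgC s) (rho ?L a x)) \<cdot>\<^bsub>?N\<^esub>
          (AMap (SrcC t) (Str (TrgC s) (a, x) \<cdot>\<^bsub>?M\<^esub> rho_map ?M (ides V a) (At s x)) \<cdot>\<^bsub>?N\<^esub> Str (SrcC t) (a, OMap (SrcC s) x))"
      using ax by simp
    also have "Str (TrgC s) (a, x) \<cdot>\<^bsub>?M\<^esub> rho_map ?M (ides V a) (At s x) = At s (rho ?L a x) \<cdot>\<^bsub>?M\<^esub> Str (SrcC s) (a, x)"
      using s(4) ax by (simp add: lax_compat_def)
    also have "At t (OMap (TrgC s) (rho ?L a x)) \<cdot>\<^bsub>?N\<^esub>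
          (AMap (SrcC t) (At s (rho ?L a x) \<cdot>\<^bsub>?M\<^esub> Str (SrcC s) (a, x)) \<cdot>\<^bsub>?N\<^esub> Str (SrcC t) (a, OMap (SrcC s) x)) = ?r"
      using ax by simp
    finally show ?thesis .
  qed
  then show ?thesis
    using st tt by (simp add: lax_compat_def hcomp_cell_def comp_lax_def)
qed

lemma structured_cats_lax:
  "structured_cats cat.truncate (vmodule V) (is_lax_mor V) (is_lax_cell V) (lax_compat V) (id_lax V) (comp_lax V)"
proof (rule structured_cats.intro, goal_cases)
  case (1 M)
  then show ?case by (simp add: vmodule_def)
next
  case (2 F)
  then show ?case by (simp add: is_lax_mor_def lax_morphism_def)
next
  case (3 F)
  then show ?case by (simp add: is_lax_mor_def lax_morphism_def)
next
  case (4 F)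
  then show ?case by (simp add: is_lax_mor_def lax_morphism_def)
next
  case (5 F)
  then show ?case by (simp add: is_lax_mor_def lax_morphism.ext)
next
  case (6 F)
  then show ?case by (simp add: is_lax_mor_def lax_morphism.ext)
next
  case (7 s)
  show ?case by (simp add: is_lax_cell_iff)
next
  case (8 M)
  then show ?case by (simp add: is_lax_mor_def id_lax_def lax_morphism_id)
next
  case (13 F G)
  then show ?case by (simp add: is_lax_mor_def comp_lax_def lax_morphism_comp)
next
  case (18 F G H)
  then interpret F: lax_morphism V "Src F" "Trg F" "OMap F" "AMap F" "Str F"
    by (simp add: is_lax_mor_def)
  interpret G: lax_morphism V "Trg F" "Trg G" "OMap G" "AMap G" "Str G"
    using 18 by (simp add: is_lax_mor_def)
  interpret H: lax_morphism V "Trg G" "Trg H" "OMap H" "AMap H" "Str H"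
    using 18 by (simp add: is_lax_mor_def)
  show ?case
    using 18 by (auto simp: comp_lax_def fun_eq_iff H.N.M.assoc)
next
  case (19 F)
  then interpret F: lax_morphism V "Src F" "Trg F" "OMap F" "AMap F" "Str F"
    by (simp add: is_lax_mor_def)
  show ?case
    using F.ext(3) by (auto simp: comp_lax_def id_lax_def fun_eq_iff extensional_def)
next
  case (20 F)
  then interpret F: lax_morphism V "Src F" "Trg F" "OMap F" "AMap F" "Str F"
    by (simp add: is_lax_mor_def)
  show ?case
    using F.ext(3) by (auto simp: comp_lax_def id_lax_def fun_eq_iff extensional_def)
next
  case (21 F)
  then interpret F: lax_morphism V "Src F" "Trg F" "OMap F" "AMap F" "Str F"
    by (simp add: is_lax_mor_def)
  show ?case
    by (simp add: lax_compat_def id_cell_def)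
qed (simp_all add: id_lax_def comp_lax_def lax_compat_vcomp lax_compat_hcomp)

lemma two_category_Vmod_lax: "two_category (Vmod_lax V)"
  using structured_cats.two_category[OF structured_cats_lax[of V]]
  by (simp add: structured_cats.two_cat_def[OF structured_cats_lax] Vmod_lax_def)

section \<open>The 2-category of \<delta>modules\<close>

section \<open>\<open>\<delta>\<close>modules and oplax functors\<close>

lemma op_cat_simps [simp]:
  "Obj (op_cat C) = Obj C" "Arr (op_cat C) = Arr C" "Dom (op_cat C) = Cod C" "Cod (op_cat C) = Dom C"
  "Ide (op_cat C) = Ide C" "Comp (op_cat C) = (\<lambda>g f. f \<cdot>\<^bsub>C\<^esub> g)"
  by (simp_all add: op_cat_def)

lemma R_elements_iff [simp]:
  "(a, x, y, r) \<in> R_elements V M \<longleftrightarrow> a \<in> objs V \<and> x \<in> Obj M \<and> y \<in> Obj M \<and> r \<in> Rset M a x y"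
  by (simp add: R_elements_def)

context dmodule
begin

lemma Rmap_in [simp]:
  assumes "fs \<in> arrs V" "f \<in> Arr M" "g \<in> Arr M" "r \<in> Rset M (cods V fs) (Cod M f) (Dom M g)"
    and "doms V fs = a" "Dom M f = x" "Cod M g = y"
  shows "Rmap M fs f g r \<in> Rset M a x y"
  using set_functor.set_functor_map[OF R_functor[of "length fs"], of "((fs, f), g)"
      "((cods V fs, Cod M f), Dom M g)" "((doms V fs, Dom M f), Cod M g)" r] assms
  by (auto simp: hom_def dist_cat_def)

lemma Rmap_ide [simp]:
  assumes "a \<in> objs V" "x \<in> Obj M" "y \<in> Obj M" "r \<in> Rset M a x y"
  shows "Rmap M (ides V a) (Ide M x) (Ide M y) r = r"
  using set_functor.set_functor_ide[OF R_functor[of "length a"], of "((a, x), y)" r] assms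
  by (auto simp: dist_cat_def)

text \<open>The action is contravariant in \<open>V\<close> and in the first variable of
  \<open>M\<close> but covariant in the last, hence the opposite orders of composition.\<close>

lemma Rmap_comp:
  assumes "fs \<in> arrs V" "f \<in> Arr M" "g \<in> Arr M" "fs' \<in> arrs V" "f' \<in> Arr M" "g' \<in> Arr M"
    "cods V fs = doms V fs'" "Cod M f = Dom M f'" "Dom M g = Cod M g'"
    "r \<in> Rset M (cods V fs') (Cod M f') (Dom M g')"
  shows "Rmap M fs f g (Rmap M fs' f' g' r) = Rmap M (map2 (Comp V) fs' fs) (f' \<cdot> f) (g \<cdot> g') r"
proof -
  have "length fs' = length fs"
    using assms(7) by (metis length_map)
  then show ?thesis
    using set_functor.set_functor_comp[OF R_functor[of "length fs"], of "((fs', f'), g')"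
      "((cods V fs', Cod M f'), Dom M g')" "((doms V fs', Dom M f'), Cod M g')"
      "((fs, f), g)" "((doms V fs, Dom M f), Cod M g)" r] assms
    by (auto simp: hom_def dist_cat_def)
qed

lemma Rmap_ides_comp:
  assumes "a \<in> objs V" "f \<in> Arr M" "g \<in> Arr M" "f' \<in> Arr M" "g' \<in> Arr M"
    "Cod M f = Dom M f'" "Dom M g = Cod M g'" "r \<in> Rset M a (Cod M f') (Dom M g')"
  shows "Rmap M (ides V a) f g (Rmap M (ides V a) f' g' r) = Rmap M (ides V a) (f' \<cdot> f) (g \<cdot> g') r"
  using assms by (subst Rmap_comp) auto

end

lemma oplax_functorI:
  assumes "dmodule V M" "dmodule V N" "cat_functor M N Fo Fa"
    and "Fo \<in> extensional (Obj M)" "Fa \<in> extensional (Arr M)" "f \<in> extensional (R_elements V M)"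
    and "\<And>a x y r. a \<in> objs V \<Longrightarrow> x \<in> Obj M \<Longrightarrow> y \<in> Obj M \<Longrightarrow> r \<in> Rset M a x y \<Longrightarrow>
          f (a, x, y, r) \<in> Rset N a (Fo x) (Fo y)"
    and "\<And>hs h k r. hs \<in> arrs V \<Longrightarrow> h \<in> Arr M \<Longrightarrow> k \<in> Arr M \<Longrightarrow>
          r \<in> Rset M (cods V hs) (Cod M h) (Dom M k) \<Longrightarrow>
          f (doms V hs, Dom M h, Cod M k, Rmap M hs h k r) =
          Rmap N hs (Fa h) (Fa k) (f (cods V hs, Cod M h, Dom M k, r))"
    and "\<And>g. g \<in> Arr M \<Longrightarrow> f ([], Dom M g, Cod M g, Riota M (Dom M g) (Cod M g) g) =
          Riota N (Fo (Dom M g)) (Fo (Cod M g)) (Fa g)"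
    and "\<And>a b a' x y r. a \<in> objs V \<Longrightarrow> b \<in> objs V \<Longrightarrow> a' \<in> objs V \<Longrightarrow> x \<in> Obj M \<Longrightarrow> y \<in> Obj M \<Longrightarrow>
       r \<in> Rset M (a @ omega V b # a') x y \<Longrightarrow>
          f (a @ b @ a', x, y, Ralpha M a b a' x y r) =
          Ralpha N a b a' (Fo x) (Fo y) (f (a @ omega V b # a', x, y, r))"
    and "\<And>a b x m y r s. a \<in> objs V \<Longrightarrow> b \<in> objs V \<Longrightarrow> x \<in> Obj M \<Longrightarrow> m \<in> Obj M \<Longrightarrow> y \<in> Obj M \<Longrightarrow>
       r \<in> Rset M a m y \<Longrightarrow> s \<in> Rset M b x m \<Longrightarrow>
          f (a @ b, x, y, Rbeta M a b x m y r s) =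
          Rbeta N a b (Fo x) (Fo m) (Fo y) (f (a, m, y, r)) (f (b, x, m, s))"
  shows "oplax_functor V M N Fo Fa f"
  using assms by (intro oplax_functor.intro oplax_functor_axioms.intro) (auto simp: hom_def)

context oplax_functor
begin

lemma oplax_in [simp]:
  assumes "a \<in> objs V" "x \<in> Obj M" "y \<in> Obj M" "r \<in> Rset M a x y" "Fo x = x'" "Fo y = y'"
  shows "f (a, x, y, r) \<in> Rset N a x' y'"
  using oplax_map assms by blast

lemma oplax_natural_arr:
  assumes "hs \<in> arrs V" "h \<in> Arr M" "k \<in> Arr M" "r \<in> Rset M (cods V hs) (Cod M h) (Dom M k)"
    "doms V hs = a" "Dom M h = x" "Cod M k = y"
  shows "f (a, x, y, Rmap M hs h k r) =
    Rmap N hs (Fa h) (Fa k) (f (cods V hs, Cod M h, Dom M k, r))"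
  using oplax_natural[of hs h "Dom M h" "Cod M h" k "Dom M k" "Cod M k" r] assms
  by (auto simp: hom_def)

lemma oplax_iota_arr:
  assumes "g \<in> Arr M" "Dom M g = x" "Cod M g = y"
  shows "f ([], x, y, Riota M x y g) = Riota N (Fo x) (Fo y) (Fa g)"
  using oplax_iota[of g x y] assms by (auto simp: hom_def)

lemmas oplax_alpha_arr = oplax_alpha[unfolded append.simps]

end

context dmodule
begin

lemma Riota_in [simp]: "g \<in> Arr M \<Longrightarrow> Dom M g = x \<Longrightarrow> Cod M g = y \<Longrightarrow> Riota M x y g \<in> Rset M [] x y"
  using iota_map[of g x y] by (auto simp: hom_def)

lemma Ralpha_in [simp]:
  assumes "a \<in> objs V" "b \<in> objs V" "a' \<in> objs V" "x \<in> Obj M" "y \<in> Obj M"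
    "r \<in> Rset M (a @ omega V b # a') x y"
  shows "Ralpha M a b a' x y r \<in> Rset M (a @ b @ a') x y"
  using alpha_map[of a b a' x y r] assms by simp

lemmas Rbeta_in [simp] = beta_map

end

lemma oplax_functor_id:
  assumes "dmodule V M"
  shows "oplax_functor V M M (restrict id (Obj M)) (restrict id (Arr M))
    (restrict (\<lambda>(a, x, y, r). r) (R_elements V M))"
proof -
  interpret dmodule V M by fact
  show ?thesis
    by (rule oplax_functorI)
      (use assms M.category_axioms in \<open>auto intro!: cat_functorI\<close>)
qed

lemma oplax_functor_comp:
  assumes "oplax_functor V L M Fo Fa f" "oplax_functor V M N Go Ga g"
  shows "oplax_functor V L N (restrict (Go \<circ> Fo) (Obj L)) (restrict (Ga \<circ> Fa) (Arr L))
    (restrict (\<lambda>(a, x, y, r). g (a, Fo x, Fo y, f (a, x, y, r))) (R_elements V L))"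
proof -
  interpret F: oplax_functor V L M Fo Fa f by fact
  interpret G: oplax_functor V M N Go Ga g by fact
  have *: "cat_functor L N (restrict (Go \<circ> Fo) (Obj L)) (restrict (Ga \<circ> Fa) (Arr L))"
    by (rule cat_functorI) (auto intro: F.M.M.category_axioms G.N.M.category_axioms)
  show ?thesis
    by (rule oplax_functorI)
      (use * in \<open>auto intro: F.M.dmodule_axioms G.N.dmodule_axioms
        simp: F.oplax_natural_arr G.oplax_natural_arr F.oplax_iota_arr G.oplax_iota_arr
          F.oplax_alpha_arr G.oplax_alpha_arr F.oplax_beta G.oplax_beta\<close>)
qed

definition oplax_compat :: "('v, 'w) omcat \<Rightarrow> ('v, 'w, 'o, 'a) oplax_cell \<Rightarrow> bool" where
  "oplax_compat V s \<longleftrightarrow>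
     (let F = SrcC s; G = TrgC s; M = Src F; N = Trg F in
       \<forall>a \<in> objs V. \<forall>x \<in> Obj M. \<forall>y \<in> Obj M. \<forall>r \<in> Rset M a x y.
         Rmap N (ides V a) (Ide N (OMap F x)) (At s y) (Str F (a, x, y, r)) =
         Rmap N (ides V a) (At s x) (Ide N (OMap G y)) (Str G (a, x, y, r)))"

lemma is_oplax_cell_iff:
  "is_oplax_cell V s \<longleftrightarrow> is_oplax_mor V (SrcC s) \<and> is_oplax_mor V (TrgC s) \<and> parallel (SrcC s) (TrgC s) \<and>
     nat_trans (Src (SrcC s)) (Trg (SrcC s)) (OMap (SrcC s)) (AMap (SrcC s)) (OMap (TrgC s)) (AMap (TrgC s)) (At s) \<and>
     At s \<in> extensional (Obj (Src (SrcC s))) \<and> oplax_compat V s"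
  by (simp add: is_oplax_cell_def oplax_compat_def Let_def)

text \<open>The covariant action of \<open>t\<close> at \<open>y\<close> commutes with the
  contravariant action of \<open>s\<close> at \<open>x\<close>, so the two compatibilities can be
  applied one after the other.\<close>

lemma oplax_compat_vcomp:
  assumes "is_oplax_cell V s" "is_oplax_cell V t" "SrcC t = TrgC s"
  shows "oplax_compat V (vcomp_cell cat.truncate t s)"
proof -
  let ?M = "Src (SrcC s)" and ?N = "Trg (SrcC s)"
  have s: "is_oplax_mor V (SrcC s)" "is_oplax_mor V (TrgC s)" "parallel (SrcC s) (TrgC s)" "oplax_compat V s"
    and ns: "nat_trans ?M ?N (OMap (SrcC s)) (AMap (SrcC s)) (OMap (TrgC s)) (AMap (TrgC s)) (At s)"
    using assms(1) by (auto simp: is_oplax_cell_iff)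
  have st: "Src (TrgC s) = ?M" "Trg (TrgC s) = ?N"
    using s by (auto simp: parallel_def)
  have t: "is_oplax_mor V (TrgC t)" "parallel (TrgC s) (TrgC t)" "oplax_compat V t"
    and nt: "nat_trans ?M ?N (OMap (TrgC s)) (AMap (TrgC s)) (OMap (TrgC t)) (AMap (TrgC t)) (At t)"
    using assms(2,3) st by (auto simp: is_oplax_cell_iff)
  have tt: "Src (TrgC t) = ?M" "Trg (TrgC t) = ?N"
    using t st by (auto simp: parallel_def)
  interpret F: oplax_functor V ?M ?N "OMap (SrcC s)" "AMap (SrcC s)" "Str (SrcC s)"
    using s(1) by (simp add: is_oplax_mor_def)
  interpret G: oplax_functor V ?M ?N "OMap (TrgC s)" "AMap (TrgC s)" "Str (TrgC s)"
    using s(2) st by (simp add: is_oplax_mor_def)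
  interpret H: oplax_functor V ?M ?N "OMap (TrgC t)" "AMap (TrgC t)" "Str (TrgC t)"
    using t(1) tt by (simp add: is_oplax_mor_def)
  \<comment> \<open>The last rule fuses nested actions into one; it is switched off in the steps
    where compatibility must match the inner action alone.\<close>
  note [simp] = nat_transD(1-3)[OF ns] nat_transD(1-3)[OF nt] F.N.Rmap_ides_comp
  have "Rmap ?N (ides V a) (Ide ?N (OMap (SrcC s) x)) (At t y \<cdot>\<^bsub>?N\<^esub> At s y) (Str (SrcC s) (a, x, y, r)) =
      Rmap ?N (ides V a) (At t x \<cdot>\<^bsub>?N\<^esub> At s x) (Ide ?N (OMap (TrgC t) y)) (Str (TrgC t) (a, x, y, r))"
    (is "?l = ?r") if ax: "a \<in> objs V" "x \<in> Obj ?M" "y \<in> Obj ?M" "r \<in> Rset ?M a x y" for a x y r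
  proof -
    have "?l = Rmap ?N (ides V a) (Ide ?N (OMap (SrcC s) x)) (At t y)
        (Rmap ?N (ides V a) (Ide ?N (OMap (SrcC s) x)) (At s y) (Str (SrcC s) (a, x, y, r)))"
      using ax by simp
    also have "\<dots> = Rmap ?N (ides V a) (Ide ?N (OMap (SrcC s) x)) (At t y)
        (Rmap ?N (ides V a) (At s x) (Ide ?N (OMap (TrgC s) y)) (Str (TrgC s) (a, x, y, r)))"
      using s(4) ax by (simp add: oplax_compat_def Let_def del: F.N.Rmap_ides_comp)
    also have "\<dots> = Rmap ?N (ides V a) (At s x) (Ide ?N (OMap (TrgC t) y))
        (Rmap ?N (ides V a) (Ide ?N (OMap (TrgC s) x)) (At t y) (Str (TrgC s) (a, x, y, r)))"
      using ax by simp
    also have "\<dots> = Rmap ?N (ides V a) (At s x) (Ide ?N (OMap (TrgC t) y))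
        (Rmap ?N (ides V a) (At t x) (Ide ?N (OMap (TrgC t) y)) (Str (TrgC t) (a, x, y, r)))"
      using t(3) ax by (simp add: oplax_compat_def st assms(3) Let_def del: F.N.Rmap_ides_comp)
    also have "\<dots> = ?r"
      using ax by simp
    finally show ?thesis .
  qed
  then show ?thesis
    by (simp add: oplax_compat_def vcomp_cell_def Let_def)
qed

text \<open>Naturality of the structure of \<open>SrcC t\<close> pulls the action of
  \<open>At s y\<close> inside, compatibility of \<open>s\<close> exchanges it for that of
  \<open>At s x\<close>, and naturality pushes the latter out again. What remains is compatibility
  of \<open>t\<close> at the element produced by \<open>TrgC s\<close>.\<close>

lemma oplax_compat_hcomp:
  assumes "is_oplax_cell V s" "is_oplax_cell V t" "Src (SrcC t) = Trg (SrcC s)"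
  shows "oplax_compat V (hcomp_cell cat.truncate (comp_oplax V) t s)"
proof -
  let ?L = "Src (SrcC s)" and ?M = "Trg (SrcC s)" and ?N = "Trg (SrcC t)"
  have s: "is_oplax_mor V (SrcC s)" "is_oplax_mor V (TrgC s)" "parallel (SrcC s) (TrgC s)" "oplax_compat V s"
    and ns: "nat_trans ?L ?M (OMap (SrcC s)) (AMap (SrcC s)) (OMap (TrgC s)) (AMap (TrgC s)) (At s)"
    using assms(1) by (auto simp: is_oplax_cell_iff)
  have st: "Src (TrgC s) = ?L" "Trg (TrgC s) = ?M"
    using s by (auto simp: parallel_def)
  have t: "is_oplax_mor V (SrcC t)" "is_oplax_mor V (TrgC t)" "parallel (SrcC t) (TrgC t)" "oplax_compat V t"
    and nt: "nat_trans ?M ?N (OMap (SrcC t)) (AMap (SrcC t)) (OMap (TrgC t)) (AMap (TrgC t)) (At t)"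
    using assms(2,3) by (auto simp: is_oplax_cell_iff)
  have tt: "Src (TrgC t) = ?M" "Trg (TrgC t) = ?N"
    using t assms(3) by (auto simp: parallel_def)
  interpret F: oplax_functor V ?L ?M "OMap (SrcC s)" "AMap (SrcC s)" "Str (SrcC s)"
    using s(1) by (simp add: is_oplax_mor_def)
  interpret F': oplax_functor V ?L ?M "OMap (TrgC s)" "AMap (TrgC s)" "Str (TrgC s)"
    using s(2) st by (simp add: is_oplax_mor_def)
  interpret G: oplax_functor V ?M ?N "OMap (SrcC t)" "AMap (SrcC t)" "Str (SrcC t)"
    using t(1) assms(3) by (simp add: is_oplax_mor_def)
  interpret G': oplax_functor V ?M ?N "OMap (TrgC t)" "AMap (TrgC t)" "Str (TrgC t)"
    using t(2) tt by (simp add: is_oplax_mor_def)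
  note [simp] = nat_transD(1-3)[OF ns] nat_transD(1-3)[OF nt] G.N.Rmap_ides_comp
  let ?At = "\<lambda>x. At t (OMap (TrgC s) x) \<cdot>\<^bsub>?N\<^esub> AMap (SrcC t) (At s x)"
  have "Rmap ?N (ides V a) (Ide ?N (OMap (SrcC t) (OMap (SrcC s) x))) (?At y)
        (Str (SrcC t) (a, OMap (SrcC s) x, OMap (SrcC s) y, Str (SrcC s) (a, x, y, r))) =
      Rmap ?N (ides V a) (?At x) (Ide ?N (OMap (TrgC t) (OMap (TrgC s) y)))
        (Str (TrgC t) (a, OMap (TrgC s) x, OMap (TrgC s) y, Str (TrgC s) (a, x, y, r)))"
    (is "?l = ?r") if ax: "a \<in> objs V" "x \<in> Obj ?L" "y \<in> Obj ?L" "r \<in> Rset ?L a x y" for a x y r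
  proof -
    let ?x = "OMap (SrcC s) x" and ?x' = "OMap (TrgC s) x" and ?y = "OMap (SrcC s) y" and ?y' = "OMap (TrgC s) y"
    let ?Fr = "Str (SrcC s) (a, x, y, r)" and ?F'r = "Str (TrgC s) (a, x, y, r)"
    have "?l = Rmap ?N (ides V a) (Ide ?N (OMap (SrcC t) ?x)) (At t ?y')
        (Rmap ?N (ides V a) (Ide ?N (OMap (SrcC t) ?x)) (AMap (SrcC t) (At s y)) (Str (SrcC t) (a, ?x, ?y, ?Fr)))"
      using ax by simp
    also have "\<dots> = Rmap ?N (ides V a) (Ide ?N (OMap (SrcC t) ?x)) (At t ?y')
        (Str (SrcC t) (a, ?x, ?y', Rmap ?M (ides V a) (Ide ?M ?x) (At s y) ?Fr))"
      using ax by (simp add: G.oplax_natural_arr del: G.N.Rmap_ides_comp)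
    also have "Rmap ?M (ides V a) (Ide ?M ?x) (At s y) ?Fr = Rmap ?M (ides V a) (At s x) (Ide ?M ?y') ?F'r"
      using s(4) ax by (simp add: oplax_compat_def Let_def)
    also have "Rmap ?N (ides V a) (Ide ?N (OMap (SrcC t) ?x)) (At t ?y')
          (Str (SrcC t) (a, ?x, ?y', Rmap ?M (ides V a) (At s x) (Ide ?M ?y') ?F'r)) =
        Rmap ?N (ides V a) (AMap (SrcC t) (At s x)) (Ide ?N (OMap (TrgC t) ?y'))
          (Rmap ?N (ides V a) (Ide ?N (OMap (SrcC t) ?x')) (At t ?y') (Str (SrcC t) (a, ?x', ?y', ?F'r)))"
      using ax by (simp add: G.oplax_natural_arr)
    also have "\<dots> = Rmap ?N (ides V a) (AMap (SrcC t) (At s x)) (Ide ?N (OMap (TrgC t) ?y'))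
          (Rmap ?N (ides V a) (At t ?x') (Ide ?N (OMap (TrgC t) ?y')) (Str (TrgC t) (a, ?x', ?y', ?F'r)))"
      using t(4) ax by (simp add: oplax_compat_def Let_def assms(3) del: G.N.Rmap_ides_comp)
    also have "\<dots> = ?r"
      using ax by simp
    finally show ?thesis .
  qed
  then show ?thesis
    using st tt by (simp add: oplax_compat_def hcomp_cell_def comp_oplax_def Let_def)
qed

lemma structured_cats_oplax:
  "structured_cats cat.truncate (dmodule V) (is_oplax_mor V) (is_oplax_cell V) (oplax_compat V)
    (id_oplax V) (comp_oplax V)"
proof (rule structured_cats.intro, goal_cases)
  case (1 M)
  then show ?case by (simp add: dmodule_def)
next
  case (2 F)
  then show ?case by (simp add: is_oplax_mor_def oplax_functor_def)
next
  case (3 F)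
  then show ?case by (simp add: is_oplax_mor_def oplax_functor_def)
next
  case (4 F)
  then show ?case by (simp add: is_oplax_mor_def oplax_functor_def)
next
  case (5 F)
  then show ?case by (simp add: is_oplax_mor_def oplax_functor.ext)
next
  case (6 F)
  then show ?case by (simp add: is_oplax_mor_def oplax_functor.ext)
next
  case (7 s)
  show ?case by (simp add: is_oplax_cell_iff)
next
  case (8 M)
  then show ?case by (simp add: is_oplax_mor_def id_oplax_def oplax_functor_id)
next
  case (13 F G)
  then show ?case by (simp add: is_oplax_mor_def comp_oplax_def oplax_functor_comp)
next
  case (18 F G H)
  then interpret F: oplax_functor V "Src F" "Trg F" "OMap F" "AMap F" "Str F"
    by (simp add: is_oplax_mor_def)
  interpret G: oplax_functor V "Trg F" "Trg G" "OMap G" "AMap G" "Str G"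
    using 18 by (simp add: is_oplax_mor_def)
  show ?case
    using 18 by (auto simp: comp_oplax_def fun_eq_iff)
next
  case (19 F)
  then interpret F: oplax_functor V "Src F" "Trg F" "OMap F" "AMap F" "Str F"
    by (simp add: is_oplax_mor_def)
  show ?case
    using F.ext(3) by (auto simp: comp_oplax_def id_oplax_def fun_eq_iff extensional_def)
next
  case (20 F)
  then interpret F: oplax_functor V "Src F" "Trg F" "OMap F" "AMap F" "Str F"
    by (simp add: is_oplax_mor_def)
  show ?case
    using F.ext(3) by (auto simp: comp_oplax_def id_oplax_def fun_eq_iff extensional_def)
next
  case (21 F)
  then interpret F: oplax_functor V "Src F" "Trg F" "OMap F" "AMap F" "Str F"
    by (simp add: is_oplax_mor_def)
  show ?case
    by (simp add: oplax_compat_def id_cell_def Let_def)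
qed (simp_all add: id_oplax_def comp_oplax_def oplax_compat_vcomp oplax_compat_hcomp)

lemma two_category_Vdmod_oplax: "two_category (Vdmod_oplax V)"
  using structured_cats.two_category[OF structured_cats_oplax[of V]]
  by (simp add: structured_cats.two_cat_def[OF structured_cats_oplax] Vdmod_oplax_def)

section \<open>Modules as representable distributors\<close>

section \<open>The 2-functor from modules to \<open>\<delta>\<close>modules\<close>

lemma dmod_of_simps [simp]:
  "Obj (dmod_of V M) = Obj M" "Arr (dmod_of V M) = Arr M" "Dom (dmod_of V M) = Dom M"
  "Cod (dmod_of V M) = Cod M" "Ide (dmod_of V M) = Ide M" "Comp (dmod_of V M) = Comp M"
  "Rset (dmod_of V M) = (\<lambda>a x y. hom M (rho M a x) y)"
  "Rmap (dmod_of V M) = (\<lambda>fs f g r. g \<cdot>\<^bsub>M\<^esub> r \<cdot>\<^bsub>M\<^esub> rho_map M fs f)"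
  "Ralpha (dmod_of V M) = (\<lambda>a b a' x y r. r \<cdot>\<^bsub>M\<^esub> rho_split M a b a' x)"
  "Rbeta (dmod_of V M) = (\<lambda>a b x m y r s. r \<cdot>\<^bsub>M\<^esub> rho_map M (ides V a) s \<cdot>\<^bsub>M\<^esub> rho_nest M a b x)"
  "Riota (dmod_of V M) = (\<lambda>x y g. g \<cdot>\<^bsub>M\<^esub> rho_counit M x)"
  by (simp_all add: dmod_of_def)

lemma hom_dmod_of [simp]: "hom (dmod_of V M) = hom M"
  by (simp add: hom_def fun_eq_iff)

lemma category_dmod_of [simp]: "category (dmod_of V M) \<longleftrightarrow> category M"
  by (simp add: category_def)

lemma cat_functor_dmod_of [simp]:
  "cat_functor (dmod_of V M) (dmod_of V N) Fo Fa \<longleftrightarrow> cat_functor M N Fo Fa"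
  by (simp add: cat_functor_def cat_functor_axioms_def)

lemma nat_trans_dmod_of [simp]:
  "nat_trans (dmod_of V M) (dmod_of V N) Fo Fa Go Ga \<tau> \<longleftrightarrow> nat_trans M N Fo Fa Go Ga \<tau>"
  by (simp add: nat_trans_def nat_trans_axioms_def)

lemma dist_cat_dmod_of [simp]: "dist_cat V (dmod_of V M) n = dist_cat V M n"
  by (simp add: dist_cat_def prod_cat_def op_cat_def)

lemma category_op_cat:
  assumes "category C"
  shows "category (op_cat C)"
proof -
  interpret category C by fact
  show ?thesis
    by (rule categoryI) (auto simp: assoc)
qed

lemma category_prod_cat:
  assumes "category C" "category D"
  shows "category (prod_cat C D)"
proof -
  interpret C: category C by fact
  interpret D: category D by fact
  show ?thesis
    by (rule categoryI) (auto simp: C.assoc D.assoc)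
qed

text \<open>In a right-nested composite the side \<open>p \<cdot> q\<close> of a square is no longer
  a subterm once an arrow \<open>k\<close> precedes it; this is the square with that tail.\<close>

lemma (in category) comp_eq_comp:
  assumes "p \<cdot> q = r \<cdot> s" "p \<in> Arr C" "q \<in> Arr C" "r \<in> Arr C" "s \<in> Arr C" "k \<in> Arr C"
    "Dom C p = Cod C q" "Dom C r = Cod C s" "Dom C q = Cod C k" "Dom C s = Cod C k"
  shows "p \<cdot> (q \<cdot> k) = r \<cdot> (s \<cdot> k)"
  using assms by (simp flip: assoc)

context vmodule
begin

text \<open>That the product of the power with \<open>M\<close> is a category is contained in
  \<open>rho_functor\<close>, whose source it is.\<close>

lemma category_dist_cat: "category (dist_cat V M n)"
  unfolding dist_cat_def
  using category_prod_cat[OF category_op_cat[OF cat_functor.axioms(1)[OF rho_functor]]]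
    M.category_axioms by blast

lemma set_functor_hom_rho:
  "set_functor (dist_cat V M n) (\<lambda>((a, x), y). hom M (rho M a x) y)
     (\<lambda>((fs, f), g) r. g \<cdot> r \<cdot> rho_map M fs f)"
proof (intro set_functor.intro set_functor_axioms.intro category_dist_cat, goal_cases)
  case (1 h p q r)
  then show ?case
    by (cases h; cases "fst h"; cases p; cases "fst p"; cases q; cases "fst q")
      (auto simp: hom_def dist_cat_def)
next
  case (2 p r)
  then show ?case
    by (cases p; cases "fst p") (auto simp: hom_def dist_cat_def)
next
  case (3 h p q k p' r)
  obtain fs f g where h: "h = ((fs, f), g)" by (metis surj_pair)
  obtain fs' f' g' where k: "k = ((fs', f'), g')" by (metis surj_pair)
  obtain a x y where p: "p = ((a, x), y)" by (metis surj_pair)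
  have *: "fs \<in> arrs V" "f \<in> Arr M" "g \<in> Arr M" "fs' \<in> arrs V" "f' \<in> Arr M" "g' \<in> Arr M"
    "cods V fs' = doms V fs" "Cod M f' = Dom M f" "Dom M g' = Cod M g" "cods V fs = a" "Cod M f = x"
    "Dom M g = y" "r \<in> Arr M" "Dom M r = rho M a x" "Cod M r = y"
    using 3 by (auto simp: hom_def dist_cat_def h k p)
  then show ?case
    using act_map_comp[of fs' f' fs f] by (simp add: h k dist_cat_def M.assoc)
qed

lemma dmodule_dmod_of: "dmodule V (dmod_of V M)"
proof (intro dmodule.intro dmodule_axioms.intro, goal_cases)
  case 1
  show ?case by (rule V.oplax_monoidal_axioms)
next
  case 2
  show ?case using M.category_axioms by simp
next
  case (3 n)
  have "(\<lambda>((fs, f), g). Rmap (dmod_of V M) fs f g) = (\<lambda>((fs, f), g) r. g \<cdot> r \<cdot> rho_map M fs f)"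
    by auto
  then show ?case using set_functor_hom_rho[of n] by simp
next
  case (4 a b a' x y r)
  then show ?case by (simp add: hom_def)
next
  case (5 fs gs fs' f x x' g y y' r)
  then have "x \<in> Obj M" "x' \<in> Obj M"
    by (auto simp: hom_def)
  then show ?case
    using 5 rho_split_natural[of fs gs fs' f x x'] by (simp add: hom_def M.assoc)
next
  case (6 a b x m y r s)
  then show ?case by (simp add: hom_def)
next
  case (7 fs gs f x x' m g y y' r s)
  then have *: "fs \<in> arrs V" "gs \<in> arrs V" "f \<in> Arr M" "Dom M f = x" "Cod M f = x'" "m \<in> Obj M"
    "g \<in> Arr M" "Dom M g = y" "Cod M g = y'" "r \<in> Arr M" "Dom M r = rho M (cods V fs) m" "Cod M r = y"
    "s \<in> Arr M" "Dom M s = rho M (cods V gs) x'" "Cod M s = m" "x \<in> Obj M" "x' \<in> Obj M"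
    by (auto simp: hom_def)
  \<comment> \<open>Names for the boundary lists keep \<open>ides V (doms V fs)\<close> from being
    collapsed into a single \<open>map\<close>, which would hide it from the rules about
    \<open>ides\<close>.\<close>
  obtain a a' b b' where [simp]: "doms V fs = a" "cods V fs = a'" "doms V gs = b" "cods V gs = b'"
    by blast
  have [simp]: "a \<in> objs V" "a' \<in> objs V" "b \<in> objs V" "b' \<in> objs V"
    using *(1,2) V.doms_cods_objs[of fs] V.doms_cods_objs[of gs] by auto
  \<comment> \<open>The two actions are merged into one action of \<open>fs\<close>, and
    \<open>s\<close> is then split off on the left; this leaves the naturality square of
    \<open>rho_nest\<close>.\<close>
  have "rho_map M fs (Ide M m) \<cdot> (rho_map M (ides V a) (s \<cdot> rho_map M gs f) \<cdot> rho_nest M a b x) =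
      rho_map M fs (s \<cdot> rho_map M gs f) \<cdot> rho_nest M a b x"
    using * by (simp add: act_map_ides_right del: act_map_ides_comp flip: M.assoc)
  also have "\<dots> = rho_map M (ides V a') s \<cdot> (rho_map M fs (rho_map M gs f) \<cdot> rho_nest M a b x)"
    using * by (simp add: act_map_ides_left flip: M.assoc)
  also have "\<dots> = rho_map M (ides V a') s \<cdot> (rho_nest M a' b' x' \<cdot> rho_map M (fs @ gs) f)"
    using * rho_nest_natural[of fs gs f x x'] by (simp add: hom_def)
  finally show ?case
    using * by (simp add: M.assoc del: act_map_ides_comp)
next
  case (8 a b x k m m' y r s)
  then show ?case by (auto simp: hom_def M.assoc)
next
  case (9 g x y)
  then show ?case by (auto simp: hom_def)
next
  case (10 f x x' g y h y')
  then show ?case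
    using rho_counit_natural[of f x x'] by (auto simp: hom_def M.assoc)
next
  case (11 a x r y g z)
  then have *: "r \<in> Arr M" "Dom M r = rho M a x" "Cod M r = y" "g \<in> Arr M" "Dom M g = y" "Cod M g = z"
    "y \<in> Obj M"
    by (auto simp: hom_def)
  \<comment> \<open>Naturality of the counit at \<open>r\<close> puts it next to
    \<open>rho_nest\<close>, where \<open>rho_counit_outer\<close> cancels both.\<close>
  have "rho_counit M y \<cdot> (rho_map M [] r \<cdot> rho_nest M [] a x) = r \<cdot> (rho_counit M (rho M a x) \<cdot> rho_nest M [] a x)"
    by (rule M.comp_eq_comp) (use * 11 rho_counit_natural[of r "rho M a x" y] in \<open>auto simp: hom_def\<close>)
  then show ?case
    using * 11 by (simp add: rho_counit_outer M.assoc)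
next
  case (12 a y r x f w)
  then have "r \<in> Arr M" "Dom M r = rho M a x" "Cod M r = y" "f \<in> Arr M" "Dom M f = w" "Cod M f = x"
    "w \<in> Obj M" "x \<in> Obj M"
    by (auto simp: hom_def)
  then show ?case
    using 12 rho_counit_inner[of a w] by (simp add: M.assoc)
next
  case (13 a v a' x y r)
  then show ?case
    using omega_counit_rho[of a v a' x] by (auto simp: hom_def M.assoc)
next
  case (14 a b c d e x y r)
  then show ?case
    using rho_split_parallel[of a b c d e x] by (auto simp: hom_def M.assoc)
next
  case (15 a b a' c x m y r s)
  then have *: "r \<in> Arr M" "Dom M r = rho M (a @ omega V b # a') m" "Cod M r = y"
    "s \<in> Arr M" "Dom M s = rho M c x" "Cod M s = m"
    by (auto simp: hom_def)
  \<comment> \<open>Naturality of the splitting at \<open>s\<close>, with identities in the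
    \<open>V\<close>-slots, brings the two insertions next to each other.\<close>
  have "rho_split M a b a' m \<cdot> (rho_map M (ides V (a @ b @ a')) s \<cdot> rho_nest M (a @ b @ a') c x) =
      rho_map M (ides V (a @ omega V b # a')) s \<cdot> (rho_split M a b a' (rho M c x) \<cdot> rho_nest M (a @ b @ a') c x)"
    by (rule M.comp_eq_comp)
      (use * 15 rho_split_natural[of "ides V a" "ides V b" "ides V a'" s "rho M c x" m] in \<open>auto simp: hom_def\<close>)
  then show ?case
    using * 15 rho_nest_split_parallel[of a b a' c x] by (auto simp: M.assoc)
next
  case (16 a b c b' x m y r s)
  then show ?case
    using rho_nest_split_nested[of a b c b' x] by (auto simp: hom_def M.assoc)
next
  case (17 a b c b' a' x y r)
  then show ?case
    using rho_split_nested[of a b c b' a' x] by (auto simp: hom_def M.assoc)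
next
  case (18 a b c x l m y r s t)
  then have *: "r \<in> Arr M" "Dom M r = rho M a m" "Cod M r = y"
    "s \<in> Arr M" "Dom M s = rho M b l" "Cod M s = m" "t \<in> Arr M" "Dom M t = rho M c x" "Cod M t = l"
    by (auto simp: hom_def)
  \<comment> \<open>Naturality of nesting at \<open>t\<close> makes the two nestings adjacent, as
    \<open>rho_nest_nested\<close> requires.\<close>
  have "rho_nest M a b l \<cdot> (rho_map M (ides V (a @ b)) t \<cdot> rho_nest M (a @ b) c x) =
      rho_map M (ides V a) (rho_map M (ides V b) t) \<cdot> (rho_nest M a b (rho M c x) \<cdot> rho_nest M (a @ b) c x)"
    by (rule M.comp_eq_comp)
      (use * 18 rho_nest_natural[of "ides V a" "ides V b" t "rho M c x" l] in \<open>auto simp: hom_def\<close>)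
  then show ?case
    using * 18 rho_nest_nested[of a b c x] by (auto simp: M.assoc)
qed

lemma left_representable_dmod_of: "left_representable V (dmod_of V M)"
proof -
  have "set_nat_iso (dist_cat V M n) (\<lambda>((a, x), y). hom M (rho M a x) y)
      (\<lambda>((fs, f), g) r. g \<cdot> r \<cdot> rho_map M fs f)
      (\<lambda>((a, x), y). hom M (rho M a x) y) (\<lambda>((fs, f), g) r. g \<cdot> r \<cdot> rho_map M fs f) (\<lambda>_ r. r)" for n
    by (intro set_nat_iso.intro set_nat_iso_axioms.intro set_functor_hom_rho) (auto simp: bij_betw_def)
  \<comment> \<open>The representation is the identity; these equations only reconcile the tuple
    patterns with those of \<open>left_representable\<close>.\<close>
  moreover have "(\<lambda>((a, x), y). hom M (rho M a x) y) = (\<lambda>(p, y). hom M ((\<lambda>(a, x). rho M a x) p) y)"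
    "(\<lambda>((fs, f), g) r. g \<cdot> r \<cdot> rho_map M fs f) =
      (\<lambda>(h, g) r. g \<cdot> r \<cdot> (\<lambda>(fs, f). rho_map M fs f) h)"
    "(\<lambda>((fs, f), g) r. g \<cdot> r \<cdot> rho_map M fs f) = (\<lambda>((fs, f), g). (\<lambda>r. g \<cdot> r \<cdot> rho_map M fs f))"
    by auto
  moreover have "cat_functor (prod_cat (pow_cat V n) (dmod_of V M)) (dmod_of V M)
      (\<lambda>(a, x). rho M a x) (\<lambda>(fs, f). rho_map M fs f)" for n
    using rho_functor[of n] by (simp add: cat_functor_def cat_functor_axioms_def prod_cat_def)
  ultimately show ?thesis
    unfolding left_representable_def by (simp, metis)
qed

end

lemma (in lax_morphism) oplax_functor_oplax_of:
  "oplax_functor V (dmod_of V M) (dmod_of V N) Fo Fa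
     (restrict (\<lambda>(a, x, y, r). Fa r \<cdot>\<^bsub>N\<^esub> f (a, x)) (R_elements V (dmod_of V M)))"
proof (rule oplax_functorI, goal_cases)
  case 1
  show ?case by (rule M.dmodule_dmod_of)
next
  case 2
  show ?case by (rule N.dmodule_dmod_of)
next
  case 3
  show ?case using F.cat_functor_axioms by simp
next
  case 4
  show ?case using ext by simp
next
  case 5
  show ?case using ext by simp
next
  case 6
  show ?case by simp
next
  case (7 a x y r)
  then show ?case by (auto simp: hom_def)
next
  case (8 hs h k r)
  then show ?case
    by (auto simp: hom_def N.M.assoc lax_natural_arr)
next
  case (9 g)
  then show ?case
    by (auto simp: hom_def N.M.assoc lax_counit)
next
  case (10 a b a' x y r)
  then show ?case
    using lax_split[of a b a' x] by (auto simp: hom_def N.M.assoc)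
next
  case (11 a b x m y r s)
  then have *: "r \<in> Arr M" "Dom M r = rho M a m" "Cod M r = y" "s \<in> Arr M" "Dom M s = rho M b x" "Cod M s = m"
    by (auto simp: hom_def)
  let ?nest = "rho_map N (ides V a) (f (b, x)) \<cdot>\<^bsub>N\<^esub> rho_nest N a b (Fo x)"
  \<comment> \<open>Naturality of \<open>f\<close> at \<open>s\<close> moves the image of
    \<open>s\<close> outwards and exposes the left side of \<open>lax_nest\<close>.\<close>
  have "f (a, m) \<cdot>\<^bsub>N\<^esub> (rho_map N (ides V a) (Fa s) \<cdot>\<^bsub>N\<^esub> ?nest) =
      Fa (rho_map M (ides V a) s) \<cdot>\<^bsub>N\<^esub> (f (a, rho M b x) \<cdot>\<^bsub>N\<^esub> ?nest)"
    by (rule N.M.comp_eq_comp) (use 11 * in \<open>auto simp: lax_natural_arr\<close>)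
  also have "\<dots> = Fa (rho_map M (ides V a) s) \<cdot>\<^bsub>N\<^esub> (Fa (rho_nest M a b x) \<cdot>\<^bsub>N\<^esub> f (a @ b, x))"
    using 11 by (simp add: lax_nest)
  finally show ?case
    using 11 * by (auto simp: hom_def N.M.assoc)
qed

lemma oplax_of_simps [simp]:
  "Src (oplax_of V F) = dmod_of V (Src F)" "Trg (oplax_of V F) = dmod_of V (Trg F)"
  "OMap (oplax_of V F) = OMap F" "AMap (oplax_of V F) = AMap F"
  by (simp_all add: oplax_of_def)

lemma oplax_cell_of_simps [simp]:
  "SrcC (oplax_cell_of V s) = oplax_of V (SrcC s)" "TrgC (oplax_cell_of V s) = oplax_of V (TrgC s)"
  "At (oplax_cell_of V s) = At s"
  by (simp_all add: oplax_cell_of_def)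

lemma is_oplax_mor_oplax_of: "is_lax_mor V F \<Longrightarrow> is_oplax_mor V (oplax_of V F)"
  using lax_morphism.oplax_functor_oplax_of
  by (fastforce simp: is_lax_mor_def is_oplax_mor_def oplax_of_def)

text \<open>
  The module condition is the \<open>\<delta>\<close>module condition at \<open>y = \<rho>(a, x)\<close> and the identity \<open>r\<close>.
\<close>

lemma oplax_compat_iff:
  assumes F: "lax_morphism V M N Fo Fa f" and G: "lax_morphism V M N Go Ga g"
    and \<tau>: "nat_trans M N Fo Fa Go Ga \<tau>"
  shows "(\<forall>a \<in> objs V. \<forall>x \<in> Obj M. \<forall>y \<in> Obj M. \<forall>r \<in> hom M (rho M a x) y.
       \<tau> y \<cdot>\<^bsub>N\<^esub> (Fa r \<cdot>\<^bsub>N\<^esub> f (a, x)) \<cdot>\<^bsub>N\<^esub> rho_map N (ides V a) (Ide N (Fo x)) =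
       Ide N (Go y) \<cdot>\<^bsub>N\<^esub> (Ga r \<cdot>\<^bsub>N\<^esub> g (a, x)) \<cdot>\<^bsub>N\<^esub> rho_map N (ides V a) (\<tau> x)) \<longleftrightarrow>
     (\<forall>a \<in> objs V. \<forall>x \<in> Obj M.
       g (a, x) \<cdot>\<^bsub>N\<^esub> rho_map N (ides V a) (\<tau> x) = \<tau> (rho M a x) \<cdot>\<^bsub>N\<^esub> f (a, x))" (is "?oplax \<longleftrightarrow> ?lax")
proof -
  interpret F: lax_morphism V M N Fo Fa f by fact
  interpret G: lax_morphism V M N Go Ga g by fact
  note [simp] = nat_transD(1-3)[OF \<tau>]
  show ?thesis
  proof (intro iffI ballI)
    fix a x assume H: ?oplax "a \<in> objs V" "x \<in> Obj M"
    show "g (a, x) \<cdot>\<^bsub>N\<^esub> rho_map N (ides V a) (\<tau> x) = \<tau> (rho M a x) \<cdot>\<^bsub>N\<^esub> f (a, x)"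
      using H(1)[rule_format, of a x "rho M a x" "Ide M (rho M a x)"] H(2,3)
      by (simp add: hom_def F.N.M.assoc)
  next
    fix a x y r assume H: ?lax "a \<in> objs V" "x \<in> Obj M" "y \<in> Obj M" "r \<in> hom M (rho M a x) y"
    then have r: "r \<in> Arr M" "Dom M r = rho M a x" "Cod M r = y"
      by (auto simp: hom_def)
    have "\<tau> y \<cdot>\<^bsub>N\<^esub> (Fa r \<cdot>\<^bsub>N\<^esub> f (a, x)) = Ga r \<cdot>\<^bsub>N\<^esub> (\<tau> (rho M a x) \<cdot>\<^bsub>N\<^esub> f (a, x))"
      by (rule F.N.M.comp_eq_comp) (use H(2-4) r nat_transD(4)[OF \<tau>, of r] in auto)
    then show "\<tau> y \<cdot>\<^bsub>N\<^esub> (Fa r \<cdot>\<^bsub>N\<^esub> f (a, x)) \<cdot>\<^bsub>N\<^esub> rho_map N (ides V a) (Ide N (Fo x)) =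
       Ide N (Go y) \<cdot>\<^bsub>N\<^esub> (Ga r \<cdot>\<^bsub>N\<^esub> g (a, x)) \<cdot>\<^bsub>N\<^esub> rho_map N (ides V a) (\<tau> x)"
      using H r by (simp add: F.N.M.assoc)
  qed
qed

text \<open>One direction lets the 2-functor act on 2-cells, the other is its fullness on
  them.\<close>

lemma is_oplax_cell_oplax_cell_of:
  assumes "is_lax_mor V (SrcC s)" "is_lax_mor V (TrgC s)" "parallel (SrcC s) (TrgC s)"
  shows "is_oplax_cell V (oplax_cell_of V s) \<longleftrightarrow> is_lax_cell V s"
proof -
  let ?M = "Src (SrcC s)" and ?N = "Trg (SrcC s)"
  have *: "Src (TrgC s) = ?M" "Trg (TrgC s) = ?N"
    using assms(3) by (auto simp: parallel_def)
  interpret F: lax_morphism V ?M ?N "OMap (SrcC s)" "AMap (SrcC s)" "Str (SrcC s)"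
    using assms(1) by (simp add: is_lax_mor_def)
  interpret G: lax_morphism V ?M ?N "OMap (TrgC s)" "AMap (TrgC s)" "Str (TrgC s)"
    using assms(2) * by (simp add: is_lax_mor_def)
  have "oplax_compat V (oplax_cell_of V s) \<longleftrightarrow> lax_compat V s"
    if "nat_trans ?M ?N (OMap (SrcC s)) (AMap (SrcC s)) (OMap (TrgC s)) (AMap (TrgC s)) (At s)"
    using oplax_compat_iff[OF F.lax_morphism_axioms G.lax_morphism_axioms that]
    by (simp add: oplax_compat_def lax_compat_def Let_def oplax_of_def *)
  then show ?thesis
    using assms by (auto simp: is_oplax_cell_iff is_lax_cell_iff is_oplax_mor_oplax_of parallel_def)
qed

lemma oplax_of_id_lax:
  assumes "vmodule V M"
  shows "oplax_of V (id_lax V M) = id_oplax V (dmod_of V M)"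
proof -
  interpret vmodule V M by fact
  show ?thesis
    by (auto simp: oplax_of_def id_lax_def id_oplax_def fun_eq_iff restrict_def hom_def)
qed

text \<open>Strict equality holds because distributing \<open>AMap G\<close> over the composite of
  \<open>AMap F r\<close> with the structure arrow of \<open>F\<close> gives the iterated structure
  map; outside the carriers both sides are \<open>undefined\<close>.\<close>

lemma oplax_of_comp_lax:
  assumes "is_lax_mor V F" "is_lax_mor V G" "Src G = Trg F"
  shows "oplax_of V (comp_lax V G F) = comp_oplax V (oplax_of V G) (oplax_of V F)"
proof -
  interpret F: lax_morphism V "Src F" "Trg F" "OMap F" "AMap F" "Str F"
    using assms by (simp add: is_lax_mor_def)
  interpret G: lax_morphism V "Trg F" "Trg G" "OMap G" "AMap G" "Str G"
    using assms by (simp add: is_lax_mor_def)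
  show ?thesis
    using assms(3)
    by (auto simp: oplax_of_def comp_lax_def comp_oplax_def fun_eq_iff restrict_def hom_def G.N.M.assoc)
qed

lemma Vmod_lax_simps:
  "Ob0 (Vmod_lax V) = {M. vmodule V M}" "Mor1 (Vmod_lax V) = {F. is_lax_mor V F}"
  "Cell2 (Vmod_lax V) = {s. is_lax_cell V s}" "src1 (Vmod_lax V) = Src" "trg1 (Vmod_lax V) = Trg"
  "src2 (Vmod_lax V) = SrcC" "trg2 (Vmod_lax V) = TrgC" "id1 (Vmod_lax V) = id_lax V"
  "comp1 (Vmod_lax V) = comp_lax V" "id2 (Vmod_lax V) = id_cell cat.truncate"
  "vcomp (Vmod_lax V) = vcomp_cell cat.truncate"
  "hcomp (Vmod_lax V) = hcomp_cell cat.truncate (comp_lax V)"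
  by (simp_all add: Vmod_lax_def)

lemma Vdmod_oplax_simps:
  "Ob0 (Vdmod_oplax V) = {M. dmodule V M}" "Mor1 (Vdmod_oplax V) = {F. is_oplax_mor V F}"
  "Cell2 (Vdmod_oplax V) = {s. is_oplax_cell V s}" "src1 (Vdmod_oplax V) = Src" "trg1 (Vdmod_oplax V) = Trg"
  "src2 (Vdmod_oplax V) = SrcC" "trg2 (Vdmod_oplax V) = TrgC" "id1 (Vdmod_oplax V) = id_oplax V"
  "comp1 (Vdmod_oplax V) = comp_oplax V" "id2 (Vdmod_oplax V) = id_cell cat.truncate"
  "vcomp (Vdmod_oplax V) = vcomp_cell cat.truncate"
  "hcomp (Vdmod_oplax V) = hcomp_cell cat.truncate (comp_oplax V)"
  by (simp_all add: Vdmod_oplax_def)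

lemma is_lax_cellD:
  assumes "is_lax_cell V s"
  shows "is_lax_mor V (SrcC s)" "is_lax_mor V (TrgC s)" "Src (TrgC s) = Src (SrcC s)"
    "Trg (TrgC s) = Trg (SrcC s)"
  using assms by (auto simp: is_lax_cell_iff parallel_def)

lemma is_lax_morD: "is_lax_mor V F \<Longrightarrow> vmodule V (Src F)" "is_lax_mor V F \<Longrightarrow> vmodule V (Trg F)"
  by (auto simp: is_lax_mor_def lax_morphism_def)

theorem two_functor_dmod_of:
  "two_functor (Vmod_lax V) (Vdmod_oplax V) (dmod_of V) (oplax_of V) (oplax_cell_of V)"
proof -
  interpret S: two_category "Vmod_lax V" by (rule two_category_Vmod_lax)
  interpret T: two_category "Vdmod_oplax V" by (rule two_category_Vdmod_oplax)
  have cell: "is_oplax_cell V (oplax_cell_of V s)" if "is_lax_cell V s" for s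
    using that by (subst is_oplax_cell_oplax_cell_of) (auto simp: is_lax_cell_iff)
  show ?thesis
  proof (intro two_functor.intro two_functor_axioms.intro S.two_category_axioms T.two_category_axioms)
    show "cat_functor (one_cat (Vmod_lax V)) (one_cat (Vdmod_oplax V)) (dmod_of V) (oplax_of V)"
      by (rule cat_functorI)
        (auto simp: two_cat_simps Vmod_lax_simps Vdmod_oplax_simps vmodule.dmodule_dmod_of
          is_oplax_mor_oplax_of oplax_of_id_lax oplax_of_comp_lax S.one_category T.one_category)
    show "cat_functor (vert_cat (Vmod_lax V)) (vert_cat (Vdmod_oplax V)) (oplax_of V) (oplax_cell_of V)"
      by (rule cat_functorI)
        (auto simp: two_cat_simps Vmod_lax_simps Vdmod_oplax_simps cell cell[unfolded oplax_cell_of_def] is_oplax_mor_oplax_of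
          S.vert_category T.vert_category id_cell_def vcomp_cell_def oplax_cell_of_def)
    show "cat_functor (horiz_cat (Vmod_lax V)) (horiz_cat (Vdmod_oplax V)) (dmod_of V) (oplax_cell_of V)"
      by (rule cat_functorI)
        (auto simp: two_cat_simps Vmod_lax_simps Vdmod_oplax_simps cell cell[unfolded oplax_cell_of_def] vmodule.dmodule_dmod_of
          S.horiz_category T.horiz_category oplax_of_comp_lax is_lax_cellD
          oplax_cell_of_def id_cell_def hcomp_cell_def oplax_of_id_lax, simp add: id_lax_def id_oplax_def)
  qed
qed

section \<open>Yoneda correspondence for 1-cells and 2-cells\<close>

section \<open>Full faithfulness\<close>

text \<open>The modules are passed explicitly, since \<open>G\<close> itself names only
  \<delta>modules.\<close>

definition lax_of :: "('v, 'w) omcat \<Rightarrow> ('v, 'w, 'o, 'a) vmod \<Rightarrow> ('v, 'w, 'o, 'a) vmod \<Rightarrow>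
    ('v, 'w, 'o, 'a) oplax_mor \<Rightarrow> ('v, 'w, 'o, 'a) lax_mor" where
  "lax_of V M N G = \<lparr>Src = M, Trg = N, OMap = OMap G, AMap = AMap G,
     Str = restrict (\<lambda>(a, x). Str G (a, x, rho M a x, Ide M (rho M a x))) (objs V \<times> Obj M)\<rparr>"

locale oplax_functor_of_modules = vM: vmodule V M + vN: vmodule V N +
    oplax_functor V "dmod_of V M" "dmod_of V N" Fo Fa f
  for V :: "('v, 'w) omcat" and M N :: "('v, 'w, 'o, 'a) vmod"
    and Fo :: "'o \<Rightarrow> 'o" and Fa :: "'a \<Rightarrow> 'a" and f
begin

abbreviation lax_str :: "'v list \<Rightarrow> 'o \<Rightarrow> 'a" where
  "lax_str a x \<equiv> f (a, x, rho M a x, Ide M (rho M a x))"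

lemma module_functor: "cat_functor M N Fo Fa"
  using F.cat_functor_axioms by simp

sublocale F': cat_functor M N Fo Fa
  by (rule module_functor)

lemma lax_str_arr [simp]:
  assumes "a \<in> objs V" "x \<in> Obj M"
  shows "lax_str a x \<in> Arr N" "Dom N (lax_str a x) = rho N a (Fo x)" "Cod N (lax_str a x) = Fo (rho M a x)"
  using oplax_in[of a x "rho M a x" "Ide M (rho M a x)"] assms by (auto simp: hom_def)

text \<open>Naturality of \<open>f\<close> in the covariant variable, applied to \<open>r\<close> as
  the push-forward of an identity along itself.\<close>

lemma f_eq:
  assumes "a \<in> objs V" "x \<in> Obj M" "r \<in> Arr M" "Dom M r = rho M a x" "Cod M r = y"
  shows "f (a, x, y, r) = Fa r \<cdot>\<^bsub>N\<^esub> lax_str a x"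
  using oplax_natural_arr[of "ides V a" "Ide M x" r "Ide M (rho M a x)" a x y] assms
  by (simp add: hom_def vN.M.assoc)

text \<open>At identities the operations of \<open>dmod_of\<close> return the structure arrows of
  the module. Each lax law is therefore an oplax law at identities, with \<open>f_eq\<close> turning
  values of \<open>f\<close> at structure arrows into composites.\<close>

lemma lax_morphism:
  "lax_morphism V M N Fo Fa (restrict (\<lambda>(a, x). lax_str a x) (objs V \<times> Obj M))"
proof (rule lax_morphismI, goal_cases)
  case 1
  show ?case by (rule vM.vmodule_axioms)
next
  case 2
  show ?case by (rule vN.vmodule_axioms)
next
  case 3
  show ?case by (rule module_functor)
next
  case 4
  show ?case using ext by simp
next
  case 5
  show ?case using ext by simp
next
  case 6
  show ?case by simp
next
  case (7 a x)
  then show ?case by simp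
next
  case (8 hs h)
  let ?y = "rho M (cods V hs) (Cod M h)"
  show ?case
    using oplax_natural_arr[of hs h "Ide M ?y" "Ide M ?y" "doms V hs" "Dom M h" ?y] 8
    by (simp add: f_eq[of _ _ "rho_map M hs h"] hom_def)
next
  case (9 x)
  then show ?case
    using oplax_iota_arr[of "Ide M x" x x] by (simp add: f_eq[of _ _ "rho_counit M x"])
next
  case (10 a b a' x)
  then show ?case
    using oplax_alpha_arr[of a b a' x "rho M (a @ omega V b # a') x" "Ide M (rho M (a @ omega V b # a') x)"]
    by (simp add: f_eq[of _ _ "rho_split M a b a' x"] hom_def)
next
  case (11 a b x)
  then show ?case
    using oplax_beta[of a b x "rho M b x" "rho M a (rho M b x)" "Ide M (rho M a (rho M b x))" "Ide M (rho M b x)"]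
    by (simp add: f_eq[of _ _ "rho_nest M a b x"] hom_def vN.M.assoc)
qed

end

lemma oplax_of_lax_of:
  assumes "vmodule V M" "vmodule V N" "is_oplax_mor V G" "Src G = dmod_of V M" "Trg G = dmod_of V N"
  shows "is_lax_mor V (lax_of V M N G)" "oplax_of V (lax_of V M N G) = G"
proof -
  interpret vM: vmodule V M by fact
  interpret vN: vmodule V N by fact
  interpret oplax_functor V "dmod_of V M" "dmod_of V N" "OMap G" "AMap G" "Str G"
    using assms by (simp add: is_oplax_mor_def)
  interpret oplax_functor_of_modules V M N "OMap G" "AMap G" "Str G"
    by unfold_locales
  show "is_lax_mor V (lax_of V M N G)"
    using lax_morphism by (simp add: is_lax_mor_def lax_of_def)
  \<comment> \<open>On elements this is \<open>f_eq\<close>; outside \<open>R_elements\<close> both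
    sides are \<open>undefined\<close>.\<close>
  have "Str (oplax_of V (lax_of V M N G)) p = Str G p" for p
  proof -
    obtain a x y r where p: "p = (a, x, y, r)" by (metis surj_pair)
    show ?thesis
      using f_eq[of a x r y] ext(3)
      by (auto simp: p oplax_of_def lax_of_def restrict_def extensional_def hom_def)
  qed
  then show "oplax_of V (lax_of V M N G) = G"
    using assms by (intro mor.equality) (auto simp: lax_of_def)
qed

text \<open>Evaluation at the identity of \<rho>(a, x) recovers the lax structure on its carrier,
  and extensionality settles the other arguments.\<close>

lemma oplax_of_inj:
  assumes "is_lax_mor V F" "is_lax_mor V G" "Src F = Src G" "Trg F = Trg G" "oplax_of V F = oplax_of V G"
  shows "F = G"
proof -
  interpret F: lax_morphism V "Src G" "Trg G" "OMap F" "AMap F" "Str F"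
    using assms by (simp add: is_lax_mor_def)
  interpret G: lax_morphism V "Src G" "Trg G" "OMap G" "AMap G" "Str G"
    using assms by (simp add: is_lax_mor_def)
  have maps: "OMap F = OMap G" "AMap F = AMap G"
    using oplax_of_simps(3,4)[of V F] oplax_of_simps(3,4)[of V G] assms(5) by auto
  have "Str F (a, x) = Str G (a, x)" for a x
  proof (cases "a \<in> objs V \<and> x \<in> Obj (Src G)")
    case True
    let ?y = "rho (Src G) a x"
    have "Str (oplax_of V F) (a, x, ?y, Ide (Src G) ?y) = Str (oplax_of V G) (a, x, ?y, Ide (Src G) ?y)"
      using assms(5) by simp
    then show ?thesis
      using True F.lax_arr(2-) F.lax_arr(1) G.lax_arr by (simp add: oplax_of_def hom_def assms(3,4) flip: maps)
  next
    case False
    then show ?thesis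
      using F.ext(3) G.ext(3) by (auto simp: extensional_def)
  qed
  then show ?thesis
    using assms(3,4) maps by (intro mor.equality) (auto simp: fun_eq_iff)
qed

lemma bij_betw_oplax_of:
  assumes "vmodule V M" "vmodule V N"
  shows "bij_betw (oplax_of V) {F. is_lax_mor V F \<and> Src F = M \<and> Trg F = N}
    {G. is_oplax_mor V G \<and> Src G = dmod_of V M \<and> Trg G = dmod_of V N}"
proof (rule bij_betw_byWitness[where f' = "lax_of V M N"])
  show "\<forall>F \<in> {F. is_lax_mor V F \<and> Src F = M \<and> Trg F = N}. lax_of V M N (oplax_of V F) = F"
  proof clarify
    fix F assume F: "is_lax_mor V F" "M = Src F" "N = Trg F"
    have G: "is_oplax_mor V (oplax_of V F)" "Src (oplax_of V F) = dmod_of V M" "Trg (oplax_of V F) = dmod_of V N"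
      using F by (auto simp: is_oplax_mor_oplax_of)
    \<comment> \<open>The left inverse law follows from the right inverse law by
      injectivity.\<close>
    show "lax_of V (Src F) (Trg F) (oplax_of V F) = F"
      using oplax_of_lax_of[OF assms G] F
      by (intro oplax_of_inj[of V]) (auto simp: lax_of_def)
  qed
qed (use assms in \<open>auto simp: oplax_of_lax_of is_oplax_mor_oplax_of, auto simp: lax_of_def\<close>)

text \<open>A 2-cell and its image have the same components, so the inverse only exchanges the
  boundary.\<close>

lemma bij_betw_oplax_cell_of:
  assumes "is_lax_mor V F" "is_lax_mor V G" "parallel F G"
  shows "bij_betw (oplax_cell_of V) {s. is_lax_cell V s \<and> SrcC s = F \<and> TrgC s = G}
    {t. is_oplax_cell V t \<and> SrcC t = oplax_of V F \<and> TrgC t = oplax_of V G}"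
proof (rule bij_betw_byWitness[where f' = "\<lambda>t. \<lparr>SrcC = F, TrgC = G, At = At t\<rparr>"])
  have "is_lax_cell V \<lparr>SrcC = F, TrgC = G, At = At t\<rparr>"
    if "is_oplax_cell V t" "SrcC t = oplax_of V F" "TrgC t = oplax_of V G" for t
  proof -
    have "oplax_cell_of V \<lparr>SrcC = F, TrgC = G, At = At t\<rparr> = t"
      using that by (intro cell.equality) simp_all
    then show ?thesis
      using is_oplax_cell_oplax_cell_of[of V "\<lparr>SrcC = F, TrgC = G, At = At t\<rparr>"] assms that(1)
      by simp
  qed
  then show "(\<lambda>t. \<lparr>SrcC = F, TrgC = G, At = At t\<rparr>) `
      {t. is_oplax_cell V t \<and> SrcC t = oplax_of V F \<and> TrgC t = oplax_of V G}
    \<subseteq> {s. is_lax_cell V s \<and> SrcC s = F \<and> TrgC s = G}"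
    by auto
  show "oplax_cell_of V ` {s. is_lax_cell V s \<and> SrcC s = F \<and> TrgC s = G}
    \<subseteq> {t. is_oplax_cell V t \<and> SrcC t = oplax_of V F \<and> TrgC t = oplax_of V G}"
    using assms by (auto simp: is_oplax_cell_oplax_cell_of)
qed (auto simp: oplax_cell_of_def)

section \<open>Reconstructing a module from universal elements\<close>

section \<open>Left representable \<open>\<delta>\<close>modules\<close>

text \<open>
  The element \<open>u a x \<in> R(a, x; \<rho>(a, x))\<close> corresponds to the identity under a representation, so every
  element of \<open>R(a, x; y)\<close> is \<open>k\<^sub>* (u a x)\<close> for a unique \<open>k : \<rho>(a, x) \<rightarrow> y\<close>.
\<close>

locale universal_elements = dmodule V M + power_action V M act act_map
  for V :: "('v, 'w) omcat" and M :: "('v, 'w, 'o, 'a) dmod" (structure)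
    and act :: "'v list \<Rightarrow> 'o \<Rightarrow> 'o" and act_map :: "'w list \<Rightarrow> 'a \<Rightarrow> 'a" +
  fixes u :: "'v list \<Rightarrow> 'o \<Rightarrow> 'a"
  assumes u_in [simp]: "a \<in> objs V \<Longrightarrow> x \<in> Obj M \<Longrightarrow> u a x \<in> Rset M a x (act a x)"
    and u_universal: "a \<in> objs V \<Longrightarrow> x \<in> Obj M \<Longrightarrow> y \<in> Obj M \<Longrightarrow> r \<in> Rset M a x y \<Longrightarrow>
          \<exists>!k. k \<in> hom M (act a x) y \<and> Rmap M (ides V a) (Ide M x) k (u a x) = r"
    and u_natural: "fs \<in> arrs V \<Longrightarrow> f \<in> Arr M \<Longrightarrow>
          Rmap M fs f (Ide M (act (cods V fs) (Cod M f))) (u (cods V fs) (Cod M f)) =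
          Rmap M (ides V (doms V fs)) (Ide M (Dom M f)) (act_map fs f) (u (doms V fs) (Dom M f))"
begin

definition elt :: "'v list \<Rightarrow> 'o \<Rightarrow> 'a \<Rightarrow> 'a" where
  "elt a x k = Rmap M (ides V a) (Ide M x) k (u a x)"

definition rep :: "'v list \<Rightarrow> 'o \<Rightarrow> 'o \<Rightarrow> 'a \<Rightarrow> 'a" where
  "rep a x y r = (THE k. k \<in> hom M (act a x) y \<and> elt a x k = r)"

lemma elt_in [simp]:
  assumes "a \<in> objs V" "x \<in> Obj M" "k \<in> Arr M" "Dom M k = act a x" "Cod M k = y"
  shows "elt a x k \<in> Rset M a x y"
  using assms by (simp add: elt_def)

text \<open>The uniqueness half of universality, through which equations between arrows out of
  \<open>act a x\<close> are proved inside R.\<close>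

lemma elt_inj:
  assumes "elt a x k = elt a x l" "a \<in> objs V" "x \<in> Obj M" "k \<in> Arr M" "l \<in> Arr M"
    "Dom M k = act a x" "Dom M l = act a x" "Cod M k = Cod M l"
  shows "k = l"
  using u_universal[of a x "Cod M k" "elt a x k"] assms by (auto simp: hom_def elt_def)

lemma rep [simp]:
  assumes "a \<in> objs V" "x \<in> Obj M" "y \<in> Obj M" "r \<in> Rset M a x y"
  shows "rep a x y r \<in> Arr M" "Dom M (rep a x y r) = act a x" "Cod M (rep a x y r) = y"
    "elt a x (rep a x y r) = r"
  using theI'[OF u_universal[OF assms]] by (auto simp: rep_def elt_def hom_def)

lemma rep_elt [simp]:
  assumes "a \<in> objs V" "x \<in> Obj M" "k \<in> Arr M" "Dom M k = act a x" "Cod M k = y"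
  shows "rep a x y (elt a x k) = k"
proof -
  have "y \<in> Obj M"
    using assms by auto
  then show ?thesis
    using assms by - (rule elt_inj[of a x], simp_all)
qed

definition module :: "('v, 'w, 'o, 'a) vmod" where
  "module = \<lparr>Obj = Obj M, Arr = Arr M, Dom = Dom M, Cod = Cod M, Ide = Ide M, Comp = Comp M,
     rho = act, rho_map = act_map,
     rho_split = (\<lambda>a b a' x. rep (a @ b @ a') x (act (a @ omega V b # a') x)
       (Ralpha M a b a' x (act (a @ omega V b # a') x) (u (a @ omega V b # a') x))),
     rho_nest = (\<lambda>a b x. rep (a @ b) x (act a (act b x))
       (Rbeta M a b x (act b x) (act a (act b x)) (u a (act b x)) (u b x))),
     rho_counit = (\<lambda>x. rep [] x x (Riota M x x (Ide M x)))\<rparr>"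

lemma module_simps [simp]:
  "Obj module = Obj M" "Arr module = Arr M" "Dom module = Dom M" "Cod module = Cod M"
  "Ide module = Ide M" "Comp module = Comp M" "rho module = act" "rho_map module = act_map"
  by (simp_all add: module_def)

lemma hom_module [simp]: "hom module = hom M"
  by (simp add: hom_def fun_eq_iff)

lemma category_module: "category module"
  using M.category_axioms by (simp add: category_def)

lemma module_split [simp]:
  assumes "a \<in> objs V" "b \<in> objs V" "a' \<in> objs V" "x \<in> Obj M"
  shows "rho_split module a b a' x \<in> Arr M" "Dom M (rho_split module a b a' x) = act (a @ b @ a') x"
    "Cod M (rho_split module a b a' x) = act (a @ omega V b # a') x"
  using assms by (simp_all add: module_def)

lemma elt_split:
  assumes "a \<in> objs V" "b \<in> objs V" "a' \<in> objs V" "x \<in> Obj M"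
  shows "elt (a @ b @ a') x (rho_split module a b a' x) =
       Ralpha M a b a' x (act (a @ omega V b # a') x) (u (a @ omega V b # a') x)"
  using assms by (simp_all add: module_def)

lemma module_nest [simp]:
  assumes "a \<in> objs V" "b \<in> objs V" "x \<in> Obj M"
  shows "rho_nest module a b x \<in> Arr M" "Dom M (rho_nest module a b x) = act (a @ b) x"
    "Cod M (rho_nest module a b x) = act a (act b x)"
  using assms by (simp_all add: module_def)

lemma elt_nest:
  assumes "a \<in> objs V" "b \<in> objs V" "x \<in> Obj M"
  shows "elt (a @ b) x (rho_nest module a b x) =
       Rbeta M a b x (act b x) (act a (act b x)) (u a (act b x)) (u b x)"
  using assms by (simp_all add: module_def)

lemma module_counit [simp]:
  assumes "x \<in> Obj M"
  shows "rho_counit module x \<in> Arr M" "Dom M (rho_counit module x) = act [] x"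
    "Cod M (rho_counit module x) = x"
  using assms by (simp_all add: module_def)

lemma elt_counit:
  assumes "x \<in> Obj M"
  shows "elt [] x (rho_counit module x) = Riota M x x (Ide M x)"
  using assms by (simp_all add: module_def)

text \<open>In terms of \<open>elt\<close>, the action and the maps \<alpha>, \<beta>, \<iota> of
  \<open>M\<close> follow the formulas of \<open>dmod_of V module\<close>; this rule covers the
  action, and \<open>Ralpha_elt\<close>, \<open>Rbeta_elt\<close> and \<open>Riota_elt\<close> the
  rest.\<close>

lemma Rmap_elt:
  assumes "fs \<in> arrs V" "f \<in> Arr M" "g \<in> Arr M" "k \<in> Arr M" "Dom M k = act (cods V fs) (Cod M f)"
    "Cod M k = Dom M g" "cods V fs = a" "Cod M f = x"
  shows "Rmap M fs f g (elt a x k) = elt (doms V fs) (Dom M f) (g \<cdot> (k \<cdot> act_map fs f))"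
proof -
  obtain a' where a': "doms V fs = a'" "a' \<in> objs V" "a \<in> objs V"
    using assms V.doms_cods_objs[of fs] by auto
  have "x \<in> Obj M"
    using assms by auto
  then have "Rmap M fs f g (elt a x k) = Rmap M fs f (g \<cdot> k) (u a x)"
    using assms a' by (simp add: elt_def Rmap_comp)
  \<comment> \<open>The pull-back along \<open>fs\<close>, \<open>f\<close> is separated from the
    push-forward, so that \<open>u_natural\<close> can turn it into a push-forward along
    \<open>act_map fs f\<close>.\<close>
  also have "\<dots> = Rmap M (ides V a') (Ide M (Dom M f)) (g \<cdot> k) (Rmap M fs f (Ide M (act a x)) (u a x))"
    using assms a' \<open>x \<in> Obj M\<close> by (simp add: Rmap_comp)
  also have "\<dots> = Rmap M (ides V a') (Ide M (Dom M f)) (g \<cdot> k)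
      (Rmap M (ides V a') (Ide M (Dom M f)) (act_map fs f) (u a' (Dom M f)))"
    using u_natural[of fs f] assms a' by simp
  also have "\<dots> = elt a' (Dom M f) (g \<cdot> (k \<cdot> act_map fs f))"
    using assms a' by (simp add: elt_def Rmap_ides_comp M.assoc)
  finally show ?thesis
    using a' by simp
qed

lemma elt_comp:
  assumes "a \<in> objs V" "x \<in> Obj M" "k \<in> Arr M" "l \<in> Arr M" "Dom M k = act a x" "Dom M l = Cod M k"
  shows "elt a x (l \<cdot> k) = Rmap M (ides V a) (Ide M x) l (elt a x k)"
  using assms by (simp add: Rmap_elt)

text \<open>Naturality of \<alpha> in the last variable reduces the claim to universal elements. The
  list \<open>l\<close> is a variable with an equation so that the rule also matches lists that have
  been rebracketed.\<close>

lemma Ralpha_elt: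
  assumes "a \<in> objs V" "b \<in> objs V" "a' \<in> objs V" "x \<in> Obj M" "k \<in> Arr M" "Dom M k = act l x"
    "Cod M k = y" "l = a @ omega V b # a'"
  shows "Ralpha M a b a' x y (elt l x k) = elt (a @ b @ a') x (k \<cdot> rho_split module a b a' x)"
proof -
  have "y \<in> Obj M"
    using assms by auto
  then show ?thesis
    using assms alpha_natural[of "ides V a" "ides V b" "ides V a'" "Ide M x" x x k "act l x" y "u l x"]
    by (simp add: elt_comp elt_split hom_def) (simp add: elt_def)
qed

text \<open>Extranaturality moves \<open>l\<close> from the second argument of \<beta> to the first,
  and naturality then pulls the whole push-forward out, leaving \<beta> at two universal
  elements.\<close>

lemma Rbeta_elt:
  assumes "a \<in> objs V" "b \<in> objs V" "x \<in> Obj M" "m \<in> Obj M" "k \<in> Arr M" "l \<in> Arr M"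
    "Dom M k = act a m" "Cod M k = y" "Dom M l = act b x" "Cod M l = m"
  shows "Rbeta M a b x m y (elt a m k) (elt b x l) =
    elt (a @ b) x (k \<cdot> (act_map (ides V a) l \<cdot> rho_nest module a b x))"
proof -
  let ?m = "act b x"
  have y: "y \<in> Obj M"
    using assms by auto
  have "Rbeta M a b x m y (elt a m k) (elt b x l) =
      Rbeta M a b x ?m y (Rmap M (ides V a) l (Ide M y) (elt a m k)) (u b x)"
    using assms y beta_extranatural[of a b x l ?m m y "elt a m k" "u b x"]
    by (simp add: hom_def) (simp add: elt_def)
  also have "\<dots> = Rbeta M a b x ?m y (elt a ?m (k \<cdot> act_map (ides V a) l)) (u b x)"
    using assms y by (simp add: Rmap_elt)
  also have "\<dots> = Rmap M (ides V (a @ b)) (Ide M x) (k \<cdot> act_map (ides V a) l)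
      (Rbeta M a b x ?m (act a ?m) (u a ?m) (u b x))"
    using assms y beta_natural[of "ides V a" "ides V b" "Ide M x" x x ?m "k \<cdot> act_map (ides V a) l" "act a ?m" y
        "u a ?m" "u b x"]
    by (simp add: hom_def elt_def)
  also have "\<dots> = elt (a @ b) x (k \<cdot> (act_map (ides V a) l \<cdot> rho_nest module a b x))"
    using assms y elt_comp[of "a @ b" x "rho_nest module a b x" "k \<cdot> act_map (ides V a) l"]
    by (simp add: elt_nest M.assoc)
  finally show ?thesis .
qed

lemma Riota_elt:
  assumes "g \<in> Arr M" "Dom M g = x" "Cod M g = y"
  shows "Riota M x y g = elt [] x (g \<cdot> rho_counit module x)"
  using assms elt_comp[of "[]" x "rho_counit module x" g] iota_natural[of "Ide M x" x x "Ide M x" x g y]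
    M.dom_cod_obj[of g]
  by (simp add: elt_counit hom_def)

lemmas elts = Rmap_elt Ralpha_elt Rbeta_elt Riota_elt M.assoc

lemma vmodule_module: "vmodule V module"
proof (intro vmodule.intro vmodule_axioms.intro, goal_cases)
  case 1
  show ?case by (rule V.oplax_monoidal_axioms)
next
  case 2
  show ?case by (rule category_module)
next
  case (3 n)
  show ?case
    using act_functor[of n] by (simp add: cat_functor_def cat_functor_axioms_def prod_cat_def category_module)
next
  case (4 a b a' x)
  then show ?case by (simp add: hom_def)
next
  case (5 fs gs fs' f x y)
  then have "f \<in> Arr M" "Dom M f = x" "Cod M f = y" "x \<in> Obj M" "y \<in> Obj M"
    by (auto simp: hom_def)
  moreover let ?l = "cods V fs @ omega V (cods V gs) # cods V fs'"
  let ?y = "act ?l y"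
  have "Ide M ?y \<in> hom M ?y ?y"
    using 5 calculation by (simp add: hom_def)
  \<comment> \<open>The universal element is entered as \<open>elt\<close> of an identity, the form
    on which the rules \<open>elts\<close> operate; the later cases do the same.\<close>
  ultimately show ?case
    using 5 alpha_natural[of fs gs fs' f x y "Ide M ?y" ?y ?y "elt ?l y (Ide M ?y)"]
    by - (rule elt_inj[of "doms V (fs @ gs @ fs')" x], simp_all add: elts hom_def)
next
  case (6 a b x)
  then show ?case by (simp add: hom_def)
next
  case (7 fs gs f x y)
  then have "f \<in> Arr M" "Dom M f = x" "Cod M f = y" "x \<in> Obj M" "y \<in> Obj M"
    by (auto simp: hom_def)
  moreover obtain a a' b b' where "doms V fs = a" "cods V fs = a'" "doms V gs = b" "cods V gs = b'"
    by blast
  moreover have "a \<in> objs V" "a' \<in> objs V" "b \<in> objs V" "b' \<in> objs V"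
    using 7 calculation V.doms_cods_objs[of fs] V.doms_cods_objs[of gs] by auto
  \<comment> \<open>The identity at the middle object that \<open>beta_natural\<close> leaves behind
    is absorbed into the action of \<open>fs\<close>.\<close>
  moreover have "act_map fs (Ide M (act b' y)) \<cdot> (act_map (ides V a) (act_map gs f) \<cdot> rho_nest module a b x) =
      act_map fs (act_map gs f) \<cdot> rho_nest module a b x"
    using 7 calculation by (simp add: act_map_ides_right flip: M.assoc)
  ultimately show ?case
    using 7 beta_natural[of fs gs f x y "act b' y" "Ide M (act a' (act b' y))" "act a' (act b' y)" "act a' (act b' y)"
      "elt a' (act b' y) (Ide M (act a' (act b' y)))" "elt b' y (Ide M (act b' y))"]
    by - (rule elt_inj[of "a @ b" x], simp_all add: elts hom_def)
next
  case (8 x)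
  then show ?case by (simp add: hom_def)
next
  case (9 f x y)
  then have "f \<in> Arr M" "Dom M f = x" "Cod M f = y" "x \<in> Obj M" "y \<in> Obj M"
    by (auto simp: hom_def)
  then show ?case
    using iota_natural[of f x y "Ide M y" y "Ide M y" y]
    by - (rule elt_inj[of "[]" x], simp_all add: elts hom_def)
next
  case (10 a x)
  \<comment> \<open>Identity lists of \<open>[]\<close> and of concatenations are unfolded before
    \<open>act_obj\<close> can match, hence its explicit instances here and below.\<close>
  then show ?case
    using beta_iota_left[of a x "elt a x (Ide M (act a x))" "act a x" "Ide M (act a x)" "act a x"]
      act_obj(2)[of "[]" "act a x"]
    by - (rule elt_inj[of a x], simp_all add: elts hom_def)
next
  case (11 a x)
  then show ?case
    using beta_iota_right[of a "act a x" "elt a x (Ide M (act a x))" x "Ide M x" x]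
    by - (rule elt_inj[of a x], simp_all add: elts hom_def)
next
  case (12 a v a' x)
  then show ?case
    using alpha_counit[of a v a' x "act (a @ v # a') x" "elt (a @ v # a') x (Ide M (act (a @ v # a') x))"]
    by - (rule elt_inj[of "a @ v # a'" x], simp_all add: elts hom_def)
next
  case (13 a b a' c x)
  let ?y = "act (a @ omega V b # a') (act c x)"
  show ?case
    using 13 beta_alpha_left[of a b a' c x "act c x" ?y "elt (a @ omega V b # a') (act c x) (Ide M ?y)"
      "elt c x (Ide M (act c x))"]
      act_obj(2)[of "a @ omega V b # a'" "act c x"] act_obj(2)[of "a @ b @ a'" "act c x"]
    by - (rule elt_inj[of "a @ b @ a' @ c" x], simp_all add: elts hom_def)
next
  case (14 a b c d e x)
  let ?l = "a @ omega V b # c @ omega V d # e"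
  show ?case
    using 14 alpha_parallel[of a b c d e x "act ?l x" "elt ?l x (Ide M (act ?l x))"]
    by - (rule elt_inj[of "a @ b @ c @ d @ e" x], simp_all add: elts hom_def)
next
  case (15 a b c b' x)
  let ?m = "act (b @ omega V c # b') x"
  show ?case
    using 15 beta_alpha_right[of a b c b' x ?m "act a ?m" "elt a ?m (Ide M (act a ?m))"
      "elt (b @ omega V c # b') x (Ide M ?m)"]
    by - (rule elt_inj[of "a @ b @ c @ b'" x], simp_all add: elts hom_def)
next
  case (16 a b c x)
  let ?l = "act c x" let ?m = "act b ?l" let ?y = "act a ?m"
  show ?case
    using 16 beta_assoc[of a b c x ?l ?m ?y "elt a ?m (Ide M ?y)" "elt b ?l (Ide M ?m)" "elt c x (Ide M ?l)"]
      act_obj(2)[of "a @ b" ?l]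
    by - (rule elt_inj[of "a @ b @ c" x], simp_all add: elts hom_def)
next
  case (17 a b c b' a' x)
  let ?l = "a @ omega V (b @ omega V c # b') # a'"
  show ?case
    using 17 alpha_nested[of a b c b' a' x "act ?l x" "elt ?l x (Ide M (act ?l x))"]
    by - (rule elt_inj[of "a @ b @ c @ b' @ a'" x], simp_all add: elts hom_def)
qed

definition elt_mor :: "('v, 'w, 'o, 'a) oplax_mor" where
  "elt_mor = \<lparr>Src = dmod_of V module, Trg = M, OMap = restrict id (Obj M), AMap = restrict id (Arr M),
     Str = restrict (\<lambda>(a, x, y, k). elt a x k) (R_elements V (dmod_of V module))\<rparr>"

definition rep_mor :: "('v, 'w, 'o, 'a) oplax_mor" where
  "rep_mor = \<lparr>Src = M, Trg = dmod_of V module, OMap = restrict id (Obj M), AMap = restrict id (Arr M),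
     Str = restrict (\<lambda>(a, x, y, r). rep a x y r) (R_elements V M)\<rparr>"

lemma dmodule_module: "dmodule V (dmod_of V module)"
  by (rule vmodule.dmodule_dmod_of[OF vmodule_module])

lemma is_oplax_mor_elt_mor: "is_oplax_mor V elt_mor"
proof -
  have "cat_functor (dmod_of V module) M (restrict id (Obj M)) (restrict id (Arr M))"
    by (rule cat_functorI) (auto simp: category_module M.category_axioms)
  then show ?thesis
    unfolding is_oplax_mor_def elt_mor_def mor.simps
    by (intro oplax_functorI)
      (use dmodule_module dmodule_axioms in \<open>simp_all add: elts hom_def\<close>)
qed

lemma is_oplax_mor_rep_mor: "is_oplax_mor V rep_mor"
proof -
  have F: "cat_functor M (dmod_of V module) (restrict id (Obj M)) (restrict id (Arr M))"
    by (rule cat_functorI) (auto simp: category_module M.category_axioms)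
  \<comment> \<open>Replacing arbitrary elements by values of \<open>elt\<close> turns the laws for
    \<open>rep\<close> into the rules \<open>elts\<close> followed by
    \<open>rep_elt\<close>.\<close>
  have repE: "\<exists>k. r = elt a x k \<and> k \<in> Arr M \<and> Dom M k = act a x \<and> Cod M k = y"
    if "a \<in> objs V" "x \<in> Obj M" "y \<in> Obj M" "r \<in> Rset M a x y" for a x y r
    using that by (intro exI[of _ "rep a x y r"]) simp
  show ?thesis
    unfolding is_oplax_mor_def rep_mor_def mor.simps
  proof (intro oplax_functorI, goal_cases)
    case 1
    show ?case by (rule dmodule_axioms)
  next
    case 2
    show ?case by (rule dmodule_module)
  next
    case 3
    show ?case by (rule F)
  next
    case (7 a x y r)
    then show ?case by (simp add: hom_def)
  next
    case (8 hs h k r)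
    then obtain l where "r = elt (cods V hs) (Cod M h) l" "l \<in> Arr M" "Dom M l = act (cods V hs) (Cod M h)"
      "Cod M l = Dom M k"
      using repE[of "cods V hs" "Cod M h" "Dom M k" r] by auto
    then show ?case
      using 8 by (simp add: elts)
  next
    case (9 g)
    then show ?case by (simp add: elts)
  next
    case (10 a b a' x y r)
    then obtain l where "r = elt (a @ omega V b # a') x l" "l \<in> Arr M" "Dom M l = act (a @ omega V b # a') x"
      "Cod M l = y"
      using repE[of "a @ omega V b # a'" x y r] by auto
    then show ?case
      using 10 by (simp add: elts)
  next
    case (11 a b x m y r s)
    then obtain k l where "r = elt a m k" "k \<in> Arr M" "Dom M k = act a m" "Cod M k = y"
      "s = elt b x l" "l \<in> Arr M" "Dom M l = act b x" "Cod M l = m"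
      using repE[of a m y r] repE[of b x m s] by auto
    then show ?case
      using 11 by (simp add: elts)
  qed simp_all
qed

text \<open>Both underlying functors are restricted identities and \<open>elt\<close>,
  \<open>rep\<close> are inverse on elements, so the 1-cells are inverse as a strict equality, which
  the 2-natural isomorphism demands.\<close>

lemma elt_rep_mor: "comp_oplax V elt_mor rep_mor = id_oplax V M"
  by (auto simp: comp_oplax_def elt_mor_def rep_mor_def id_oplax_def fun_eq_iff restrict_def hom_def)

lemma rep_elt_mor: "comp_oplax V rep_mor elt_mor = id_oplax V (dmod_of V module)"
  by (auto simp: comp_oplax_def elt_mor_def rep_mor_def id_oplax_def fun_eq_iff restrict_def hom_def)

end

text \<open>The representations are given separately for each n. They are glued along the length of
  the list, after which the universal elements come from the Yoneda argument.\<close>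

lemma left_representable_universal_elements:
  assumes "dmodule V M" "left_representable V M"
  obtains act act_map u where "universal_elements V M act act_map u"
proof -
  interpret dmodule V M by fact
  obtain \<rho>o \<rho>a \<phi> where functors: "\<And>n. cat_functor (prod_cat (pow_cat V n) M) M (\<rho>o n) (\<rho>a n)"
    and iso: "\<And>n. set_nat_iso (dist_cat V M n)
          (\<lambda>((a, x), y). Rset M a x y) (\<lambda>((fs, f), g). Rmap M fs f g)
          (\<lambda>(p, y). hom M (\<rho>o n p) y) (\<lambda>(h, g) r. g \<cdot>\<^bsub>M\<^esub> r \<cdot>\<^bsub>M\<^esub> \<rho>a n h) (\<phi> n)"
    using assms(2) unfolding left_representable_def by metis
  \<comment> \<open>The length of the list selects the representing functor;
    \<open>pow_cat V n\<close> contains only lists of length n, so functoriality for each n carries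
    over.\<close>
  define act where "act a x = \<rho>o (length a) (a, x)" for a x
  define act_map where "act_map fs f = \<rho>a (length fs) (fs, f)" for fs f
  interpret power_action V M act act_map
  proof (intro power_action.intro power_action_axioms.intro V.category_axioms M.category_axioms)
    fix n
    show "cat_functor (prod_cat (pow_cat V n) M) M (\<lambda>(a, x). act a x) (\<lambda>(fs, f). act_map fs f)"
      using functors[of n]
      by (auto simp: cat_functor_def cat_functor_axioms_def act_def act_map_def hom_def
          V.map2_comp_arrs)
  qed
  have bij: "bij_betw (\<phi> (length a) ((a, x), y)) (Rset M a x y) (hom M (act a x) y)"
    if "a \<in> objs V" "x \<in> Obj M" "y \<in> Obj M" for a x y
    using set_nat_iso.bijective[OF iso[of "length a"], of "((a, x), y)"] that
    by (simp add: act_def dist_cat_def)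
  have natural: "\<phi> (length fs) ((doms V fs, Dom M f), Cod M g) (Rmap M fs f g r) =
      g \<cdot>\<^bsub>M\<^esub> \<phi> (length fs) ((cods V fs, Cod M f), Dom M g) r \<cdot>\<^bsub>M\<^esub> act_map fs f"
    if "fs \<in> arrs V" "f \<in> Arr M" "g \<in> Arr M" "r \<in> Rset M (cods V fs) (Cod M f) (Dom M g)" for fs f g r
    using set_nat_iso.set_naturality[OF iso[of "length fs"], of "((fs, f), g)"
        "((cods V fs, Cod M f), Dom M g)" "((doms V fs, Dom M f), Cod M g)" r] that
    by (simp add: act_map_def dist_cat_def hom_def)
  define u where "u a x = the_inv_into (Rset M a x (act a x)) (\<phi> (length a) ((a, x), act a x)) (Ide M (act a x))" for a x
  have u: "u a x \<in> Rset M a x (act a x)" "\<phi> (length a) ((a, x), act a x) (u a x) = Ide M (act a x)"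
    if "a \<in> objs V" "x \<in> Obj M" for a x
  proof -
    have "Ide M (act a x) \<in> \<phi> (length a) ((a, x), act a x) ` Rset M a x (act a x)"
      "inj_on (\<phi> (length a) ((a, x), act a x)) (Rset M a x (act a x))"
      using bij[of a x "act a x"] that by (auto simp: bij_betw_def hom_def)
    then show "u a x \<in> Rset M a x (act a x)" "\<phi> (length a) ((a, x), act a x) (u a x) = Ide M (act a x)"
      unfolding u_def by (auto intro: the_inv_into_into f_the_inv_into_f)
  qed
  \<comment> \<open>Naturality at the preimage of the identity shows that pushing \<open>u\<close>
    along \<open>k\<close> inverts \<open>\<phi>\<close>; both existence and uniqueness of the
    factorization follow.\<close>
  have \<phi>_push: "\<phi> (length a) ((a, x), Cod M k) (Rmap M (ides V a) (Ide M x) k (u a x)) = k"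
    if "a \<in> objs V" "x \<in> Obj M" "k \<in> Arr M" "Dom M k = act a x" for a x k
    using natural[of "ides V a" "Ide M x" k "u a x"] that u by simp
  have inj: "r = s" if "\<phi> (length a) ((a, x), y) r = \<phi> (length a) ((a, x), y) s"
    "a \<in> objs V" "x \<in> Obj M" "y \<in> Obj M" "r \<in> Rset M a x y" "s \<in> Rset M a x y" for a x y r s
    using bij[of a x y] that by (auto simp: bij_betw_def dest: inj_onD)
  have "universal_elements V M act act_map u"
  proof (intro universal_elements.intro universal_elements_axioms.intro dmodule_axioms
      power_action_axioms)
    fix a x y r assume *: "a \<in> objs V" "x \<in> Obj M" "y \<in> Obj M" "r \<in> Rset M a x y"
    let ?k = "\<phi> (length a) ((a, x), y) r"
    have k: "?k \<in> Arr M" "Dom M ?k = act a x" "Cod M ?k = y"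
      using bij_betwE[OF bij[OF *(1-3)]] *(4) by (auto simp: hom_def)
    show "\<exists>!k. k \<in> hom M (act a x) y \<and> Rmap M (ides V a) (Ide M x) k (u a x) = r"
    proof (rule ex1I[of _ ?k])
      show "?k \<in> hom M (act a x) y \<and> Rmap M (ides V a) (Ide M x) ?k (u a x) = r"
        using * k u \<phi>_push[of a x ?k] inj[of a x y "Rmap M (ides V a) (Ide M x) ?k (u a x)" r]
        by (simp add: hom_def)
      show "k = ?k" if "k \<in> hom M (act a x) y \<and> Rmap M (ides V a) (Ide M x) k (u a x) = r" for k
        using that * \<phi>_push[of a x k] by (auto simp: hom_def)
    qed
  next
    fix fs f assume *: "fs \<in> arrs V" "f \<in> Arr M"
    obtain a b where a: "doms V fs = a" "cods V fs = b" by blast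
    have ab: "a \<in> objs V" "b \<in> objs V" "length a = length fs" "length b = length fs"
      using a *(1) V.doms_cods_objs[of fs] by auto
    \<comment> \<open>Under \<open>\<phi>\<close> both sides become \<open>act_map fs f\<close>: the
      left one by naturality, the right one by \<open>\<phi>_push\<close>.\<close>
    have "Rmap M fs f (Ide M (act b (Cod M f))) (u b (Cod M f)) =
        Rmap M (ides V a) (Ide M (Dom M f)) (act_map fs f) (u a (Dom M f))"
    proof (rule inj[of a "Dom M f" "act b (Cod M f)"])
      show "\<phi> (length a) ((a, Dom M f), act b (Cod M f)) (Rmap M fs f (Ide M (act b (Cod M f))) (u b (Cod M f))) =
          \<phi> (length a) ((a, Dom M f), act b (Cod M f))
            (Rmap M (ides V a) (Ide M (Dom M f)) (act_map fs f) (u a (Dom M f)))"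
        using natural[of fs f "Ide M (act b (Cod M f))" "u b (Cod M f)"] \<phi>_push[of a "Dom M f" "act_map fs f"]
          u[of b "Cod M f"] * a ab by simp
    qed (use * a ab u in simp_all)
    then show "Rmap M fs f (Ide M (act (cods V fs) (Cod M f))) (u (cods V fs) (Cod M f)) =
          Rmap M (ides V (doms V fs)) (Ide M (Dom M f)) (act_map fs f) (u (doms V fs) (Dom M f))"
      using a by simp
  qed (use u in simp)
  then show thesis
    by (rule that)
qed

lemma left_representable_iso_dmod_of:
  assumes "dmodule V M" "left_representable V M"
  obtains N E E' where "vmodule V N" "is_oplax_mor V E" "Src E = dmod_of V N" "Trg E = M"
    "is_oplax_mor V E'" "Src E' = M" "Trg E' = dmod_of V N"
    "comp_oplax V E E' = id_oplax V M" "comp_oplax V E' E = id_oplax V (dmod_of V N)"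
proof -
  obtain act act_map u where "universal_elements V M act act_map u"
    using left_representable_universal_elements[OF assms] .
  then interpret universal_elements V M act act_map u .
  show thesis
    by (rule that[OF vmodule_module is_oplax_mor_elt_mor _ _ is_oplax_mor_rep_mor _ _ elt_rep_mor rep_elt_mor])
      (simp_all add: elt_mor_def rep_mor_def)
qed

section \<open>Corestriction to left representables and the 2-equivalence\<close>

section \<open>The 2-equivalence\<close>

text \<open>The full sub-2-category keeps the operations, so the functor laws carry over once the
  images of modules are known to be left representable.\<close>

lemma two_functor_dmod_of_left_representable:
  "two_functor (Vmod_lax V) (full_sub_two_cat (left_representable V) (Vdmod_oplax V))
     (dmod_of V) (oplax_of V) (oplax_cell_of V)"
proof -
  interpret two_functor "Vmod_lax V" "Vdmod_oplax V" "dmod_of V" "oplax_of V" "oplax_cell_of V"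
    by (rule two_functor_dmod_of)
  let ?T = "full_sub_two_cat (left_representable V) (Vdmod_oplax V)"
  have T: "two_category ?T"
    by (rule T.two_category_full_sub)
  note T' = two_category.one_category[OF T] two_category.vert_category[OF T] two_category.horiz_category[OF T]
  have id1: "oplax_of V (id1 (Vmod_lax V) M) = id1 (Vdmod_oplax V) (dmod_of V M)"
    if "M \<in> Ob0 (Vmod_lax V)" for M
    using one.functor_ide[of M] that by (simp add: two_cat_simps)
  have rep: "left_representable V (dmod_of V M)" if "M \<in> Ob0 (Vmod_lax V)" for M
    using that by (simp add: Vmod_lax_simps vmodule.left_representable_dmod_of)
  show ?thesis
  proof (intro two_functor.intro two_functor_axioms.intro S.two_category_axioms T)
    show "cat_functor (one_cat (Vmod_lax V)) (one_cat ?T) (dmod_of V) (oplax_of V)"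
      using T' S.mor1 one.functor_arr one.functor_comp_arr one.functor_ide map_obj
      by (intro cat_functorI) (auto simp: S.one_category full_sub_two_cat_def two_cat_simps rep)
    show "cat_functor (vert_cat (Vmod_lax V)) (vert_cat ?T) (oplax_of V) (oplax_cell_of V)"
      by (intro cat_functorI) (use T' in \<open>auto simp: S.vert_category full_sub_two_cat_def two_cat_simps rep\<close>)
    show "cat_functor (horiz_cat (Vmod_lax V)) (horiz_cat ?T) (dmod_of V) (oplax_cell_of V)"
      using T' horiz.functor_comp_arr horiz.functor_ide
      by (intro cat_functorI) (auto simp: S.horiz_category full_sub_two_cat_def two_cat_simps rep id1)
  qed
qed

theorem mainTheorem2:
  fixes V :: "('v, 'w) omcat"
  assumes "oplax_monoidal V"
  shows "two_functor
           (Vmod_lax V :: (('v, 'w, 'o, 'a) vmod, ('v, 'w, 'o, 'a) lax_mor,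
                           ('v, 'w, 'o, 'a) lax_cell) two_cat)
           (Vdmod_oplax V) (dmod_of V) (oplax_of V) (oplax_cell_of V) \<and>
         two_equivalence
           (Vmod_lax V :: (('v, 'w, 'o, 'a) vmod, ('v, 'w, 'o, 'a) lax_mor,
                           ('v, 'w, 'o, 'a) lax_cell) two_cat)
           (full_sub_two_cat (left_representable V) (Vdmod_oplax V))
           (dmod_of V) (oplax_of V) (oplax_cell_of V)"
proof (intro conjI two_functor_dmod_of two_equivalenceI two_functor_dmod_of_left_representable)
  let ?S = "Vmod_lax V :: (('v, 'w, 'o, 'a) vmod, ('v, 'w, 'o, 'a) lax_mor, ('v, 'w, 'o, 'a) lax_cell) two_cat"
  let ?T = "full_sub_two_cat (left_representable V) (Vdmod_oplax V) ::
    (('v, 'w, 'o, 'a) dmod, ('v, 'w, 'o, 'a) oplax_mor, ('v, 'w, 'o, 'a) oplax_cell) two_cat"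
  note simps = two_cat_simps full_sub_two_cat_def Vmod_lax_simps Vdmod_oplax_simps
  show "bij_betw (oplax_of V) (hom (one_cat ?S) M N) (hom (one_cat ?T) (dmod_of V M) (dmod_of V N))"
    if "M \<in> Ob0 ?S" "N \<in> Ob0 ?S" for M N
  proof -
    have "vmodule V M" "vmodule V N"
      using that by (auto simp: simps)
    \<comment> \<open>Both \<delta>modules lie in the full sub-2-category, so its 1-cells between
      them are all the oplax functors.\<close>
    then have "hom (one_cat ?S) M N = {F. is_lax_mor V F \<and> Src F = M \<and> Trg F = N}"
      "hom (one_cat ?T) (dmod_of V M) (dmod_of V N) =
        {G. is_oplax_mor V G \<and> Src G = dmod_of V M \<and> Trg G = dmod_of V N}"
      by (auto simp: hom_def simps vmodule.left_representable_dmod_of)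
    then show ?thesis
      using bij_betw_oplax_of[OF \<open>vmodule V M\<close> \<open>vmodule V N\<close>] by simp
  qed
  show "bij_betw (oplax_cell_of V) (hom (vert_cat ?S) F G) (hom (vert_cat ?T) (oplax_of V F) (oplax_of V G))"
    if "F \<in> Mor1 ?S" "G \<in> Mor1 ?S" "src1 ?S F = src1 ?S G" "trg1 ?S F = trg1 ?S G" for F G
  proof -
    have FG: "is_lax_mor V F" "is_lax_mor V G" "parallel F G"
      using that by (auto simp: simps parallel_def)
    then have "hom (vert_cat ?S) F G = {s. is_lax_cell V s \<and> SrcC s = F \<and> TrgC s = G}"
      "hom (vert_cat ?T) (oplax_of V F) (oplax_of V G) =
        {t. is_oplax_cell V t \<and> SrcC t = oplax_of V F \<and> TrgC t = oplax_of V G}"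
      by (auto simp: hom_def simps vmodule.left_representable_dmod_of is_lax_morD)
    then show ?thesis
      using bij_betw_oplax_cell_of[OF FG] by simp
  qed
  show "\<exists>N \<in> Ob0 ?S. \<exists>E \<in> hom (one_cat ?T) (dmod_of V N) M. iso_in (one_cat ?T) E"
    if M: "M \<in> Ob0 ?T" for M
  proof -
    have "dmodule V M" "left_representable V M"
      using M by (auto simp: simps)
    then obtain N E E' where "vmodule V N" "is_oplax_mor V E" "Src E = dmod_of V N" "Trg E = M"
        "is_oplax_mor V E'" "Src E' = M" "Trg E' = dmod_of V N"
        "comp_oplax V E E' = id_oplax V M" "comp_oplax V E' E = id_oplax V (dmod_of V N)"
      by (rule left_representable_iso_dmod_of)
    then show ?thesis
      using \<open>left_representable V M\<close>
      by (intro bexI[of _ N] bexI[of _ E])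
        (auto simp: iso_in_def hom_def simps vmodule.left_representable_dmod_of intro!: exI[of _ E'])
  qed
qed

end
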